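(* $\mathrm{RCA}_0 + \mathrm{I}\Sigma^0_2 + \forall f\,\exists k\,\mathrm{DNR}(k,f) \vdash \forall f\,\mathrm{DNR}(2,f)$.
   Context: All theories are in the language of second-order arithmetic; $\mathbb{N}$ denotes the first-order part of the structure under consideration, and $f,g$ range over functions $\mathbb{N}\to\mathbb{N}$. $\mathrm{PA}^-$ denotes the axioms of a discretely ordered commutative semi-ring with $1$. $\mathrm{RCA}_0$ consists of $\mathrm{PA}^-$, the $\Sigma^0_1$ induction scheme, and the $\Delta^0_1$ comprehension scheme (number and set parameters allowed). $\mathrm{I}\Sigma^0_2$ is the induction scheme for $\Sigma^0_2$ formulas (number and set parameters allowed). $\Phi^f_e$ denotes the $e$th Turing functional with oracle $f$, formalized in $\mathrm{RCA}_0$ via coded computations. For $k \in \mathbb{N}$: $g$ is $k$-bounded if $\mathrm{ran}(g) \subseteq \{0,\dots,k-1\}$; $g$ is diagonally non-recursive relative to $f$ if $\forall e\,(g(e) \neq \Phi^f_e(e))$ (the inequality counts as true when $\Phi^f_e(e)$ diverges). $\mathrm{DNR}(k,f)$ is the statement ``there is a $k$-bounded $g$ that is diagonally non-recursive relative to $f$.'' *)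

theory Defs
  imports Main
begin

section \<open>The language of second-order arithmetic\<close>

text \<open>
  Two-sorted first-order logic with de Bruijn indices.  Number variables and set variables have
  separate index spaces: \<open>AllN\<close> binds number variable \<open>0\<close> and leaves set variables alone,
  \<open>AllS\<close> binds set variable \<open>0\<close> and leaves number variables alone.
\<close>

datatype tm =
    V nat
  | Zero (\<open>\<^bold>0\<close>)
  | One (\<open>\<^bold>1\<close>)
  | Add tm tm (infixl \<open>\<^bold>+\<close> 65)
  | Mul tm tm (infixl \<open>\<^bold>*\<close> 70)

datatype fm =
    Eq tm tm (infix \<open>\<^bold>=\<close> 50)
  | Less tm tm (infix \<open>\<^bold><\<close> 50)
  | Mem tm nat (infix \<open>\<^bold>\<in>\<close> 50)
  | Fls (\<open>\<^bold>\<bottom>\<close>)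
  | Imp fm fm (infixr \<open>\<^bold>\<longrightarrow>\<close> 25)
  | AllN fm
  | AllS fm

definition Neg :: "fm \<Rightarrow> fm" (\<open>\<^bold>\<not> _\<close> [40] 40)
  where "(\<^bold>\<not> \<phi>) = (\<phi> \<^bold>\<longrightarrow> \<^bold>\<bottom>)"

definition Or :: "fm \<Rightarrow> fm \<Rightarrow> fm" (infixr \<open>\<^bold>\<or>\<close> 30)
  where "(\<phi> \<^bold>\<or> \<psi>) = (\<^bold>\<not> \<phi> \<^bold>\<longrightarrow> \<psi>)"

definition And :: "fm \<Rightarrow> fm \<Rightarrow> fm" (infixr \<open>\<^bold>\<and>\<close> 35)
  where "(\<phi> \<^bold>\<and> \<psi>) = (\<^bold>\<not> (\<phi> \<^bold>\<longrightarrow> \<^bold>\<not> \<psi>))"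

definition Iff :: "fm \<Rightarrow> fm \<Rightarrow> fm" (infix \<open>\<^bold>\<longleftrightarrow>\<close> 25)
  where "(\<phi> \<^bold>\<longleftrightarrow> \<psi>) = ((\<phi> \<^bold>\<longrightarrow> \<psi>) \<^bold>\<and> (\<psi> \<^bold>\<longrightarrow> \<phi>))"

definition ExN :: "fm \<Rightarrow> fm"
  where "ExN \<phi> = (\<^bold>\<not> AllN (\<^bold>\<not> \<phi>))"

definition ExS :: "fm \<Rightarrow> fm"
  where "ExS \<phi> = (\<^bold>\<not> AllS (\<^bold>\<not> \<phi>))"

definition Leq :: "tm \<Rightarrow> tm \<Rightarrow> fm" (infix \<open>\<^bold>\<le>\<close> 50)
  where "(s \<^bold>\<le> t) = (s \<^bold>< t \<^bold>\<or> s \<^bold>= t)"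

text \<open>Simultaneous substitution of terms for number variables and of set variables for set variables.\<close>

primrec sub_tm :: "(nat \<Rightarrow> tm) \<Rightarrow> tm \<Rightarrow> tm" where
  "sub_tm \<sigma> (V i) = \<sigma> i"
| "sub_tm \<sigma> \<^bold>0 = \<^bold>0"
| "sub_tm \<sigma> \<^bold>1 = \<^bold>1"
| "sub_tm \<sigma> (s \<^bold>+ t) = sub_tm \<sigma> s \<^bold>+ sub_tm \<sigma> t"
| "sub_tm \<sigma> (s \<^bold>* t) = sub_tm \<sigma> s \<^bold>* sub_tm \<sigma> t"

text \<open>\<open>up n t\<close> is \<open>t\<close> moved under \<open>n\<close> number quantifiers.\<close>

definition up :: "nat \<Rightarrow> tm \<Rightarrow> tm"
  where "up n t = sub_tm (\<lambda>i. V (i + n)) t"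

primrec sub_fm :: "(nat \<Rightarrow> tm) \<Rightarrow> (nat \<Rightarrow> nat) \<Rightarrow> fm \<Rightarrow> fm" where
  "sub_fm \<sigma> \<rho> (s \<^bold>= t) = (sub_tm \<sigma> s \<^bold>= sub_tm \<sigma> t)"
| "sub_fm \<sigma> \<rho> (s \<^bold>< t) = (sub_tm \<sigma> s \<^bold>< sub_tm \<sigma> t)"
| "sub_fm \<sigma> \<rho> (t \<^bold>\<in> X) = (sub_tm \<sigma> t \<^bold>\<in> \<rho> X)"
| "sub_fm \<sigma> \<rho> \<^bold>\<bottom> = \<^bold>\<bottom>"
| "sub_fm \<sigma> \<rho> (\<phi> \<^bold>\<longrightarrow> \<psi>) = (sub_fm \<sigma> \<rho> \<phi> \<^bold>\<longrightarrow> sub_fm \<sigma> \<rho> \<psi>)"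
| "sub_fm \<sigma> \<rho> (AllN \<phi>) = AllN (sub_fm (case_nat (V 0) (\<lambda>i. up 1 (\<sigma> i))) \<rho> \<phi>)"
| "sub_fm \<sigma> \<rho> (AllS \<phi>) = AllS (sub_fm \<sigma> (case_nat 0 (\<lambda>i. Suc (\<rho> i))) \<phi>)"

definition liftN :: "fm \<Rightarrow> fm"
  where "liftN = sub_fm (\<lambda>i. V (Suc i)) (\<lambda>X. X)"

definition liftS :: "fm \<Rightarrow> fm"
  where "liftS = sub_fm V Suc"

definition instN :: "tm \<Rightarrow> fm \<Rightarrow> fm"
  where "instN t = sub_fm (case_nat t V) (\<lambda>X. X)"

definition instS :: "nat \<Rightarrow> fm \<Rightarrow> fm"
  where "instS Y = sub_fm V (case_nat Y (\<lambda>X. X))"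

text \<open>\<open>fv_below m k \<phi>\<close>: the free number variables of \<open>\<phi>\<close> are below \<open>m\<close>, the free set variables below \<open>k\<close>.\<close>

primrec fv_below_tm :: "nat \<Rightarrow> tm \<Rightarrow> bool" where
  "fv_below_tm m (V i) \<longleftrightarrow> i < m"
| "fv_below_tm m \<^bold>0 \<longleftrightarrow> True"
| "fv_below_tm m \<^bold>1 \<longleftrightarrow> True"
| "fv_below_tm m (s \<^bold>+ t) \<longleftrightarrow> fv_below_tm m s \<and> fv_below_tm m t"
| "fv_below_tm m (s \<^bold>* t) \<longleftrightarrow> fv_below_tm m s \<and> fv_below_tm m t"

primrec fv_below :: "nat \<Rightarrow> nat \<Rightarrow> fm \<Rightarrow> bool" where
  "fv_below m k (s \<^bold>= t) \<longleftrightarrow> fv_below_tm m s \<and> fv_below_tm m t"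
| "fv_below m k (s \<^bold>< t) \<longleftrightarrow> fv_below_tm m s \<and> fv_below_tm m t"
| "fv_below m k (t \<^bold>\<in> X) \<longleftrightarrow> fv_below_tm m t \<and> X < k"
| "fv_below m k \<^bold>\<bottom> \<longleftrightarrow> True"
| "fv_below m k (\<phi> \<^bold>\<longrightarrow> \<psi>) \<longleftrightarrow> fv_below m k \<phi> \<and> fv_below m k \<psi>"
| "fv_below m k (AllN \<phi>) \<longleftrightarrow> fv_below (Suc m) k \<phi>"
| "fv_below m k (AllS \<phi>) \<longleftrightarrow> fv_below m (Suc k) \<phi>"

definition universal_closures :: "fm set \<Rightarrow> fm set" where
  "universal_closures A = {(AllS ^^ k) ((AllN ^^ m) \<phi>) | m k \<phi>. \<phi> \<in> A \<and> fv_below m k \<phi>}"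


section \<open>Provability\<close>

text \<open>
  Classical natural deduction for two-sorted first-order logic with equality between numbers
  (equality of sets is not a primitive of the language).  The set of hypotheses may be infinite;
  derivations are finite trees.
\<close>

inductive proves :: "fm set \<Rightarrow> fm \<Rightarrow> bool" (infix \<open>\<turnstile>\<close> 20) where
  Hyp: "\<phi> \<in> \<Gamma> \<Longrightarrow> \<Gamma> \<turnstile> \<phi>"
| Imp_I: "insert \<phi> \<Gamma> \<turnstile> \<psi> \<Longrightarrow> \<Gamma> \<turnstile> (\<phi> \<^bold>\<longrightarrow> \<psi>)"
| Imp_E: "\<Gamma> \<turnstile> (\<phi> \<^bold>\<longrightarrow> \<psi>) \<Longrightarrow> \<Gamma> \<turnstile> \<phi> \<Longrightarrow> \<Gamma> \<turnstile> \<psi>"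
| RAA: "insert (\<^bold>\<not> \<phi>) \<Gamma> \<turnstile> \<^bold>\<bottom> \<Longrightarrow> \<Gamma> \<turnstile> \<phi>"
| AllN_I: "liftN ` \<Gamma> \<turnstile> \<phi> \<Longrightarrow> \<Gamma> \<turnstile> AllN \<phi>"
| AllN_E: "\<Gamma> \<turnstile> AllN \<phi> \<Longrightarrow> \<Gamma> \<turnstile> instN t \<phi>"
| AllS_I: "liftS ` \<Gamma> \<turnstile> \<phi> \<Longrightarrow> \<Gamma> \<turnstile> AllS \<phi>"
| AllS_E: "\<Gamma> \<turnstile> AllS \<phi> \<Longrightarrow> \<Gamma> \<turnstile> instS Y \<phi>"
| Eq_refl: "\<Gamma> \<turnstile> (t \<^bold>= t)"
| Eq_subst: "\<Gamma> \<turnstile> (s \<^bold>= t) \<Longrightarrow> \<Gamma> \<turnstile> instN s \<phi> \<Longrightarrow> \<Gamma> \<turnstile> instN t \<phi>"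


section \<open>The arithmetical hierarchy and the base theories\<close>

inductive_set Delta00 :: "fm set" where
  "(s \<^bold>= t) \<in> Delta00"
| "(s \<^bold>< t) \<in> Delta00"
| "(t \<^bold>\<in> X) \<in> Delta00"
| "\<^bold>\<bottom> \<in> Delta00"
| "\<phi> \<in> Delta00 \<Longrightarrow> \<psi> \<in> Delta00 \<Longrightarrow> (\<phi> \<^bold>\<longrightarrow> \<psi>) \<in> Delta00"
| "\<phi> \<in> Delta00 \<Longrightarrow> AllN (V 0 \<^bold>< up 1 t \<^bold>\<longrightarrow> \<phi>) \<in> Delta00"
| "\<phi> \<in> Delta00 \<Longrightarrow> ExN (V 0 \<^bold>< up 1 t \<^bold>\<and> \<phi>) \<in> Delta00"

fun Sigma0 :: "nat \<Rightarrow> fm set" and Pi0 :: "nat \<Rightarrow> fm set" where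
  "Sigma0 0 = Delta00"
| "Sigma0 (Suc n) = ExN ` Pi0 n"
| "Pi0 0 = Delta00"
| "Pi0 (Suc n) = AllN ` Sigma0 n"

definition PA_minus :: "fm set" where
  "PA_minus = universal_closures (let x = V 0; y = V 1; z = V 2 in
    { (x \<^bold>+ y) \<^bold>+ z \<^bold>= x \<^bold>+ (y \<^bold>+ z),
      x \<^bold>+ y \<^bold>= y \<^bold>+ x,
      (x \<^bold>* y) \<^bold>* z \<^bold>= x \<^bold>* (y \<^bold>* z),
      x \<^bold>* y \<^bold>= y \<^bold>* x,
      x \<^bold>* (y \<^bold>+ z) \<^bold>= x \<^bold>* y \<^bold>+ x \<^bold>* z,
      x \<^bold>+ \<^bold>0 \<^bold>= x,
      x \<^bold>* \<^bold>0 \<^bold>= \<^bold>0,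
      x \<^bold>* \<^bold>1 \<^bold>= x,
      (x \<^bold>< y \<^bold>\<and> y \<^bold>< z) \<^bold>\<longrightarrow> x \<^bold>< z,
      \<^bold>\<not> x \<^bold>< x,
      x \<^bold>< y \<^bold>\<or> x \<^bold>= y \<^bold>\<or> y \<^bold>< x,
      x \<^bold>< y \<^bold>\<longrightarrow> x \<^bold>+ z \<^bold>< y \<^bold>+ z,
      (\<^bold>0 \<^bold>< z \<^bold>\<and> x \<^bold>< y) \<^bold>\<longrightarrow> x \<^bold>* z \<^bold>< y \<^bold>* z,
      x \<^bold>< y \<^bold>\<longrightarrow> ExN (up 1 x \<^bold>+ V 0 \<^bold>= up 1 y),
      \<^bold>0 \<^bold>< \<^bold>1,
      \<^bold>0 \<^bold>< x \<^bold>\<longrightarrow> \<^bold>1 \<^bold>\<le> x,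
      \<^bold>0 \<^bold>\<le> x })"

text \<open>Induction and comprehension act on number variable \<open>0\<close>; all other free variables are parameters.\<close>

definition induction :: "fm \<Rightarrow> fm" where
  "induction \<phi> =
     (instN \<^bold>0 \<phi> \<^bold>\<and>
      AllN (\<phi> \<^bold>\<longrightarrow> sub_fm (case_nat (V 0 \<^bold>+ \<^bold>1) (\<lambda>i. V (Suc i))) (\<lambda>X. X) \<phi>)
      \<^bold>\<longrightarrow> AllN \<phi>)"

definition comprehension :: "fm \<Rightarrow> fm \<Rightarrow> fm" where
  "comprehension \<phi> \<psi> =
     (AllN (\<phi> \<^bold>\<longleftrightarrow> \<psi>) \<^bold>\<longrightarrow> ExS (AllN (V 0 \<^bold>\<in> 0 \<^bold>\<longleftrightarrow> liftS \<phi>)))"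

definition I_Sigma0 :: "nat \<Rightarrow> fm set"
  where "I_Sigma0 n = universal_closures (induction ` Sigma0 n)"

definition Delta01_CA :: "fm set" where
  "Delta01_CA = universal_closures {comprehension \<phi> \<psi> | \<phi> \<psi>. \<phi> \<in> Sigma0 1 \<and> \<psi> \<in> Pi0 1}"

definition RCA0 :: "fm set"
  where "RCA0 = PA_minus \<union> I_Sigma0 1 \<union> Delta01_CA"


section \<open>Coding of functions and finite sequences\<close>

primrec num :: "nat \<Rightarrow> tm" where
  "num 0 = \<^bold>0"
| "num (Suc n) = num n \<^bold>+ \<^bold>1"

text \<open>Simpson's pairing function \<open>(s + t)\<^sup>2 + s\<close>, injective but not onto.\<close>

definition pair :: "tm \<Rightarrow> tm \<Rightarrow> tm"
  where "pair s t = (s \<^bold>+ t) \<^bold>* (s \<^bold>+ t) \<^bold>+ s"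

text \<open>A function is a set of codes of pairs, the graph of the function.\<close>

definition App :: "nat \<Rightarrow> tm \<Rightarrow> tm \<Rightarrow> fm"
  where "App F s t = (pair s t \<^bold>\<in> F)"

definition IsFun :: "nat \<Rightarrow> fm" where
  "IsFun F =
     (AllN (V 0 \<^bold>\<in> F \<^bold>\<longrightarrow> ExN (ExN (V 2 \<^bold>= pair (V 1) (V 0)))) \<^bold>\<and>
      AllN (ExN (App F (V 1) (V 0))) \<^bold>\<and>
      AllN (AllN (AllN (App F (V 2) (V 1) \<^bold>\<and> App F (V 2) (V 0) \<^bold>\<longrightarrow> V 1 \<^bold>= V 0))))"

definition Rem :: "tm \<Rightarrow> tm \<Rightarrow> tm \<Rightarrow> fm" where
  "Rem s m x = (x \<^bold>< m \<^bold>\<and> ExN (up 1 s \<^bold>= V 0 \<^bold>* up 1 m \<^bold>+ up 1 x))"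

text \<open>
  The code \<open>\<langle>n, \<langle>a, b\<rangle>\<rangle>\<close> stands for the sequence of length \<open>n\<close> whose \<open>i\<close>-th entry is given by
  Goedel's beta function, the remainder of \<open>a\<close> modulo \<open>b (i + 1) + 1\<close>.
\<close>

definition Len :: "tm \<Rightarrow> tm \<Rightarrow> fm" where
  "Len s n = ExN (ExN (up 2 s \<^bold>= pair (up 2 n) (pair (V 1) (V 0))))"

definition Entry :: "tm \<Rightarrow> tm \<Rightarrow> tm \<Rightarrow> fm" where
  "Entry s i x = ExN (ExN (ExN (
     let s = up 3 s; i = up 3 i; x = up 3 x; n = V 2; a = V 1; b = V 0 in
     s \<^bold>= pair n (pair a b) \<^bold>\<and> i \<^bold>< n \<^bold>\<and> Rem a (b \<^bold>* (i \<^bold>+ \<^bold>1) \<^bold>+ \<^bold>1) x)))"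


section \<open>Turing functionals\<close>

text \<open>
  \<open>\<Phi>\<^sub>e\<close> is the functional computed by the oracle register machine with program \<open>e\<close>.  A program is
  (the code of) a finite sequence of instructions \<open>\<langle>op, \<langle>a, \<langle>b, c\<rangle>\<rangle>\<rangle>\<close>, with the following effect on
  the registers \<open>R\<close> and the program counter, relative to an oracle \<open>f\<close>:

    \<^item> \<open>op = 0\<close>:  \<open>R\<^sub>a := b\<close>
    \<^item> \<open>op = 1\<close>:  \<open>R\<^sub>a := R\<^sub>b + R\<^sub>c\<close>
    \<^item> \<open>op = 2\<close>:  \<open>R\<^sub>a := R\<^sub>b * R\<^sub>c\<close>
    \<^item> \<open>op = 3\<close>:  \<open>R\<^sub>a := f(R\<^sub>b)\<close>
    \<^item> \<open>op = 4\<close>:  if \<open>R\<^sub>b < R\<^sub>c\<close> then go to instruction \<open>a\<close>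

  The input is placed in register \<open>0\<close>, all other registers start with \<open>0\<close>, the machine halts when
  the program counter leaves the program, and the output is the content of register \<open>0\<close>.  If
  \<open>e\<close> is not a code of a sequence, or an entry without a valid \<open>op\<close> is to be executed, the
  computation diverges.

  A configuration is a pair of a program counter and a sequence coding the registers.  The number of
  registers is constant along a computation but otherwise arbitrary; a computation that addresses a
  register outside this range is stuck, and so does not witness convergence.
\<close>

text \<open>\<open>Upd r a v r'\<close>: \<open>r'\<close> is \<open>r\<close> with entry \<open>a\<close> replaced by \<open>v\<close>.\<close>

definition Upd :: "tm \<Rightarrow> tm \<Rightarrow> tm \<Rightarrow> tm \<Rightarrow> fm" where
  "Upd r a v r' =
     (ExN (Len (up 1 r) (V 0) \<^bold>\<and> Len (up 1 r') (V 0) \<^bold>\<and> up 1 a \<^bold>< V 0) \<^bold>\<and>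
      Entry r' a v \<^bold>\<and>
      AllN (AllN (let r = up 2 r; a = up 2 a; r' = up 2 r'; i = V 1; x = V 0 in
        \<^bold>\<not> i \<^bold>= a \<^bold>\<and> Entry r i x \<^bold>\<longrightarrow> Entry r' i x)))"

definition Exec :: "nat \<Rightarrow> tm \<Rightarrow> tm \<Rightarrow> tm \<Rightarrow> tm \<Rightarrow> tm \<Rightarrow> fm" where
  "Exec F q p r p' r' = ExN (ExN (ExN (ExN (ExN (
     let q = up 5 q; p = up 5 p; r = up 5 r; p' = up 5 p'; r' = up 5 r';
         a = V 4; b = V 3; c = V 2; u = V 1; v = V 0;
         instr = (\<lambda>op. q \<^bold>= pair (num op) (pair a (pair b c)))
     in
       (instr 0 \<^bold>\<and> Upd r a b r' \<^bold>\<and> p' \<^bold>= p \<^bold>+ \<^bold>1)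
     \<^bold>\<or> (instr 1 \<^bold>\<and> Entry r b u \<^bold>\<and> Entry r c v \<^bold>\<and> Upd r a (u \<^bold>+ v) r' \<^bold>\<and> p' \<^bold>= p \<^bold>+ \<^bold>1)
     \<^bold>\<or> (instr 2 \<^bold>\<and> Entry r b u \<^bold>\<and> Entry r c v \<^bold>\<and> Upd r a (u \<^bold>* v) r' \<^bold>\<and> p' \<^bold>= p \<^bold>+ \<^bold>1)
     \<^bold>\<or> (instr 3 \<^bold>\<and> Entry r b u \<^bold>\<and> App F u v \<^bold>\<and> Upd r a v r' \<^bold>\<and> p' \<^bold>= p \<^bold>+ \<^bold>1)
     \<^bold>\<or> (instr 4 \<^bold>\<and> Entry r b u \<^bold>\<and> Entry r c v \<^bold>\<and> r' \<^bold>= r \<^bold>\<and>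
          ((u \<^bold>< v \<^bold>\<and> p' \<^bold>= a) \<^bold>\<or> (\<^bold>\<not> u \<^bold>< v \<^bold>\<and> p' \<^bold>= p \<^bold>+ \<^bold>1))))))))"

definition Step :: "nat \<Rightarrow> tm \<Rightarrow> tm \<Rightarrow> tm \<Rightarrow> fm" where
  "Step F e s s' = ExN (ExN (ExN (ExN (ExN (
     let e = up 5 e; s = up 5 s; s' = up 5 s'; p = V 4; r = V 3; p' = V 2; r' = V 1; q = V 0 in
     s \<^bold>= pair p r \<^bold>\<and> s' \<^bold>= pair p' r' \<^bold>\<and> Entry e p q \<^bold>\<and> Exec F q p r p' r')))))"

definition Initial :: "tm \<Rightarrow> tm \<Rightarrow> fm" where
  "Initial s x = ExN (let s = up 1 s; x = up 1 x; r = V 0 in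
     s \<^bold>= pair \<^bold>0 r \<^bold>\<and> Entry r \<^bold>0 x \<^bold>\<and>
     AllN (AllN (Entry (up 2 r) (V 1) (V 0) \<^bold>\<longrightarrow> V 1 \<^bold>= \<^bold>0 \<^bold>\<or> V 0 \<^bold>= \<^bold>0)))"

definition Final :: "tm \<Rightarrow> tm \<Rightarrow> tm \<Rightarrow> fm" where
  "Final e s y = ExN (ExN (ExN (
     let e = up 3 e; s = up 3 s; y = up 3 y; p = V 2; r = V 1; n = V 0 in
     s \<^bold>= pair p r \<^bold>\<and> Len e n \<^bold>\<and> n \<^bold>\<le> p \<^bold>\<and> Entry r \<^bold>0 y)))"

text \<open>
  \<open>Phi F e x y\<close>: there is a coded computation \<open>w\<close>, of some number \<open>t\<close> of steps, witnessing
  \<open>\<Phi>\<^sub>e\<^sup>f(x) = y\<close>, where \<open>f\<close> is the function with graph \<open>F\<close>.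
\<close>

definition Phi :: "nat \<Rightarrow> tm \<Rightarrow> tm \<Rightarrow> tm \<Rightarrow> fm" where
  "Phi F e x y = ExN (ExN (
     let e = up 2 e; x = up 2 x; y = up 2 y; w = V 1; t = V 0 in
     Len w (t \<^bold>+ \<^bold>1) \<^bold>\<and>
     ExN (Entry (up 1 w) \<^bold>0 (V 0) \<^bold>\<and> Initial (V 0) (up 1 x)) \<^bold>\<and>
     AllN (V 0 \<^bold>< up 1 t \<^bold>\<longrightarrow>
       ExN (ExN (let w = up 3 w; e = up 3 e; i = V 2; s = V 1; s' = V 0 in
         Entry w i s \<^bold>\<and> Entry w (i \<^bold>+ \<^bold>1) s' \<^bold>\<and> Step F e s s'))) \<^bold>\<and>
     ExN (Entry (up 1 w) (up 1 t) (V 0) \<^bold>\<and> Final (up 1 e) (V 0) (up 1 y))))"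


section \<open>Diagonally non-recursive functions\<close>

definition Bounded :: "tm \<Rightarrow> nat \<Rightarrow> fm" where
  "Bounded k G = AllN (AllN (App G (V 1) (V 0) \<^bold>\<longrightarrow> V 0 \<^bold>< up 2 k))"

definition DiagNonRec :: "nat \<Rightarrow> nat \<Rightarrow> fm" where
  "DiagNonRec G F = AllN (AllN (App G (V 1) (V 0) \<^bold>\<longrightarrow> \<^bold>\<not> Phi F (V 1) (V 1) (V 0)))"

text \<open>The quantified \<open>g\<close> becomes set variable \<open>0\<close>, so the oracle \<open>F\<close> is shifted to \<open>Suc F\<close>.\<close>

definition DNR :: "tm \<Rightarrow> nat \<Rightarrow> fm" where
  "DNR k F = ExS (IsFun 0 \<^bold>\<and> Bounded k 0 \<^bold>\<and> DiagNonRec 0 (Suc F))"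

definition AllFun :: "fm \<Rightarrow> fm"
  where "AllFun \<phi> = AllS (IsFun 0 \<^bold>\<longrightarrow> \<phi>)"

end

(*
  By completeness it suffices to work in a model. Let g be k-bounded and DNR relative to f. A value
  u < k is read as the 0/1-vector ([i = u])_{i<k}. By an s-m-n argument there is, for every sequence
  s of length k, a program e such that Phi_e(e) is the u < k with Phi_{s_i}(s_i) = [i = u] for all
  i < k, if there is one; so g(e) is not such a u. Let P(j) say that some sequence a of length k has
  the property that for no s agreeing with a below j, and no program e for s, does
  Phi_{s_i}(s_i) = [i = g(e)] hold for all i with j <= i < k. This is Sigma_2, P(0) holds and P(k)
  fails, so Sigma_2 induction gives j with P(j) and not P(j + 1). Fix a for P(j). For every z, failure
  of P(j + 1) for a with a_j := z yields s with s_j = z and e with Phi_{s_i}(s_i) = [i = g(e)] for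
  all i > j; they are found by search, and h(z) := [j = g(e)] differs from Phi_z(z) by P(j).
*)
theory Submission
  imports Defs "HOL-Library.Countable"
begin

text \<open>The bound k may be a nonstandard element of the model, so the passage from P(0) to P(k)
  cannot be a recursion in the metatheory; it has to be one instance of induction inside the model.
  This dictates the shape of P. All k computations in a condition on s are required to converge by
  one common stage c, so that the condition is bounded once s, e, u = g(e) and c are given, and P(j)
  has just one quantifier of each kind in front of a bounded matrix.

  The same distinction governs the programs. The formula behind the s-m-n argument is a fixed one of
  the metatheory, so recursion on its syntax compiles it into standardly many instructions and
  registers. Only the constants in the program and the lengths of its loops may be nonstandard, and
  the loops are handled by induction in the model.

  The vectors make u unique: for u \<noteq> u' the program s_u would have to output both 1 and 0.
  Sequence codes are not unique, so being a program for s is a relation, and determinism of the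
  machine is proved only up to agreement of register contents.\<close>

section \<open>Substitution\<close>

declare One_nat_def [simp del]

abbreviation slift :: "(nat \<Rightarrow> tm) \<Rightarrow> nat \<Rightarrow> tm"
  where "slift \<sigma> \<equiv> case_nat (V 0) (\<lambda>i. up 1 (\<sigma> i))"

lemma sub_tm_sub_tm: "sub_tm \<sigma> (sub_tm \<tau> t) = sub_tm (\<lambda>i. sub_tm \<sigma> (\<tau> i)) t"
  by (induction t) auto

lemma sub_tm_V [simp]: "sub_tm V t = t"
  by (induction t) auto

lemma up_sub_tm: "up n (sub_tm \<sigma> t) = sub_tm (\<lambda>i. up n (\<sigma> i)) t"
  by (simp add: up_def sub_tm_sub_tm)

lemma sub_tm_up: "sub_tm \<sigma> (up n t) = sub_tm (\<lambda>i. \<sigma> (i + n)) t"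
  by (simp add: up_def sub_tm_sub_tm)

lemma slift_comp: "(\<lambda>i. sub_tm (slift \<sigma>) (slift \<tau> i)) = slift (\<lambda>i. sub_tm \<sigma> (\<tau> i))"
  by (auto simp: fun_eq_iff One_nat_def sub_tm_up up_sub_tm split: nat.split)

lemma slift_V [simp]: "slift V = V"
  by (auto simp: fun_eq_iff up_def split: nat.split)

lemma case_nat_Suc_id [simp]: "case_nat 0 Suc = (\<lambda>i. i)"
  by (auto simp: fun_eq_iff split: nat.split)

text \<open>The calculus of lifts and instances rests on this: \<open>liftN\<close>,
  \<open>liftS\<close>, \<open>instN\<close> and \<open>instS\<close> are each one simultaneous
  substitution, so commuting two of them means comparing two functions on indices.\<close>

lemma sub_fm_sub_fm:
  "sub_fm \<sigma> \<rho> (sub_fm \<tau> \<pi> \<phi>) = sub_fm (\<lambda>i. sub_tm \<sigma> (\<tau> i)) (\<lambda>X. \<rho> (\<pi> X)) \<phi>"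
proof (induction \<phi> arbitrary: \<sigma> \<rho> \<tau> \<pi>)
  case (AllN \<phi>)
  then show ?case by (simp only: sub_fm.simps slift_comp)
next
  case (AllS \<phi>)
  have "(\<lambda>X. case_nat 0 (\<lambda>i. Suc (\<rho> i)) (case_nat 0 (\<lambda>i. Suc (\<pi> i)) X))
      = case_nat 0 (\<lambda>i. Suc (\<rho> (\<pi> i)))"
    by (auto simp: fun_eq_iff split: nat.split)
  with AllS show ?case by (simp only: sub_fm.simps)
qed (auto simp: sub_tm_sub_tm)

lemma sub_fm_V [simp]: "sub_fm V (\<lambda>X. X) \<phi> = \<phi>"
proof (induction \<phi>)
  case (AllN \<phi>)
  then show ?case by (simp only: sub_fm.simps slift_V)
next
  case (AllS \<phi>)
  then show ?case by (simp only: sub_fm.simps case_nat_Suc_id)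
qed simp_all

lemma sub_fm_connectives [simp]:
  "sub_fm \<sigma> \<rho> (\<^bold>\<not> \<phi>) = (\<^bold>\<not> sub_fm \<sigma> \<rho> \<phi>)"
  "sub_fm \<sigma> \<rho> (\<phi> \<^bold>\<and> \<psi>) = (sub_fm \<sigma> \<rho> \<phi> \<^bold>\<and> sub_fm \<sigma> \<rho> \<psi>)"
  "sub_fm \<sigma> \<rho> (ExN \<chi>) = ExN (sub_fm (slift \<sigma>) \<rho> \<chi>)"
  by (simp_all add: Neg_def And_def ExN_def)

lemma sub_fm_liftN: "sub_fm (slift \<sigma>) \<rho> (liftN \<phi>) = liftN (sub_fm \<sigma> \<rho> \<phi>)"
  by (simp add: liftN_def sub_fm_sub_fm up_def One_nat_def)

lemma sub_fm_liftS:
  "sub_fm \<sigma> (case_nat 0 (\<lambda>i. Suc (\<rho> i))) (liftS \<phi>) = liftS (sub_fm \<sigma> \<rho> \<phi>)"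
  by (simp add: liftS_def sub_fm_sub_fm)

lemma sub_fm_instN: "sub_fm \<sigma> \<rho> (instN t \<phi>) = instN (sub_tm \<sigma> t) (sub_fm (slift \<sigma>) \<rho> \<phi>)"
proof -
  have "(\<lambda>i. sub_tm \<sigma> (case_nat t V i))
      = (\<lambda>i. sub_tm (case_nat (sub_tm \<sigma> t) V) (slift \<sigma> i))"
    by (auto simp: fun_eq_iff One_nat_def sub_tm_up split: nat.split)
  then show ?thesis by (simp add: instN_def sub_fm_sub_fm)
qed

lemma sub_fm_instS:
  "sub_fm \<sigma> \<rho> (instS Y \<phi>) = instS (\<rho> Y) (sub_fm \<sigma> (case_nat 0 (\<lambda>i. Suc (\<rho> i))) \<phi>)"
proof -
  have "(\<lambda>X. \<rho> (case_nat Y (\<lambda>X. X) X))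
      = (\<lambda>X. case_nat (\<rho> Y) (\<lambda>X. X) (case_nat 0 (\<lambda>i. Suc (\<rho> i)) X))"
    by (auto simp: fun_eq_iff split: nat.split)
  then show ?thesis by (simp add: instS_def sub_fm_sub_fm)
qed

text \<open>In the quantifier case of the truth lemma, this turns an instance of a substituted body
  back into one simultaneous substitution, to which the induction hypothesis applies.\<close>

lemma instN_slift: "instN t (sub_fm (slift \<sigma>) \<rho> \<phi>) = sub_fm (case_nat t \<sigma>) \<rho> \<phi>"
proof -
  have "(\<lambda>i. sub_tm (case_nat t V) (slift \<sigma> i)) = case_nat t \<sigma>"
    by (auto simp: fun_eq_iff One_nat_def sub_tm_up split: nat.split)
  then show ?thesis by (simp add: instN_def sub_fm_sub_fm)
qed

lemma instS_slift:
  "instS Y (sub_fm \<sigma> (case_nat 0 (\<lambda>i. Suc (\<rho> i))) \<phi>) = sub_fm \<sigma> (case_nat Y \<rho>) \<phi>"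
proof -
  have "(\<lambda>X. case_nat Y (\<lambda>X. X) (case_nat 0 (\<lambda>i. Suc (\<rho> i)) X)) = case_nat Y \<rho>"
    by (auto simp: fun_eq_iff split: nat.split)
  then show ?thesis by (simp add: instS_def sub_fm_sub_fm)
qed

section \<open>Bounds on free variables\<close>

lemma fv_below_tm_mono: "fv_below_tm m t \<Longrightarrow> m \<le> m' \<Longrightarrow> fv_below_tm m' t"
  by (induction t) auto

lemma fv_below_mono: "fv_below m k \<phi> \<Longrightarrow> m \<le> m' \<Longrightarrow> k \<le> k' \<Longrightarrow> fv_below m' k' \<phi>"
proof (induction \<phi> arbitrary: m k m' k')
  case (AllN \<phi>)
  show ?case using AllN.IH[of "Suc m" k "Suc m'" k'] AllN.prems by simp
next
  case (AllS \<phi>)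
  show ?case using AllS.IH[of m "Suc k" m' "Suc k'"] AllS.prems by simp
qed (auto intro: fv_below_tm_mono)

lemma ex_fv_below_tm: "\<exists>m. fv_below_tm m t"
proof (induction t)
  case (Add s t)
  then obtain m n where "fv_below_tm m s" "fv_below_tm n t" by blast
  then show ?case by (auto intro!: exI[of _ "max m n"] elim: fv_below_tm_mono)
next
  case (Mul s t)
  then obtain m n where "fv_below_tm m s" "fv_below_tm n t" by blast
  then show ?case by (auto intro!: exI[of _ "max m n"] elim: fv_below_tm_mono)
qed auto

lemma ex_fv_below: "\<exists>m k. fv_below m k \<phi>"
proof (induction \<phi>)
  case (Eq s t)
  obtain m n where "fv_below_tm m s" "fv_below_tm n t" using ex_fv_below_tm by metis
  then show ?case by (auto intro!: exI[of _ "max m n"] elim: fv_below_tm_mono)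
next
  case (Less s t)
  obtain m n where "fv_below_tm m s" "fv_below_tm n t" using ex_fv_below_tm by metis
  then show ?case by (auto intro!: exI[of _ "max m n"] elim: fv_below_tm_mono)
next
  case (Mem t X)
  obtain m where "fv_below_tm m t" using ex_fv_below_tm by metis
  then show ?case by (metis fv_below.simps(3) lessI)
next
  case (Imp \<phi> \<psi>)
  then obtain m k n l where "fv_below m k \<phi>" "fv_below n l \<psi>" by blast
  then have "fv_below (max m n) (max k l) \<phi>" "fv_below (max m n) (max k l) \<psi>"
    by (auto elim: fv_below_mono)
  then show ?case by auto
next
  case (AllN \<phi>)
  then obtain m k where "fv_below m k \<phi>" by blast
  then have "fv_below (Suc m) k \<phi>" by (rule fv_below_mono) auto
  then show ?case by auto
next
  case (AllS \<phi>)
  then obtain m k where "fv_below m k \<phi>" by blast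
  then have "fv_below m (Suc k) \<phi>" by (rule fv_below_mono) auto
  then show ?case by auto
qed auto

lemma sub_tm_cong: "fv_below_tm m t \<Longrightarrow> (\<And>i. i < m \<Longrightarrow> \<sigma> i = \<tau> i) \<Longrightarrow> sub_tm \<sigma> t = sub_tm \<tau> t"
  by (induction t) auto

lemma sub_fm_cong:
  "fv_below m k \<phi> \<Longrightarrow> (\<And>i. i < m \<Longrightarrow> \<sigma> i = \<tau> i) \<Longrightarrow> (\<And>X. X < k \<Longrightarrow> \<rho> X = \<pi> X)
    \<Longrightarrow> sub_fm \<sigma> \<rho> \<phi> = sub_fm \<tau> \<pi> \<phi>"
proof (induction \<phi> arbitrary: m k \<sigma> \<tau> \<rho> \<pi>)
  case (AllN \<phi>)
  show ?case
    using AllN.prems by (auto intro!: AllN.IH[of "Suc m" k] split: nat.split)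
next
  case (AllS \<phi>)
  show ?case
    using AllS.prems by (auto intro!: AllS.IH[of m "Suc k"] split: nat.split)
next
  case (Eq s t)
  then show ?case using sub_tm_cong[of m s \<sigma> \<tau>] sub_tm_cong[of m t \<sigma> \<tau>] by auto
next
  case (Less s t)
  then show ?case using sub_tm_cong[of m s \<sigma> \<tau>] sub_tm_cong[of m t \<sigma> \<tau>] by auto
next
  case (Mem t X)
  then show ?case using sub_tm_cong[of m t \<sigma> \<tau>] by auto
next
  case (Imp \<phi> \<psi>)
  have "sub_fm \<sigma> \<rho> \<phi> = sub_fm \<tau> \<pi> \<phi>" "sub_fm \<sigma> \<rho> \<psi> = sub_fm \<tau> \<pi> \<psi>"
    using Imp.prems by (auto intro!: Imp.IH[of m k])
  then show ?case by simp
qed simp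


section \<open>Derivations\<close>

lemma proves_mono: "\<Gamma> \<turnstile> \<phi> \<Longrightarrow> \<Gamma> \<subseteq> \<Delta> \<Longrightarrow> \<Delta> \<turnstile> \<phi>"
proof (induction arbitrary: \<Delta> rule: proves.induct)
  case (Imp_I \<phi> \<Gamma> \<psi>)
  then show ?case by (meson insert_mono proves.Imp_I)
next
  case (RAA \<phi> \<Gamma>)
  then show ?case by (meson insert_mono proves.RAA)
next
  case (AllN_I \<Gamma> \<phi>)
  then show ?case by (meson image_mono proves.AllN_I)
next
  case (AllS_I \<Gamma> \<phi>)
  then show ?case by (meson image_mono proves.AllS_I)
next
  case (Hyp \<phi> \<Gamma>)
  then show ?case by (auto intro: proves.Hyp)
next
  case (Imp_E \<Gamma> \<phi> \<psi>)
  then show ?case by (metis proves.Imp_E)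
next
  case (Eq_subst \<Gamma> s t \<phi>)
  then show ?case by (metis proves.Eq_subst)
qed (simp_all add: proves.AllN_E proves.AllS_E proves.Eq_refl)

text \<open>\<open>AllN_I\<close> and \<open>AllS_I\<close> shift all hypotheses instead of asking
  for a fresh variable. Renaming whole derivations lets a variable that merely does not occur in the
  hypotheses play the part of the bound index.\<close>

lemma proves_sub_fm: "\<Gamma> \<turnstile> \<phi> \<Longrightarrow> sub_fm \<sigma> \<rho> ` \<Gamma> \<turnstile> sub_fm \<sigma> \<rho> \<phi>"
proof (induction arbitrary: \<sigma> \<rho> rule: proves.induct)
  case (AllN_I \<Gamma> \<phi>)
  have "liftN ` sub_fm \<sigma> \<rho> ` \<Gamma> \<turnstile> sub_fm (slift \<sigma>) \<rho> \<phi>"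
    using AllN_I.IH[of "slift \<sigma>" \<rho>] by (simp only: image_image sub_fm_liftN)
  then show ?case by (simp only: sub_fm.simps proves.AllN_I)
next
  case (AllS_I \<Gamma> \<phi>)
  have "liftS ` sub_fm \<sigma> \<rho> ` \<Gamma> \<turnstile> sub_fm \<sigma> (case_nat 0 (\<lambda>i. Suc (\<rho> i))) \<phi>"
    using AllS_I.IH[of \<sigma> "case_nat 0 (\<lambda>i. Suc (\<rho> i))"] by (simp only: image_image sub_fm_liftS)
  then show ?case by (simp only: sub_fm.simps proves.AllS_I)
next
  case (Eq_subst \<Gamma> s t \<phi>)
  then show ?case
    unfolding sub_fm_instN by (metis proves.Eq_subst sub_fm.simps(1))
next
  case (AllN_E \<Gamma> \<phi> t)
  then show ?case
    unfolding sub_fm_instN by (metis proves.AllN_E sub_fm.simps(6))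
next
  case (AllS_E \<Gamma> \<phi> t)
  then show ?case
    unfolding sub_fm_instS by (metis proves.AllS_E sub_fm.simps(7))
next
  case (Imp_E \<Gamma> \<phi> \<psi>)
  then show ?case by (metis proves.Imp_E sub_fm.simps(5))
next
  case (Imp_I \<phi> \<Gamma> \<psi>)
  then show ?case by (simp add: proves.Imp_I)
next
  case (RAA \<phi> \<Gamma>)
  then show ?case by (simp add: proves.RAA)
next
  case (Hyp \<phi> \<Gamma>)
  then show ?case by (auto intro: proves.Hyp)
next
  case (Eq_refl \<Gamma> t)
  then show ?case by (simp add: proves.Eq_refl)
qed

lemma proves_finite: "\<Gamma> \<turnstile> \<phi> \<Longrightarrow> \<exists>\<Delta>. finite \<Delta> \<and> \<Delta> \<subseteq> \<Gamma> \<and> (\<Delta> \<turnstile> \<phi>)"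
proof (induction rule: proves.induct)
  case (Hyp \<phi> \<Gamma>)
  then show ?case by (intro exI[of _ "{\<phi>}"]) (auto intro: proves.Hyp)
next
  case (Imp_I \<phi> \<Gamma> \<psi>)
  then obtain \<Delta> where "finite \<Delta>" "\<Delta> \<subseteq> insert \<phi> \<Gamma>" "\<Delta> \<turnstile> \<psi>" by blast
  moreover from this have "insert \<phi> (\<Delta> - {\<phi>}) \<turnstile> \<psi>" by (auto elim: proves_mono)
  ultimately show ?case by (intro exI[of _ "\<Delta> - {\<phi>}"]) (auto intro: proves.Imp_I)
next
  case (Imp_E \<Gamma> \<phi> \<psi>)
  then obtain \<Delta> \<Delta>' where "finite \<Delta>" "\<Delta> \<subseteq> \<Gamma>" "\<Delta> \<turnstile> \<phi> \<^bold>\<longrightarrow> \<psi>" "finite \<Delta>'" "\<Delta>' \<subseteq> \<Gamma>" "\<Delta>' \<turnstile> \<phi>"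
    by blast
  then show ?case
    by (intro exI[of _ "\<Delta> \<union> \<Delta>'"]) (auto intro: proves.Imp_E[of _ \<phi>] elim: proves_mono)
next
  case (RAA \<phi> \<Gamma>)
  then obtain \<Delta> where "finite \<Delta>" "\<Delta> \<subseteq> insert (\<^bold>\<not> \<phi>) \<Gamma>" "\<Delta> \<turnstile> \<^bold>\<bottom>" by blast
  moreover from this have "insert (\<^bold>\<not> \<phi>) (\<Delta> - {\<^bold>\<not> \<phi>}) \<turnstile> \<^bold>\<bottom>" by (auto elim: proves_mono)
  ultimately show ?case by (intro exI[of _ "\<Delta> - {\<^bold>\<not> \<phi>}"]) (auto intro: proves.RAA)
next
  case (AllN_I \<Gamma> \<phi>)
  then show ?case by (metis finite_subset_image proves.AllN_I)
next
  case (AllS_I \<Gamma> \<phi>)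
  then show ?case by (metis finite_subset_image proves.AllS_I)
next
  case (Eq_subst \<Gamma> s t \<phi>)
  then obtain \<Delta> \<Delta>' where "finite \<Delta>" "\<Delta> \<subseteq> \<Gamma>" "\<Delta> \<turnstile> s \<^bold>= t" "finite \<Delta>'" "\<Delta>' \<subseteq> \<Gamma>"
    "\<Delta>' \<turnstile> instN s \<phi>" by blast
  then show ?case
    by (intro exI[of _ "\<Delta> \<union> \<Delta>'"]) (auto intro!: proves.Eq_subst[of _ s t \<phi>] elim: proves_mono)
next
  case (Eq_refl \<Gamma> t)
  then show ?case by (intro exI[of _ "{}"]) (auto intro: proves.Eq_refl)
next
  case (AllN_E \<Gamma> \<phi> t)
  then show ?case by (metis proves.AllN_E)
next
  case (AllS_E \<Gamma> \<phi> t)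
  then show ?case by (metis proves.AllS_E)
qed

lemma fresh_AllN:
  assumes \<Gamma>: "\<forall>\<phi>\<in>\<Gamma>. fv_below m k \<phi>" and \<psi>: "fv_below (Suc m) k \<psi>"
    and p: "\<Gamma> \<turnstile> instN (V m) \<psi>"
  shows "\<Gamma> \<turnstile> AllN \<psi>"
proof -
  \<comment> \<open>\<sigma> moves the fresh variable to the index that the quantifier binds and
    shifts every other one. On \<Gamma> it therefore acts as \<open>liftN\<close>, and it undoes the
    instantiation of \<psi> by \<open>V m\<close>.\<close>
  define \<sigma> where "\<sigma> i = (if i = m then V 0 else V (Suc i))" for i
  have "sub_fm \<sigma> (\<lambda>X. X) \<phi> = liftN \<phi>" if "\<phi> \<in> \<Gamma>" for \<phi>
    unfolding liftN_def using \<Gamma> that by (intro sub_fm_cong[of m k]) (auto simp: \<sigma>_def)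
  then have "sub_fm \<sigma> (\<lambda>X. X) ` \<Gamma> = liftN ` \<Gamma>" by (rule image_cong[OF refl])
  moreover have "sub_fm \<sigma> (\<lambda>X. X) (instN (V m) \<psi>) = sub_fm V (\<lambda>X. X) \<psi>"
    unfolding instN_def sub_fm_sub_fm using \<psi>
    by (intro sub_fm_cong[of "Suc m" k]) (auto simp: \<sigma>_def split: nat.split)
  ultimately show ?thesis
    using proves_sub_fm[OF p, of \<sigma> "\<lambda>X. X"] by (simp add: proves.AllN_I)
qed

lemma fresh_AllS:
  assumes \<Gamma>: "\<forall>\<phi>\<in>\<Gamma>. fv_below m k \<phi>" and \<psi>: "fv_below m (Suc k) \<psi>"
    and p: "\<Gamma> \<turnstile> instS k \<psi>"
  shows "\<Gamma> \<turnstile> AllS \<psi>"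
proof -
  define \<rho> where "\<rho> i = (if i = k then 0 else Suc i)" for i
  have "sub_fm V \<rho> \<phi> = liftS \<phi>" if "\<phi> \<in> \<Gamma>" for \<phi>
    unfolding liftS_def using \<Gamma> that by (intro sub_fm_cong[of m k]) (auto simp: \<rho>_def)
  then have "sub_fm V \<rho> ` \<Gamma> = liftS ` \<Gamma>" by (rule image_cong[OF refl])
  moreover have "sub_fm V \<rho> (instS k \<psi>) = sub_fm V (\<lambda>X. X) \<psi>"
    unfolding instS_def sub_fm_sub_fm using \<psi>
    by (intro sub_fm_cong[of m "Suc k"]) (auto simp: \<rho>_def split: nat.split)
  ultimately show ?thesis
    using proves_sub_fm[OF p, of V \<rho>] by (simp add: proves.AllS_I)
qed


section \<open>Henkin extensions\<close>

definition consistent :: "fm set \<Rightarrow> bool"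
  where "consistent \<Gamma> \<longleftrightarrow> \<not> (\<Gamma> \<turnstile> \<^bold>\<bottom>)"

text \<open>Witnesses are required for negated universal formulas because the existential
  quantifiers are abbreviations for those. A witness for a set quantifier can only be a set
  variable, since the language has no other set terms.\<close>

definition henkin :: "fm set \<Rightarrow> bool" where
  "henkin H \<longleftrightarrow> (\<forall>\<phi>. (H \<turnstile> \<phi>) \<longrightarrow> \<phi> \<in> H) \<and> \<^bold>\<bottom> \<notin> H \<and> (\<forall>\<phi>. \<phi> \<in> H \<or> (\<^bold>\<not> \<phi>) \<in> H) \<and>
    (\<forall>\<psi>. (\<^bold>\<not> AllN \<psi>) \<in> H \<longrightarrow> (\<exists>t. (\<^bold>\<not> instN t \<psi>) \<in> H)) \<and>
    (\<forall>\<psi>. (\<^bold>\<not> AllS \<psi>) \<in> H \<longrightarrow> (\<exists>Y. (\<^bold>\<not> instS Y \<psi>) \<in> H))"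

instance tm :: countable by countable_datatype
instance fm :: countable by countable_datatype

lemma consistent_insert_Neg: "consistent (insert (\<^bold>\<not> \<phi>) \<Gamma>)" if "\<not> (\<Gamma> \<turnstile> \<phi>)"
  using that RAA consistent_def by blast

lemma inconsistent_insert: "\<Gamma> \<turnstile> \<^bold>\<not> \<phi>" if "\<not> consistent (insert \<phi> \<Gamma>)"
  using that by (simp add: consistent_def Neg_def Imp_I)

lemma Neg_elim: "\<Gamma> \<turnstile> \<^bold>\<bottom>" if "\<Gamma> \<turnstile> \<^bold>\<not> \<phi>" "\<Gamma> \<turnstile> \<phi>"
  using that Imp_E unfolding Neg_def by blast

definition witnessed :: "fm \<Rightarrow> fm set \<Rightarrow> bool" where
  "witnessed \<phi> \<Gamma> \<longleftrightarrow> (\<forall>\<psi>. \<phi> = (\<^bold>\<not> AllN \<psi>) \<longrightarrow> \<phi> \<in> \<Gamma> \<longrightarrow> (\<exists>t. (\<^bold>\<not> instN t \<psi>) \<in> \<Gamma>)) \<and>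
     (\<forall>\<psi>. \<phi> = (\<^bold>\<not> AllS \<psi>) \<longrightarrow> \<phi> \<in> \<Gamma> \<longrightarrow> (\<exists>Y. (\<^bold>\<not> instS Y \<psi>) \<in> \<Gamma>))"

text \<open>\<Gamma> may be infinite, but a common bound on its free variables is kept along the
  construction. It guarantees variables that are fresh for all of \<Gamma>, and adding finitely many
  formulas preserves it.\<close>

lemma henkin_step:
  assumes con: "consistent \<Gamma>" and fv: "\<forall>\<psi>\<in>\<Gamma>. fv_below m k \<psi>"
  obtains \<Gamma>' m' k' where "\<Gamma> \<subseteq> \<Gamma>'" "consistent \<Gamma>'" "\<forall>\<psi>\<in>\<Gamma>'. fv_below m' k' \<psi>"
     "\<phi> \<in> \<Gamma>' \<or> \<not> consistent (insert \<phi> \<Gamma>)" "witnessed \<phi> \<Gamma>'"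
proof -
  note extension = that
  have *: thesis if sub: "\<Gamma> \<subseteq> \<Gamma>'" and con': "consistent \<Gamma>'"
    and \<Delta>: "finite \<Delta>" "\<Gamma>' = \<Gamma> \<union> \<Delta>"
    and dec: "\<phi> \<in> \<Gamma>' \<or> \<not> consistent (insert \<phi> \<Gamma>)" and wit: "witnessed \<phi> \<Gamma>'" for \<Gamma>' \<Delta>
  proof -
    from \<Delta>(1) have "\<exists>m' k'. \<forall>\<psi>\<in>\<Delta>. fv_below m' k' \<psi>"
    proof (induction \<Delta>)
      case (insert \<chi> \<Delta>)
      then obtain m1 k1 where 1: "\<forall>\<psi>\<in>\<Delta>. fv_below m1 k1 \<psi>" by blast
      obtain m2 k2 where 2: "fv_below m2 k2 \<chi>" using ex_fv_below by blast
      have "\<forall>\<psi>\<in>insert \<chi> \<Delta>. fv_below (max m1 m2) (max k1 k2) \<psi>"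
        using 1 2 fv_below_mono by (metis insert_iff max.cobounded1 max.cobounded2)
      then show ?case by blast
    qed auto
    then obtain m' k' where "\<forall>\<psi>\<in>\<Delta>. fv_below m' k' \<psi>" by blast
    then have "\<forall>\<psi>\<in>\<Gamma>'. fv_below (max m m') (max k k') \<psi>"
      using fv fv_below_mono \<Delta>(2) by (metis Un_iff max.cobounded1 max.cobounded2)
    then show thesis using extension[OF sub con' _ dec wit] by metis
  qed
  show thesis
  proof (cases "consistent (insert \<phi> \<Gamma>)")
    case False
    have "\<phi> \<notin> \<Gamma>" using False con by (metis insert_absorb)
    then show thesis using False con by (intro *[of \<Gamma> "{}"]) (auto simp: witnessed_def)
  next
    case True
    obtain m1 k1 where 1: "fv_below m1 k1 \<phi>" using ex_fv_below by blast
    define m' k' where "m' = max m m1" "k' = max k k1"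
    have fv': "\<forall>\<psi>\<in>insert \<phi> \<Gamma>. fv_below m' k' \<psi>"
      using 1 fv fv_below_mono unfolding m'_k'_def
      by (metis insert_iff max.cobounded1 max.cobounded2)
    consider \<psi> where "\<phi> = (\<^bold>\<not> AllN \<psi>)" | \<psi> where "\<phi> = (\<^bold>\<not> AllS \<psi>)"
      | "\<nexists>\<psi>. \<phi> = (\<^bold>\<not> AllN \<psi>)" "\<nexists>\<psi>. \<phi> = (\<^bold>\<not> AllS \<psi>)" by blast
    then show thesis
    proof cases
      case 1
      have "\<not> (insert \<phi> \<Gamma> \<turnstile> instN (V m') \<psi>)"
      proof
        assume a: "insert \<phi> \<Gamma> \<turnstile> instN (V m') \<psi>"
        have "fv_below (Suc m') k' \<psi>" using fv' 1 by (simp add: Neg_def)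
        then have "insert \<phi> \<Gamma> \<turnstile> AllN \<psi>" using fresh_AllN fv' a by blast
        moreover have "insert \<phi> \<Gamma> \<turnstile> \<^bold>\<not> AllN \<psi>" using 1 by (simp add: Hyp)
        ultimately show False using True Neg_elim unfolding consistent_def by metis
      qed
      then have "consistent (insert (\<^bold>\<not> instN (V m') \<psi>) (insert \<phi> \<Gamma>))"
        by (rule consistent_insert_Neg)
      moreover have "witnessed \<phi> (insert (\<^bold>\<not> instN (V m') \<psi>) (insert \<phi> \<Gamma>))"
        using 1 by (auto simp: witnessed_def Neg_def)
      ultimately show thesis
        by (intro *[of "insert (\<^bold>\<not> instN (V m') \<psi>) (insert \<phi> \<Gamma>)" "{\<^bold>\<not> instN (V m') \<psi>, \<phi>}"]) auto
    next
      case 2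
      have "\<not> (insert \<phi> \<Gamma> \<turnstile> instS k' \<psi>)"
      proof
        assume a: "insert \<phi> \<Gamma> \<turnstile> instS k' \<psi>"
        have "fv_below m' (Suc k') \<psi>" using fv' 2 by (simp add: Neg_def)
        then have "insert \<phi> \<Gamma> \<turnstile> AllS \<psi>" using fresh_AllS fv' a by blast
        moreover have "insert \<phi> \<Gamma> \<turnstile> \<^bold>\<not> AllS \<psi>" using 2 by (simp add: Hyp)
        ultimately show False using True Neg_elim unfolding consistent_def by metis
      qed
      then have "consistent (insert (\<^bold>\<not> instS k' \<psi>) (insert \<phi> \<Gamma>))"
        by (rule consistent_insert_Neg)
      moreover have "witnessed \<phi> (insert (\<^bold>\<not> instS k' \<psi>) (insert \<phi> \<Gamma>))"
        using 2 by (auto simp: witnessed_def Neg_def)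
      ultimately show thesis
        by (intro *[of "insert (\<^bold>\<not> instS k' \<psi>) (insert \<phi> \<Gamma>)" "{\<^bold>\<not> instS k' \<psi>, \<phi>}"]) auto
    next
      case 3
      then have "witnessed \<phi> (insert \<phi> \<Gamma>)" by (simp add: witnessed_def)
      then show thesis using True by (intro *[of "insert \<phi> \<Gamma>" "{\<phi>}"]) auto
    qed
  qed
qed

text \<open>One pass through an enumeration of all formulas decides and witnesses each of them.
  Consistency of the union reduces to a single stage because a derivation uses finitely many
  hypotheses.\<close>

lemma ex_henkin:
  assumes con: "consistent T" and closed: "\<forall>\<phi>\<in>T. fv_below 0 0 \<phi>"
  shows "\<exists>H. henkin H \<and> T \<subseteq> H"
proof -
  define good where "good \<Gamma> \<longleftrightarrow> consistent \<Gamma> \<and> T \<subseteq> \<Gamma> \<and> (\<exists>m k. \<forall>\<psi>\<in>\<Gamma>. fv_below m k \<psi>)" for \<Gamma>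
  define step where "step n \<Gamma> \<Gamma>' \<longleftrightarrow> \<Gamma> \<subseteq> \<Gamma>' \<and>
     (from_nat n \<in> \<Gamma>' \<or> \<not> consistent (insert (from_nat n) \<Gamma>)) \<and> witnessed (from_nat n) \<Gamma>'" for n :: nat and \<Gamma> \<Gamma>'
  have "\<exists>\<Gamma>. good \<Gamma>" using con closed unfolding good_def by blast
  moreover have "\<exists>\<Gamma>'. good \<Gamma>' \<and> step n \<Gamma> \<Gamma>'" if "good \<Gamma>" for \<Gamma> n
  proof -
    from that obtain m k where \<Gamma>: "consistent \<Gamma>" "T \<subseteq> \<Gamma>" "\<forall>\<psi>\<in>\<Gamma>. fv_below m k \<psi>"
      unfolding good_def by blast
    obtain \<Gamma>' m' k' where "\<Gamma> \<subseteq> \<Gamma>'" "consistent \<Gamma>'" "\<forall>\<psi>\<in>\<Gamma>'. fv_below m' k' \<psi>"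
      "from_nat n \<in> \<Gamma>' \<or> \<not> consistent (insert (from_nat n) \<Gamma>)" "witnessed (from_nat n) \<Gamma>'"
      using henkin_step[OF \<Gamma>(1,3)] by metis
    then have "good \<Gamma>' \<and> step n \<Gamma> \<Gamma>'" using \<Gamma>(2) unfolding good_def step_def by auto
    then show ?thesis ..
  qed
  ultimately obtain G where G: "\<And>n. good (G n)" "\<And>n. step n (G n) (G (Suc n))"
    using dependent_nat_choice[of "\<lambda>_. good" step] by metis
  have mono: "G i \<subseteq> G j" if "i \<le> j" for i j
    using that by (induction rule: dec_induct) (use G(2) in \<open>auto simp: step_def\<close>)
  define H where "H = (\<Union>n. G n)"
  have sub: "G n \<subseteq> H" for n unfolding H_def by blast
  have conH: "\<not> (H \<turnstile> \<^bold>\<bottom>)"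
  proof
    assume "H \<turnstile> \<^bold>\<bottom>"
    then obtain \<Delta> where \<Delta>: "finite \<Delta>" "\<Delta> \<subseteq> H" "\<Delta> \<turnstile> \<^bold>\<bottom>" using proves_finite by blast
    from \<Delta>(1,2) have "\<exists>n. \<Delta> \<subseteq> G n"
    proof (induction \<Delta>)
      case (insert x \<Delta>)
      then obtain n i where "\<Delta> \<subseteq> G n" "x \<in> G i" unfolding H_def by blast
      then have "insert x \<Delta> \<subseteq> G (max n i)"
        using mono[of n "max n i"] mono[of i "max n i"] by auto
      then show ?case ..
    qed auto
    then show False using \<Delta>(3) G(1) proves_mono unfolding good_def consistent_def by blast
  qed
  have dec: "\<phi> \<in> G (Suc (to_nat \<phi>)) \<or> (H \<turnstile> \<^bold>\<not> \<phi>)" for \<phi>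
  proof -
    have "\<phi> \<in> G (Suc (to_nat \<phi>)) \<or> \<not> consistent (insert \<phi> (G (to_nat \<phi>)))"
      using G(2)[of "to_nat \<phi>"] by (simp add: step_def)
    then show ?thesis using inconsistent_insert proves_mono sub by blast
  qed
  \<comment> \<open>A formula that was refused at its stage has its negation derivable from the
    union. So a formula derivable from the union was accepted, and its witness was added at the same
    stage.\<close>
  have stage: "\<phi> \<in> G (Suc (to_nat \<phi>))" if "H \<turnstile> \<phi>" for \<phi>
    using that dec[of \<phi>] conH Neg_elim by blast
  then have closed: "\<phi> \<in> H" if "H \<turnstile> \<phi>" for \<phi>
    using that sub by blast
  have wit: "witnessed \<phi> (G (Suc (to_nat \<phi>)))" for \<phi>
    using G(2)[of "to_nat \<phi>"] by (simp add: step_def)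
  have wN: "\<exists>t. (\<^bold>\<not> instN t \<psi>) \<in> H" if "(\<^bold>\<not> AllN \<psi>) \<in> H" for \<psi>
    using stage[OF Hyp[OF that]] wit[of "\<^bold>\<not> AllN \<psi>"] sub unfolding witnessed_def by blast
  have wS: "\<exists>t. (\<^bold>\<not> instS t \<psi>) \<in> H" if "(\<^bold>\<not> AllS \<psi>) \<in> H" for \<psi>
    using stage[OF Hyp[OF that]] wit[of "\<^bold>\<not> AllS \<psi>"] sub unfolding witnessed_def by blast
  have max: "\<phi> \<in> H \<or> (\<^bold>\<not> \<phi>) \<in> H" for \<phi>
    using dec[of \<phi>] closed sub by blast
  have bot: "\<^bold>\<bottom> \<notin> H" using conH Hyp by blast
  have "henkin H"
    unfolding henkin_def using closed bot max wN wS by blast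
  moreover have "T \<subseteq> H" using G(1)[of 0] sub[of 0] unfolding good_def by blast
  ultimately show ?thesis by blast
qed

section \<open>Semantics\<close>

primrec val :: "(nat \<Rightarrow> 'a::{zero,one,plus,times}) \<Rightarrow> tm \<Rightarrow> 'a" where
  "val e (V i) = e i"
| "val e \<^bold>0 = 0"
| "val e \<^bold>1 = 1"
| "val e (s \<^bold>+ t) = val e s + val e t"
| "val e (s \<^bold>* t) = val e s * val e t"

primrec sat :: "'a set set \<Rightarrow> (nat \<Rightarrow> 'a::{zero,one,plus,times,ord}) \<Rightarrow> (nat \<Rightarrow> 'a set) \<Rightarrow> fm \<Rightarrow> bool" where
  "sat S e s (t \<^bold>= u) \<longleftrightarrow> val e t = val e u"
| "sat S e s (t \<^bold>< u) \<longleftrightarrow> val e t < val e u"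
| "sat S e s (t \<^bold>\<in> X) \<longleftrightarrow> val e t \<in> s X"
| "sat S e s \<^bold>\<bottom> \<longleftrightarrow> False"
| "sat S e s (\<phi> \<^bold>\<longrightarrow> \<psi>) \<longleftrightarrow> (sat S e s \<phi> \<longrightarrow> sat S e s \<psi>)"
| "sat S e s (AllN \<phi>) \<longleftrightarrow> (\<forall>x. sat S (case_nat x e) s \<phi>)"
| "sat S e s (AllS \<phi>) \<longleftrightarrow> (\<forall>X\<in>S. sat S e (case_nat X s) \<phi>)"

lemma sat_connectives [simp]:
  "sat S e s (\<^bold>\<not> \<phi>) \<longleftrightarrow> \<not> sat S e s \<phi>"
  "sat S e s (\<phi> \<^bold>\<and> \<psi>) \<longleftrightarrow> sat S e s \<phi> \<and> sat S e s \<psi>"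
  "sat S e s (\<phi> \<^bold>\<or> \<psi>) \<longleftrightarrow> sat S e s \<phi> \<or> sat S e s \<psi>"
  "sat S e s (\<phi> \<^bold>\<longleftrightarrow> \<psi>) \<longleftrightarrow> (sat S e s \<phi> \<longleftrightarrow> sat S e s \<psi>)"
  "sat S e s (ExN \<phi>) \<longleftrightarrow> (\<exists>x. sat S (case_nat x e) s \<phi>)"
  "sat S e s (ExS \<phi>) \<longleftrightarrow> (\<exists>X\<in>S. sat S e (case_nat X s) \<phi>)"
  by (auto simp: Neg_def And_def Or_def Iff_def ExN_def ExS_def)

lemma val_sub_tm: "val e (sub_tm \<sigma> t) = val (\<lambda>i. val e (\<sigma> i)) t"
  by (induction t) auto

lemma val_up [simp]: "val e (up n t) = val (\<lambda>i. e (i + n)) t"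
  by (simp add: up_def val_sub_tm)

lemma sat_sub_fm: "sat S e s (sub_fm \<sigma> \<rho> \<phi>) \<longleftrightarrow> sat S (\<lambda>i. val e (\<sigma> i)) (\<lambda>X. s (\<rho> X)) \<phi>"
proof (induction \<phi> arbitrary: e s \<sigma> \<rho>)
  case (AllN \<phi>)
  have "(\<lambda>i. val (case_nat x e) (slift \<sigma> i)) = case_nat x (\<lambda>i. val e (\<sigma> i))" for x
    by (auto simp: fun_eq_iff One_nat_def split: nat.split)
  with AllN show ?case by (simp only: sub_fm.simps sat.simps)
next
  case (AllS \<phi>)
  have "(\<lambda>Y. case_nat X s (case_nat 0 (\<lambda>i. Suc (\<rho> i)) Y)) = case_nat X (\<lambda>Y. s (\<rho> Y))" for X
    by (auto simp: fun_eq_iff split: nat.split)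
  with AllS show ?case by (simp only: sub_fm.simps sat.simps)
qed (simp_all add: val_sub_tm)

lemma val_case_nat_V: "(\<lambda>i. val e (case_nat t V i)) = case_nat (val e t) e"
  by (auto simp: fun_eq_iff split: nat.split)

lemma case_nat_case_nat_id: "(\<lambda>X. s (case_nat Y (\<lambda>X. X) X)) = case_nat (s Y) s"
  by (auto simp: fun_eq_iff split: nat.split)

lemma sat_inst [simp]:
  "sat S e s (instN t \<phi>) \<longleftrightarrow> sat S (case_nat (val e t) e) s \<phi>"
  "sat S e s (instS Y \<phi>) \<longleftrightarrow> sat S e (case_nat (s Y) s) \<phi>"
  by (simp_all only: instN_def instS_def sat_sub_fm val_case_nat_V case_nat_case_nat_id val.simps)

lemma sat_lift [simp]:
  "sat S (case_nat x e) s (liftN \<phi>) \<longleftrightarrow> sat S e s \<phi>"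
  "sat S e (case_nat X s) (liftS \<phi>) \<longleftrightarrow> sat S e s \<phi>"
  by (simp_all add: liftN_def liftS_def sat_sub_fm)

lemma soundness:
  "\<Gamma> \<turnstile> \<phi> \<Longrightarrow> range s \<subseteq> S \<Longrightarrow> \<forall>\<psi>\<in>\<Gamma>. sat S e s \<psi> \<Longrightarrow> sat S e s \<phi>"
proof (induction arbitrary: e s rule: proves.induct)
  case (AllN_I \<Gamma> \<phi>)
  have "sat S (case_nat x e) s \<phi>" for x
    using AllN_I.prems by (intro AllN_I.IH) auto
  then show ?case by simp
next
  case (AllS_I \<Gamma> \<phi>)
  have "sat S e (case_nat X s) \<phi>" if "X \<in> S" for X
    using AllS_I.prems that by (intro AllS_I.IH) (auto simp: image_subset_iff split: nat.splits)
  then show ?case by simp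
next
  case (AllS_E \<Gamma> \<phi> Y)
  have "s Y \<in> S" using AllS_E.prems by blast
  then show ?case using AllS_E.IH[OF AllS_E.prems] by simp
next
  case (RAA \<phi> \<Gamma>)
  then show ?case using RAA.IH[of s e] by auto
qed auto

lemma val_cong: "fv_below_tm m t \<Longrightarrow> (\<And>i. i < m \<Longrightarrow> e i = e' i) \<Longrightarrow> val e t = val e' t"
  by (induction t) auto

lemma sat_cong:
  "fv_below m k \<phi> \<Longrightarrow> (\<And>i. i < m \<Longrightarrow> e i = e' i) \<Longrightarrow> (\<And>X. X < k \<Longrightarrow> s X = s' X)
    \<Longrightarrow> sat S e s \<phi> \<longleftrightarrow> sat S e' s' \<phi>"
proof (induction \<phi> arbitrary: m k e e' s s')
  case (AllN \<phi>)
  have "sat S (case_nat x e) s \<phi> \<longleftrightarrow> sat S (case_nat x e') s' \<phi>" for x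
    using AllN.prems by (intro AllN.IH[of "Suc m" k]) (auto split: nat.split)
  then show ?case by simp
next
  case (AllS \<phi>)
  have "sat S e (case_nat X s) \<phi> \<longleftrightarrow> sat S e' (case_nat X s') \<phi>" for X
    using AllS.prems by (intro AllS.IH[of m "Suc k"]) (auto split: nat.split)
  then show ?case by simp
next
  case (Eq t u)
  then show ?case using val_cong[of m t e e'] val_cong[of m u e e'] by auto
next
  case (Less t u)
  then show ?case using val_cong[of m t e e'] val_cong[of m u e e'] by auto
next
  case (Mem t X)
  then show ?case using val_cong[of m t e e'] by auto
next
  case (Imp \<phi> \<psi>)
  have "sat S e s \<phi> \<longleftrightarrow> sat S e' s' \<phi>" "sat S e s \<psi> \<longleftrightarrow> sat S e' s' \<psi>"
    using Imp.prems by (intro Imp.IH[of m k]; simp)+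
  then show ?case by simp
qed simp

section \<open>Universal closures\<close>

lemma fv_below_closure:
  "fv_below m k \<phi> \<Longrightarrow> fv_below 0 0 ((AllS ^^ k) ((AllN ^^ m) \<phi>))"
proof -
  have N: "fv_below m k \<phi> \<Longrightarrow> fv_below 0 k ((AllN ^^ m) \<phi>)" for m k \<phi>
    by (induction m arbitrary: \<phi>) (auto simp: funpow_swap1 simp del: funpow.simps(2) simp: funpow_Suc_right)
  have S: "fv_below 0 k \<phi> \<Longrightarrow> fv_below 0 0 ((AllS ^^ k) \<phi>)" for k \<phi>
    by (induction k arbitrary: \<phi>) (auto simp: funpow_Suc_right simp del: funpow.simps(2))
  show "fv_below m k \<phi> \<Longrightarrow> ?thesis" using N S by blast
qed

lemma universal_closures_closed: "\<phi> \<in> universal_closures A \<Longrightarrow> fv_below 0 0 \<phi>"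
  unfolding universal_closures_def using fv_below_closure by blast

lemma sat_AllN_closure:
  "sat S e s ((AllN ^^ m) \<phi>) \<longleftrightarrow> (\<forall>f. sat S (\<lambda>i. if i < m then f i else e (i - m)) s \<phi>)"
proof (induction m arbitrary: \<phi>)
  case (Suc m)
  have eq: "case_nat (g 0) (\<lambda>i. if i < m then g (Suc i) else e (i - m)) =
    (\<lambda>i. if i < Suc m then g i else e (i - Suc m))" for g
    by (auto simp: fun_eq_iff split: nat.split)
  have "sat S e s ((AllN ^^ Suc m) \<phi>) \<longleftrightarrow>
     (\<forall>f x. sat S (case_nat x (\<lambda>i. if i < m then f i else e (i - m))) s \<phi>)"
    by (simp add: funpow_Suc_right Suc.IH del: funpow.simps(2))
  also have "\<dots> \<longleftrightarrow> (\<forall>g. sat S (case_nat (g 0) (\<lambda>i. if i < m then g (Suc i) else e (i - m))) s \<phi>)"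
  proof safe
    fix f x
    assume "\<forall>g. sat S (case_nat (g 0) (\<lambda>i. if i < m then g (Suc i) else e (i - m))) s \<phi>"
    from this[rule_format, of "case_nat x f"]
    show "sat S (case_nat x (\<lambda>i. if i < m then f i else e (i - m))) s \<phi>" by (simp cong: if_cong)
  next
    fix g
    assume *: "\<forall>f x. sat S (case_nat x (\<lambda>i. if i < m then f i else e (i - m))) s \<phi>"
    show "sat S (case_nat (g 0) (\<lambda>i. if i < m then g (Suc i) else e (i - m))) s \<phi>"
      using *[rule_format, of "g 0" "\<lambda>i. g (Suc i)"] .
  qed
  finally show ?case by (simp only: eq)
qed simp

lemma sat_AllS_closure:
  "sat S e s ((AllS ^^ k) \<phi>) \<longleftrightarrow>
    (\<forall>f. (\<forall>i<k. f i \<in> S) \<longrightarrow> sat S e (\<lambda>i. if i < k then f i else s (i - k)) \<phi>)"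
proof (induction k arbitrary: \<phi>)
  case (Suc k)
  have eq: "case_nat (g 0) (\<lambda>i. if i < k then g (Suc i) else s (i - k)) =
    (\<lambda>i. if i < Suc k then g i else s (i - Suc k))" for g
    by (auto simp: fun_eq_iff split: nat.split)
  have "sat S e s ((AllS ^^ Suc k) \<phi>) \<longleftrightarrow> (\<forall>f. (\<forall>i<k. f i \<in> S) \<longrightarrow>
     (\<forall>X\<in>S. sat S e (case_nat X (\<lambda>i. if i < k then f i else s (i - k))) \<phi>))"
    by (simp add: funpow_Suc_right Suc.IH del: funpow.simps(2))
  also have "\<dots> \<longleftrightarrow> (\<forall>g. (\<forall>i<Suc k. g i \<in> S) \<longrightarrow>
      sat S e (case_nat (g 0) (\<lambda>i. if i < k then g (Suc i) else s (i - k))) \<phi>)"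
  proof safe
    fix f X
    assume *: "\<forall>g. (\<forall>i<Suc k. g i \<in> S) \<longrightarrow>
      sat S e (case_nat (g 0) (\<lambda>i. if i < k then g (Suc i) else s (i - k))) \<phi>"
      and "\<forall>i<k. f i \<in> S" "X \<in> S"
    then have "\<forall>i<Suc k. case_nat X f i \<in> S" by (auto split: nat.split)
    with *[rule_format, of "case_nat X f"]
    show "sat S e (case_nat X (\<lambda>i. if i < k then f i else s (i - k))) \<phi>" by (simp cong: if_cong)
  next
    fix g :: "nat \<Rightarrow> 'a set"
    assume *: "\<forall>f. (\<forall>i<k. f i \<in> S) \<longrightarrow>
      (\<forall>X\<in>S. sat S e (case_nat X (\<lambda>i. if i < k then f i else s (i - k))) \<phi>)"
      and g: "\<forall>i<Suc k. g i \<in> S"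
    from *[rule_format, of "\<lambda>i. g (Suc i)" "g 0"] g
    show "sat S e (case_nat (g 0) (\<lambda>i. if i < k then g (Suc i) else s (i - k))) \<phi>" by simp
  qed
  finally show ?case by (simp only: eq)
qed simp

text \<open>Every formula has a closure, since its free variables lie below some m and k. The
  restriction to s with range in S reflects that the set quantifiers of the closure range over S
  only.\<close>

lemma sat_universal_closures:
  fixes S :: "'a::{zero,one,plus,times,ord} set set"
  assumes s0: "range s0 \<subseteq> S"
  shows "(\<forall>\<phi>\<in>universal_closures A. sat S e0 s0 \<phi>) \<longleftrightarrow>
    (\<forall>\<phi>\<in>A. \<forall>e (s :: nat \<Rightarrow> 'a set). range s \<subseteq> S \<longrightarrow> sat S e s \<phi>)"
proof (intro iffI ballI allI impI)
  fix \<phi> e and s :: "nat \<Rightarrow> 'a set"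
  assume *: "\<forall>\<phi>\<in>universal_closures A. sat S e0 s0 \<phi>" and \<phi>: "\<phi> \<in> A" and s: "range (s :: nat \<Rightarrow> _) \<subseteq> S"
  obtain m k where fv: "fv_below m k \<phi>" using ex_fv_below by blast
  then have "sat S e0 s0 ((AllS ^^ k) ((AllN ^^ m) \<phi>))"
    using * \<phi> unfolding universal_closures_def by blast
  then have "sat S (\<lambda>i. if i < m then e i else e0 (i - m)) (\<lambda>i. if i < k then s i else s0 (i - k)) \<phi>"
    using s unfolding sat_AllN_closure sat_AllS_closure by (simp add: image_subset_iff)
  then show "sat S e s \<phi>"
    by (rule iffD1[OF sat_cong[OF fv], rotated -1]) auto
next
  fix \<phi>
  assume *: "\<forall>\<phi>\<in>A. \<forall>e (s :: nat \<Rightarrow> 'a set). range s \<subseteq> S \<longrightarrow> sat S e s \<phi>" and "\<phi> \<in> universal_closures A"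
  then obtain m k \<psi> where \<psi>: "\<phi> = (AllS ^^ k) ((AllN ^^ m) \<psi>)" "\<psi> \<in> A"
    unfolding universal_closures_def by blast
  have "range (\<lambda>i. if i < k then f i else s0 (i - k)) \<subseteq> S" if "\<forall>i<k. f i \<in> S" for f
    using that s0 by auto
  then show "sat S e0 s0 \<phi>"
    unfolding \<psi>(1) sat_AllN_closure sat_AllS_closure
    by (intro allI impI *[rule_format, OF \<psi>(2)]) 
qed

section \<open>The term model of a Henkin set\<close>

text \<open>Discretely ordered semirings are a subclass of \<open>linordered_semidom\<close>, so
  that its arithmetic lemmas apply to nonstandard models. The price is a subtraction, which the term
  model has to supply.\<close>

class pam = linordered_semidom +
  assumes zero_le' [simp]: "0 \<le> x" and discrete': "0 < x \<Longrightarrow> 1 \<le> x"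

definition theory_2p7 :: "fm set"
  where "theory_2p7 = RCA0 \<union> I_Sigma0 2 \<union> {AllFun (ExN (DNR (V 0) 0))}"

definition goal_2p7 :: fm
  where "goal_2p7 = AllFun (DNR (num 2) 0)"

lemmas formula_defs = AllFun_def DNR_def IsFun_def Bounded_def DiagNonRec_def Phi_def Final_def
  Initial_def Step_def Exec_def Upd_def Entry_def Rem_def Len_def App_def pair_def Leq_def Let_def

lemma fv_below_connectives [simp]:
  "fv_below m k (\<^bold>\<not> \<phi>) \<longleftrightarrow> fv_below m k \<phi>"
  "fv_below m k (\<phi> \<^bold>\<and> \<psi>) \<longleftrightarrow> fv_below m k \<phi> \<and> fv_below m k \<psi>"
  "fv_below m k (\<phi> \<^bold>\<or> \<psi>) \<longleftrightarrow> fv_below m k \<phi> \<and> fv_below m k \<psi>"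
  "fv_below m k (ExN \<phi>) \<longleftrightarrow> fv_below (Suc m) k \<phi>"
  "fv_below m k (ExS \<phi>) \<longleftrightarrow> fv_below m (Suc k) \<phi>"
  by (simp_all add: Neg_def And_def Or_def ExN_def ExS_def)

lemma closed_2p7: "fv_below 0 0 (AllFun (ExN (DNR (V 0) 0)))" "fv_below 0 0 goal_2p7"
  by (simp_all add: One_nat_def goal_2p7_def formula_defs numeral_eq_Suc up_def)

lemma theory_2p7_closed: "\<phi> \<in> insert (\<^bold>\<not> goal_2p7) theory_2p7 \<Longrightarrow> fv_below 0 0 \<phi>"
proof -
  assume \<phi>: "\<phi> \<in> insert (\<^bold>\<not> goal_2p7) theory_2p7"
  have "\<phi> = (\<^bold>\<not> goal_2p7) \<or> \<phi> = AllFun (ExN (DNR (V 0) 0)) \<or> \<phi> \<in> PA_minus \<or>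
      (\<exists>A. \<phi> \<in> universal_closures A)"
    using \<phi> unfolding theory_2p7_def RCA0_def I_Sigma0_def Delta01_CA_def by blast
  then show ?thesis
    using closed_2p7 universal_closures_closed unfolding PA_minus_def by auto
qed

lemma closures_instance:
  assumes "\<forall>\<phi>\<in>universal_closures A. sat S e s \<phi>" "range s \<subseteq> S"
  shows "\<forall>\<phi>\<in>A. sat S e' s \<phi>"
  using sat_universal_closures[of s S A e] assms by blast

text \<open>By soundness, the standard numbers make \<open>PA_minus\<close> consistent; the fallback
  Henkin set for a derivable goal needs this.\<close>

lemma PA_minus_nat: "\<forall>\<phi>\<in>PA_minus. sat UNIV (e :: nat \<Rightarrow> nat) s \<phi>"
proof -
  have 1: "\<exists>w. x + w = y" "\<exists>w. w + x = y" if "x < y" for x y :: nat using that by presburger+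
  show ?thesis unfolding PA_minus_def Let_def
    by (subst sat_universal_closures) (auto simp: One_nat_def Leq_def algebra_simps intro!: 1)
qed

lemma ex_henkin_2p7:
  "\<exists>H. henkin H \<and> PA_minus \<subseteq> H \<and> (\<not> (theory_2p7 \<turnstile> goal_2p7) \<longrightarrow> insert (\<^bold>\<not> goal_2p7) theory_2p7 \<subseteq> H)"
proof (cases "theory_2p7 \<turnstile> goal_2p7")
  case True
  have "consistent PA_minus"
    unfolding consistent_def using soundness[of PA_minus "\<^bold>\<bottom>"] PA_minus_nat
    by (metis UNIV_I sat.simps(4) subsetI)
  moreover have "\<forall>\<phi>\<in>PA_minus. fv_below 0 0 \<phi>"
    using universal_closures_closed unfolding PA_minus_def by blast
  ultimately show ?thesis using True ex_henkin by blast
next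
  case False
  then have "consistent (insert (\<^bold>\<not> goal_2p7) theory_2p7)" by (rule consistent_insert_Neg)
  then obtain H where "henkin H" "insert (\<^bold>\<not> goal_2p7) theory_2p7 \<subseteq> H"
    using ex_henkin theory_2p7_closed by blast
  moreover from this have "PA_minus \<subseteq> H" by (auto simp: theory_2p7_def RCA0_def)
  ultimately show ?thesis by blast
qed

text \<open>
  A type definition cannot depend on a hypothesis, so the Henkin set is chosen unconditionally; if the
  goal is derivable, any Henkin extension of \<open>PA_minus\<close> will do.
\<close>

definition hset :: "fm set" where
  "hset = (SOME H. henkin H \<and> PA_minus \<subseteq> H \<and>
     (\<not> (theory_2p7 \<turnstile> goal_2p7) \<longrightarrow> insert (\<^bold>\<not> goal_2p7) theory_2p7 \<subseteq> H))"

lemma hset: "henkin hset" "PA_minus \<subseteq> hset"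
  "\<not> (theory_2p7 \<turnstile> goal_2p7) \<Longrightarrow> insert (\<^bold>\<not> goal_2p7) theory_2p7 \<subseteq> hset"
  using someI_ex[OF ex_henkin_2p7] unfolding hset_def by blast+

section \<open>Terms modulo provable equality\<close>

lemma hset_closed: "hset \<turnstile> \<phi> \<Longrightarrow> \<phi> \<in> hset"
  using hset(1) by (simp add: henkin_def)

lemma hset_refl: "(t \<^bold>= t) \<in> hset"
  by (intro hset_closed Eq_refl)

lemma sub_tm_case_nat_up [simp]: "sub_tm (case_nat s V) (up 1 t) = t"
  by (simp add: sub_tm_up One_nat_def)

lemma hset_subst:
  assumes "(s \<^bold>= t) \<in> hset" "instN s \<phi> \<in> hset" shows "instN t \<phi> \<in> hset"
  using assms by (meson Eq_subst Hyp hset_closed)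

text \<open>The left s in s = s is replaced by t, while \<open>up 1\<close> keeps the right one out
  of reach of the instantiation. The congruence laws below follow the same pattern.\<close>

lemma hset_sym: "(s \<^bold>= t) \<in> hset \<Longrightarrow> (t \<^bold>= s) \<in> hset"
  using hset_subst[of s t "V 0 \<^bold>= up 1 s"] hset_refl by (simp add: instN_def)

lemma hset_trans: "(s \<^bold>= t) \<in> hset \<Longrightarrow> (t \<^bold>= u) \<in> hset \<Longrightarrow> (s \<^bold>= u) \<in> hset"
  using hset_subst[of t u "up 1 s \<^bold>= V 0"] by (simp add: instN_def)

quotient_type trm = tm / "\<lambda>s t. (s \<^bold>= t) \<in> hset" morphisms rep_trm abs_trm
  by (auto intro!: equivpI reflpI sympI transpI intro: hset_refl hset_sym hset_trans)

lemma hset_cong2: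
  assumes "(s \<^bold>= s') \<in> hset" "(t \<^bold>= t') \<in> hset"
  shows "(s \<^bold>+ t \<^bold>= s' \<^bold>+ t') \<in> hset" "(s \<^bold>* t \<^bold>= s' \<^bold>* t') \<in> hset"
    "(s \<^bold>< t) \<in> hset \<Longrightarrow> (s' \<^bold>< t') \<in> hset"
proof -
  have "(s \<^bold>+ t \<^bold>= s' \<^bold>+ t) \<in> hset"
    using hset_subst[OF assms(1), of "up 1 (s \<^bold>+ t) \<^bold>= V 0 \<^bold>+ up 1 t"] hset_refl
    by (simp add: instN_def)
  then show "(s \<^bold>+ t \<^bold>= s' \<^bold>+ t') \<in> hset"
    using hset_subst[OF assms(2), of "up 1 (s \<^bold>+ t) \<^bold>= up 1 s' \<^bold>+ V 0"] by (simp add: instN_def)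
  have "(s \<^bold>* t \<^bold>= s' \<^bold>* t) \<in> hset"
    using hset_subst[OF assms(1), of "up 1 (s \<^bold>* t) \<^bold>= V 0 \<^bold>* up 1 t"] hset_refl
    by (simp add: instN_def)
  then show "(s \<^bold>* t \<^bold>= s' \<^bold>* t') \<in> hset"
    using hset_subst[OF assms(2), of "up 1 (s \<^bold>* t) \<^bold>= up 1 s' \<^bold>* V 0"] by (simp add: instN_def)
  assume "(s \<^bold>< t) \<in> hset"
  then have "(s' \<^bold>< t) \<in> hset"
    using hset_subst[OF assms(1), of "V 0 \<^bold>< up 1 t"] by (simp add: instN_def)
  then show "(s' \<^bold>< t') \<in> hset"
    using hset_subst[OF assms(2), of "up 1 s' \<^bold>< V 0"] by (simp add: instN_def)
qed

instantiation trm :: "{zero,one,plus,times,ord}"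
begin
lift_definition zero_trm :: trm is "\<^bold>0" .
lift_definition one_trm :: trm is "\<^bold>1" .
lift_definition plus_trm :: "trm \<Rightarrow> trm \<Rightarrow> trm" is Add by (rule hset_cong2)
lift_definition times_trm :: "trm \<Rightarrow> trm \<Rightarrow> trm" is Mul by (rule hset_cong2)
lift_definition less_trm :: "trm \<Rightarrow> trm \<Rightarrow> bool" is "\<lambda>s t. (s \<^bold>< t) \<in> hset"
  using hset_cong2(3) hset_sym by blast
definition less_eq_trm :: "trm \<Rightarrow> trm \<Rightarrow> bool" where "less_eq_trm s t \<longleftrightarrow> s < t \<or> s = t"
instance ..
end

lift_definition set_trm :: "nat \<Rightarrow> trm \<Rightarrow> bool" is "\<lambda>X t. (t \<^bold>\<in> X) \<in> hset"
proof -
  have *: "(s \<^bold>\<in> X) \<in> hset \<Longrightarrow> (t \<^bold>\<in> X) \<in> hset" if "(s \<^bold>= t) \<in> hset" for X s t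
    using hset_subst[OF that, of "V 0 \<^bold>\<in> X"] by (simp add: instN_def)
  show "\<And>X s t. (s \<^bold>= t) \<in> hset \<Longrightarrow> ((s \<^bold>\<in> X) \<in> hset) = ((t \<^bold>\<in> X) \<in> hset)"
    using * hset_sym by blast
qed

definition sets_trm :: "trm set set" where "sets_trm = range (\<lambda>X. Collect (set_trm X))"

lemma val_trm: "val (\<lambda>i. abs_trm (\<sigma> i)) t = abs_trm (sub_tm \<sigma> t)"
  by (induction t) (simp_all add: zero_trm.abs_eq one_trm.abs_eq plus_trm.abs_eq times_trm.abs_eq)

lemma hset_Imp: "(\<phi> \<^bold>\<longrightarrow> \<psi>) \<in> hset \<longleftrightarrow> (\<phi> \<in> hset \<longrightarrow> \<psi> \<in> hset)"
proof -
  have 1: "\<psi> \<in> hset" if "(\<phi> \<^bold>\<longrightarrow> \<psi>) \<in> hset" "\<phi> \<in> hset"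
    using that by (meson Hyp Imp_E hset_closed)
  have 2: "(\<phi> \<^bold>\<longrightarrow> \<psi>) \<in> hset" if "\<psi> \<in> hset"
    using that by (meson Hyp Imp_I hset_closed insertCI)
  have 3: "(\<phi> \<^bold>\<longrightarrow> \<psi>) \<in> hset" if "\<phi> \<notin> hset"
  proof -
    have "(\<^bold>\<not> \<phi>) \<in> hset" using that hset(1) unfolding henkin_def by blast
    then have "insert (\<^bold>\<not> \<psi>) (insert \<phi> hset) \<turnstile> \<^bold>\<bottom>"
      using Neg_elim[of "insert (\<^bold>\<not> \<psi>) (insert \<phi> hset)" \<phi>] by (simp add: Hyp)
    then show ?thesis by (meson RAA Imp_I hset_closed)
  qed
  show ?thesis using 1 2 3 by blast
qed

lemma hset_Neg: "(\<^bold>\<not> \<phi>) \<in> hset \<longleftrightarrow> \<phi> \<notin> hset"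
  using hset_Imp[of \<phi> "\<^bold>\<bottom>"] hset(1) unfolding henkin_def Neg_def by blast

lemma hset_AllN: "AllN \<phi> \<in> hset \<longleftrightarrow> (\<forall>t. instN t \<phi> \<in> hset)"
proof
  assume "AllN \<phi> \<in> hset"
  then show "\<forall>t. instN t \<phi> \<in> hset" by (meson Hyp AllN_E hset_closed)
next
  assume *: "\<forall>t. instN t \<phi> \<in> hset"
  show "AllN \<phi> \<in> hset"
  proof (rule ccontr)
    assume "AllN \<phi> \<notin> hset"
    then obtain t where "(\<^bold>\<not> instN t \<phi>) \<in> hset"
      using hset(1) hset_Neg unfolding henkin_def by blast
    then show False using * hset_Neg by blast
  qed
qed

lemma hset_AllS: "AllS \<phi> \<in> hset \<longleftrightarrow> (\<forall>t. instS t \<phi> \<in> hset)"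
proof
  assume "AllS \<phi> \<in> hset"
  then show "\<forall>t. instS t \<phi> \<in> hset" by (meson Hyp AllS_E hset_closed)
next
  assume *: "\<forall>t. instS t \<phi> \<in> hset"
  show "AllS \<phi> \<in> hset"
  proof (rule ccontr)
    assume "AllS \<phi> \<notin> hset"
    then obtain t where "(\<^bold>\<not> instS t \<phi>) \<in> hset"
      using hset(1) hset_Neg unfolding henkin_def by blast
    then show False using * hset_Neg by blast
  qed
qed

text \<open>The induction is over all simultaneous substitutions, because a quantifier extends the
  environment. Every element of the model is the class of a term and every set is named by a set
  variable, so quantifying over the model amounts to quantifying over instances.\<close>

lemma truth_lemma:
  "sat sets_trm (\<lambda>i. abs_trm (\<sigma> i)) (\<lambda>X. Collect (set_trm (\<rho> X))) \<phi> \<longleftrightarrow> sub_fm \<sigma> \<rho> \<phi> \<in> hset"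
proof (induction \<phi> arbitrary: \<sigma> \<rho>)
  case (Eq s t)
  then show ?case by (simp add: val_trm trm.abs_eq_iff)
next
  case (Less s t)
  then show ?case by (simp add: val_trm less_trm.abs_eq)
next
  case (Mem t X)
  then show ?case by (simp add: val_trm set_trm.abs_eq)
next
  case Fls
  then show ?case using hset(1) by (simp add: henkin_def)
next
  case (Imp \<phi> \<psi>)
  then show ?case by (simp add: hset_Imp)
next
  case (AllN \<phi>)
  have "case_nat (abs_trm t) (\<lambda>i. abs_trm (\<sigma> i)) = (\<lambda>i. abs_trm (case_nat t \<sigma> i))" for t
    by (auto simp: fun_eq_iff split: nat.split)
  then have P: "sat sets_trm (case_nat (abs_trm t) (\<lambda>i. abs_trm (\<sigma> i))) (\<lambda>X. Collect (set_trm (\<rho> X))) \<phi>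
      \<longleftrightarrow> sub_fm (case_nat t \<sigma>) \<rho> \<phi> \<in> hset" for t
    by (simp only: AllN.IH)
  have "(\<forall>x. Q x) \<longleftrightarrow> (\<forall>t. Q (abs_trm t))" for Q
    using trm.abs_induct[of Q] by blast
  then show ?case by (simp only: sat.simps sub_fm.simps hset_AllN instN_slift P)
next
  case (AllS \<phi>)
  have "case_nat (Collect (set_trm Y)) (\<lambda>X. Collect (set_trm (\<rho> X)))
      = (\<lambda>X. Collect (set_trm (case_nat Y \<rho> X)))" for Y
    by (auto simp: fun_eq_iff split: nat.split)
  then have P: "sat sets_trm (\<lambda>i. abs_trm (\<sigma> i)) (case_nat (Collect (set_trm Y)) (\<lambda>X. Collect (set_trm (\<rho> X)))) \<phi>
      \<longleftrightarrow> sub_fm \<sigma> (case_nat Y \<rho>) \<phi> \<in> hset" for Y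
    by (simp only: AllS.IH)
  have "(\<forall>X\<in>sets_trm. Q X) \<longleftrightarrow> (\<forall>Y. Q (Collect (set_trm Y)))" for Q
    by (simp add: sets_trm_def)
  then show ?case by (simp only: sat.simps sub_fm.simps hset_AllS instS_slift P)
qed

lemma sat_hset:
  "sat sets_trm (\<lambda>i. abs_trm (V i)) (\<lambda>X. Collect (set_trm X)) \<phi> \<longleftrightarrow> \<phi> \<in> hset"
  using truth_lemma[of V "\<lambda>X. X" \<phi>] by simp

section \<open>Arithmetic of the term model\<close>

lemma sat_PA_minus:
  fixes s :: "nat \<Rightarrow> 'a::{zero,one,plus,times,ord} set"
  assumes "range s \<subseteq> S" "\<forall>\<phi>\<in>PA_minus. sat S e s \<phi>"
  shows "(x + y) + z = x + (y + z :: 'a)" "x + y = y + x" "(x * y) * z = x * (y * z)" "x * y = y * x"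
    "x * (y + z) = x * y + x * z" "x + 0 = x" "x * 0 = 0" "x * 1 = x"
    "x < y \<Longrightarrow> y < z \<Longrightarrow> x < z" "\<not> x < x" "x < y \<or> x = y \<or> y < x"
    "x < y \<Longrightarrow> x + z < y + z" "0 < z \<Longrightarrow> x < y \<Longrightarrow> x * z < y * z"
    "x < y \<Longrightarrow> \<exists>w. x + w = y" "0 < (1::'a)" "0 < x \<Longrightarrow> 1 < x \<or> x = 1" "0 < x \<or> x = 0"
proof -
  note 1 = closures_instance[OF assms(2)[unfolded PA_minus_def Let_def] assms(1),
      of "case_nat x (case_nat y (\<lambda>_. z))"]
  note 2 = 1[simplified, simplified One_nat_def numeral_2_eq_2 Leq_def, simplified]
  show "(x + y) + z = x + (y + z :: 'a)" "x + y = y + x" "(x * y) * z = x * (y * z)" "x * y = y * x"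
    "x * (y + z) = x * y + x * z" "x + 0 = x" "x * 0 = 0" "x * 1 = x"
    "x < y \<Longrightarrow> y < z \<Longrightarrow> x < z" "\<not> x < x" "x < y \<or> x = y \<or> y < x"
    "x < y \<Longrightarrow> x + z < y + z" "0 < z \<Longrightarrow> x < y \<Longrightarrow> x * z < y * z"
    "x < y \<Longrightarrow> \<exists>w. x + w = y" "0 < (1::'a)" "0 < x \<Longrightarrow> 1 < x \<or> x = 1" "0 < x \<or> x = 0"
    using 2 by (argo | blast)+
qed

lemma trm_sets: "range (\<lambda>X. Collect (set_trm X)) \<subseteq> sets_trm"
  by (simp add: sets_trm_def)

lemma trm_sat_PA_minus:
  "\<forall>\<phi>\<in>PA_minus. sat sets_trm (\<lambda>i. abs_trm (V i)) (\<lambda>X. Collect (set_trm X)) \<phi>"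
  using hset(2) sat_hset by blast

lemmas trm_PA = sat_PA_minus[OF trm_sets trm_sat_PA_minus]

text \<open>This makes the truncated difference that \<open>linordered_semidom\<close> demands well
  defined.\<close>

lemma trm_minus_ex1:
  fixes x y :: trm
  assumes "y \<le> x" shows "\<exists>!z. y + z = x"
proof -
  have "\<exists>z. y + z = x"
    using assms trm_PA(6,14) unfolding less_eq_trm_def by blast
  moreover have "z = w" if "y + z = y + w" for z w
  proof -
    have False if "z < w" "y + z = y + w" for z w
      using trm_PA(12)[OF that(1), of y] that(2) trm_PA(10) trm_PA(2)[of _ y] by simp
    then show ?thesis using trm_PA(11)[of z w] that by metis
  qed
  ultimately show ?thesis by blast
qed

instantiation trm :: pam
begin
definition minus_trm :: "trm \<Rightarrow> trm \<Rightarrow> trm"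
  where "minus_trm x y = (if y \<le> x then THE z. y + z = x else 0)"
instance
proof
  fix x y z :: trm
  note P = trm_PA
  note le = less_eq_trm_def
  have le_add: "b \<le> b + c" for b c :: trm
    using P(17)[of c] P(12)[of 0 c b] P(2) P(6) unfolding le by metis
  have not_le: "\<not> b \<le> a \<longleftrightarrow> a < b" for a b :: trm
    using P(9,10,11) unfolding le by metis
  have diffI: "a - b = c" if "b + c = a" for a b c :: trm
  proof -
    have "b \<le> a" using le_add that by blast
    moreover have "(THE z. b + z = a) = c"
      using trm_minus_ex1[OF \<open>b \<le> a\<close>] that by (intro the1_equality)
    ultimately show ?thesis by (simp add: minus_trm_def)
  qed
  have diff_less: "a - b = 0" if "a < b" for a b :: trm
  proof -
    have "\<not> b \<le> a" using that not_le by blast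
    then show ?thesis by (simp add: minus_trm_def)
  qed
  have le_E: "\<exists>c. a = b + c" if "b \<le> a" for a b :: trm
    using trm_minus_ex1[OF that] by metis
  have zero_diff: "0 - a = 0" for a :: trm
    using diffI[of a 0 0] diff_less[of 0 a] P(6,17)[of a] by metis
  have add0: "0 + a = a" for a :: trm using P(2,6) by metis
  have mono: "c + a < c + b" if "a < b" for a b c :: trm using P(12)[OF that, of c] P(2) by metis
  show "x + y + z = x + (y + z)" "x + y = y + x" "x * y * z = x * (y * z)" "x * y = y * x"
    "x * (y + z) = x * y + x * z" "x * 0 = 0" "(0::trm) < 1"
    by (fact P)+
  show "x + y - x = y" by (rule diffI) simp
  show "x - y - z = x - (y + z)"
  proof (cases "y \<le> x")
    case True
    then obtain d where d: "x = y + d" using le_E by blast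
    show ?thesis
    proof (cases "z \<le> d")
      case True
      then obtain f where "d = z + f" using le_E by blast
      then have "x - y = d" "d - z = f" "x - (y + z) = f"
        using d P(1) by (auto intro!: diffI)
      then show ?thesis by simp
    next
      case False
      then have "d < z" using not_le by blast
      then have "x < y + z" using mono d by blast
      moreover have "x - y = d" using d by (auto intro: diffI)
      ultimately show ?thesis using diff_less \<open>d < z\<close> by metis
    qed
  next
    case False
    then have "x < y" using not_le by blast
    moreover have "x < y + z" using \<open>x < y\<close> le_add[of y z] P(9) unfolding le by metis
    ultimately show ?thesis using diff_less zero_diff by metis
  qed
  show "(x < y) = (x \<le> y \<and> \<not> y \<le> x)" "x \<le> x" "x \<le> y \<Longrightarrow> y \<le> z \<Longrightarrow> x \<le> z"
    "x \<le> y \<Longrightarrow> y \<le> x \<Longrightarrow> x = y" "x \<le> y \<or> y \<le> x"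
    using P(9,10,11) unfolding le by metis+
  show "x \<le> y \<Longrightarrow> z + x \<le> z + y" using mono unfolding le by metis
  show "0 + x = x" by (fact add0)
  show "(x + y) * z = x * z + y * z" using P(4,5) by metis
  show "0 * x = 0" "1 * x = x" using P(4,7,8) by metis+
  show "x < y \<Longrightarrow> 0 < z \<Longrightarrow> z * x < z * y" using P(4,13) by metis
  show "(0::trm) \<noteq> 1" using P(10,15) by metis
  show "x * (y - z) = x * y - x * z"
  proof (cases "z \<le> y")
    case True
    then obtain d where d: "y = z + d" using le_E by blast
    then have "y - z = d" "x * y - x * z = x * d"
      using P(5) by (auto intro!: diffI)
    then show ?thesis by simp
  next
    case False
    then have *: "y < z" "y - z = 0" using not_le diff_less by blast+
    have "x * y - x * z = 0"
    proof (cases "x = 0")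
      case True
      then have "x * y = 0" "x * z = 0" using P(4,7) by metis+
      then show ?thesis using zero_diff by simp
    next
      case False
      then have "x * y < x * z" using P(4,13,17) * by metis
      then show ?thesis by (rule diff_less)
    qed
    then show ?thesis using * P(7) by simp
  qed
  show "x \<noteq> 0 \<Longrightarrow> y \<noteq> 0 \<Longrightarrow> x * y \<noteq> 0"
    using P(4,7,10,13,17) by metis
  show "y \<le> x \<Longrightarrow> x - y + y = x"
    using le_E diffI P(2) by metis
  show "0 \<le> x" "0 < x \<Longrightarrow> 1 \<le> x" using P(16,17) unfolding le by metis+
qed
end

text \<open>If the goal were not derivable, \<open>hset\<close> would contain its negation together
  with the theory, and the truth lemma would make the term model a counterexample. Truth in
  structures over this one type is therefore enough.\<close>

lemma provable_if_true_in_trm: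
  assumes "\<And>S e (s :: nat \<Rightarrow> trm set). range s \<subseteq> S \<Longrightarrow> \<forall>\<phi>\<in>theory_2p7. sat S e s \<phi> \<Longrightarrow> sat S e s goal_2p7"
  shows "theory_2p7 \<turnstile> goal_2p7"
proof (rule ccontr)
  assume *: "\<not> (theory_2p7 \<turnstile> goal_2p7)"
  then have "sat sets_trm (\<lambda>i. abs_trm (V i)) (\<lambda>X. Collect (set_trm X)) goal_2p7"
    using hset(3) sat_hset by (intro assms[OF trm_sets]) blast
  then show False using * hset(3) hset_Neg sat_hset by blast
qed

section \<open>Definable predicates\<close>

lemma case_nat_1 [simp]: "case_nat a f 1 = f 0"
  by (simp add: One_nat_def)

lemma sat_Delta00: "\<phi> \<in> Delta00 \<Longrightarrow> sat S e s \<phi> \<longleftrightarrow> sat S' e s \<phi>"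
  by (induction arbitrary: e rule: Delta00.induct) auto

lemma sub_tm_slift_up [simp]: "sub_tm (slift \<sigma>) (up 1 t) = up 1 (sub_tm \<sigma> t)"
  by (simp add: sub_tm_up up_sub_tm One_nat_def)

lemma sub_fm_Delta00: "\<phi> \<in> Delta00 \<Longrightarrow> sub_fm \<sigma> \<rho> \<phi> \<in> Delta00"
proof (induction arbitrary: \<sigma> rule: Delta00.induct)
  case (6 \<phi> t)
  then show ?case
    using Delta00.intros(6)[of "sub_fm (slift \<sigma>) \<rho> \<phi>" "sub_tm \<sigma> t"] by simp
next
  case (7 \<phi> t)
  then show ?case
    using Delta00.intros(7)[of "sub_fm (slift \<sigma>) \<rho> \<phi>" "sub_tm \<sigma> t"] by simp
qed (auto intro: Delta00.intros)

text \<open>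
  Variable \<open>i\<close> of a formula is interpreted by \<open>\<sigma> i\<close>: either an argument of the predicate that
  the formula defines, or a number parameter.
\<close>

definition penv :: "(nat \<Rightarrow> nat + 'a) \<Rightarrow> (nat \<Rightarrow> 'a) \<Rightarrow> nat \<Rightarrow> 'a"
  where "penv \<sigma> e i = (case \<sigma> i of Inl k \<Rightarrow> e k | Inr a \<Rightarrow> a)"

named_theorems D0_intros

definition Tm :: "((nat \<Rightarrow> 'a::pam) \<Rightarrow> 'a) \<Rightarrow> bool"
  where "Tm f \<longleftrightarrow> (\<exists>t \<sigma>. \<forall>e. f e = val (penv \<sigma> e) t)"

text \<open>A collects the admissible set parameters: S where induction and comprehension are to
  apply, \<open>{F}\<close> where a machine with oracle f must decide the predicate. Number
  parameters are unrestricted. Bounded formulas have no set quantifiers, so satisfaction may be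
  taken over the empty collection.\<close>

definition D0 :: "'a::pam set set \<Rightarrow> ((nat \<Rightarrow> 'a) \<Rightarrow> bool) \<Rightarrow> bool" where
  "D0 A P \<longleftrightarrow> (\<exists>\<phi>\<in>Delta00. \<exists>s \<sigma>. range s \<subseteq> A \<and> (\<forall>e. P e \<longleftrightarrow> sat {} (penv \<sigma> e) s \<phi>))"

lemma D0_mono: "D0 A P \<Longrightarrow> A \<subseteq> B \<Longrightarrow> D0 B P"
  unfolding D0_def by (meson order_trans)

text \<open>Interleaving lets two formulas with separate parameters live in one environment, on its
  even and odd variables.\<close>

definition join :: "(nat \<Rightarrow> 'b) \<Rightarrow> (nat \<Rightarrow> 'b) \<Rightarrow> nat \<Rightarrow> 'b"
  where "join f g i = (if even i then f (i div 2) else g (i div 2))"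

lemma join_simps [simp]: "join f g (2 * i) = f i" "join f g (Suc (2 * i)) = g i"
  by (simp_all add: join_def)

lemma range_join: "range f \<subseteq> A \<Longrightarrow> range g \<subseteq> A \<Longrightarrow> range (join f g) \<subseteq> A"
  by (auto simp: join_def)

lemma penv_join [simp]:
  "(\<lambda>i. penv (join \<sigma> \<tau>) e (2 * i)) = penv \<sigma> e"
  "(\<lambda>i. penv (join \<sigma> \<tau>) e (Suc (2 * i))) = penv \<tau> e"
  by (simp_all add: penv_def fun_eq_iff)

lemma penv_join_apply [simp]:
  "penv (join \<sigma> \<tau>) e (2 * i) = penv \<sigma> e i"
  "penv (join \<sigma> \<tau>) e (Suc (2 * i)) = penv \<tau> e i"
  by (simp_all add: penv_def)

lemma Tm_pairE:
  assumes "Tm f" "Tm g"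
  obtains t u \<sigma> where "\<And>e. f e = val (penv \<sigma> e) t" "\<And>e. g e = val (penv \<sigma> e) u"
proof -
  obtain t \<sigma> u \<tau> where "\<And>e. f e = val (penv \<sigma> e) t" "\<And>e. g e = val (penv \<tau> e) u"
    using assms unfolding Tm_def by blast
  then show thesis
    by (intro that[of "join \<sigma> \<tau>" "sub_tm (\<lambda>i. V (2 * i)) t" "sub_tm (\<lambda>i. V (Suc (2 * i))) u"])
       (simp_all add: val_sub_tm)
qed

lemma Tm_var [D0_intros]: "Tm (\<lambda>e. e k)"
  unfolding Tm_def by (intro exI[of _ "V 0"] exI[of _ "\<lambda>_. Inl k"]) (simp add: penv_def)

lemma Tm_const [D0_intros]: "Tm (\<lambda>e. a)"
  unfolding Tm_def by (intro exI[of _ "V 0"] exI[of _ "\<lambda>_. Inr a"]) (simp add: penv_def)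

lemma Tm_add [D0_intros]: "Tm f \<Longrightarrow> Tm g \<Longrightarrow> Tm (\<lambda>e. f e + g e)"
  by (erule (1) Tm_pairE) (unfold Tm_def, metis val.simps(4))

lemma Tm_mul [D0_intros]: "Tm f \<Longrightarrow> Tm g \<Longrightarrow> Tm (\<lambda>e. f e * g e)"
  by (erule (1) Tm_pairE) (unfold Tm_def, metis val.simps(5))

lemma Tm_rename: "Tm f \<Longrightarrow> Tm (\<lambda>e. f (\<lambda>k. e (\<pi> k)))"
  unfolding Tm_def
proof (elim exE)
  fix t \<sigma> assume "\<forall>e. f e = val (penv \<sigma> e) t"
  moreover have "penv (\<lambda>i. map_sum \<pi> id (\<sigma> i)) e = penv \<sigma> (\<lambda>k. e (\<pi> k))" for e :: "nat \<Rightarrow> 'a"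
    by (auto simp: penv_def fun_eq_iff split: sum.split)
  ultimately show "\<exists>t \<sigma>. \<forall>e. f (\<lambda>k. e (\<pi> k)) = val (penv \<sigma> e) t"
    by (intro exI[of _ t] exI[of _ "\<lambda>i. map_sum \<pi> id (\<sigma> i)"]) simp
qed

lemma D0_rename: "D0 A P \<Longrightarrow> D0 A (\<lambda>e. P (\<lambda>k. e (\<pi> k)))"
  unfolding D0_def
proof (elim bexE exE conjE)
  fix \<phi> s \<sigma> assume "\<phi> \<in> Delta00" "range s \<subseteq> A" "\<forall>e. P e \<longleftrightarrow> sat {} (penv \<sigma> e) s \<phi>"
  moreover have "penv (\<lambda>i. map_sum \<pi> id (\<sigma> i)) e = penv \<sigma> (\<lambda>k. e (\<pi> k))" for e :: "nat \<Rightarrow> 'a"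
    by (auto simp: penv_def fun_eq_iff split: sum.split)
  ultimately show "\<exists>\<phi>\<in>Delta00. \<exists>s \<sigma>. range s \<subseteq> A \<and>
      (\<forall>e. P (\<lambda>k. e (\<pi> k)) \<longleftrightarrow> sat {} (penv \<sigma> e) s \<phi>)"
    by (intro bexI[of _ \<phi>] exI[of _ s] exI[of _ "\<lambda>i. map_sum \<pi> id (\<sigma> i)"]) simp_all
qed

lemma D0_pairE:
  assumes "D0 A P" "D0 A Q"
  obtains \<phi> \<psi> s \<sigma> where "\<phi> \<in> Delta00" "\<psi> \<in> Delta00" "range s \<subseteq> A"
    "\<And>e. P e \<longleftrightarrow> sat {} (penv \<sigma> e) s \<phi>" "\<And>e. Q e \<longleftrightarrow> sat {} (penv \<sigma> e) s \<psi>"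
proof -
  obtain \<phi> s \<sigma> where \<phi>: "\<phi> \<in> Delta00" "range s \<subseteq> A" "\<And>e. P e \<longleftrightarrow> sat {} (penv \<sigma> e) s \<phi>"
    using assms(1) unfolding D0_def by blast
  obtain \<psi> r \<tau> where \<psi>: "\<psi> \<in> Delta00" "range r \<subseteq> A" "\<And>e. Q e \<longleftrightarrow> sat {} (penv \<tau> e) r \<psi>"
    using assms(2) unfolding D0_def by blast
  show thesis
    using \<phi> \<psi>
    by (intro that[of "sub_fm (\<lambda>i. V (2 * i)) (\<lambda>i. 2 * i) \<phi>"
          "sub_fm (\<lambda>i. V (Suc (2 * i))) (\<lambda>i. Suc (2 * i)) \<psi>" "join s r" "join \<sigma> \<tau>"])
       (simp_all add: sub_fm_Delta00 sat_sub_fm range_join)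
qed

lemma D0_imp [D0_intros]: "D0 A P \<Longrightarrow> D0 A Q \<Longrightarrow> D0 A (\<lambda>e. P e \<longrightarrow> Q e)"
  by (erule (1) D0_pairE) (unfold D0_def, metis Delta00.intros(5) sat.simps(5))

lemma D0_eq [D0_intros]: "A \<noteq> {} \<Longrightarrow> Tm f \<Longrightarrow> Tm g \<Longrightarrow> D0 A (\<lambda>e. f e = g e)"
  and D0_less [D0_intros]: "A \<noteq> {} \<Longrightarrow> Tm f \<Longrightarrow> Tm g \<Longrightarrow> D0 A (\<lambda>e. f e < g e)"
proof -
  assume "A \<noteq> {}" "Tm f" "Tm g"
  then obtain t u \<sigma> X where "\<And>e. f e = val (penv \<sigma> e) t" "\<And>e. g e = val (penv \<sigma> e) u" "X \<in> A"
    using Tm_pairE by (metis ex_in_conv)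
  note tu = this
  show "D0 A (\<lambda>e. f e = g e)"
    unfolding D0_def using tu
    by (intro bexI[of _ "t \<^bold>= u"] exI[of _ "\<lambda>_. X"] exI[of _ \<sigma>]) (auto intro: Delta00.intros)
  show "D0 A (\<lambda>e. f e < g e)"
    unfolding D0_def using tu
    by (intro bexI[of _ "t \<^bold>< u"] exI[of _ "\<lambda>_. X"] exI[of _ \<sigma>]) (auto intro: Delta00.intros)
qed

lemma D0_mem [D0_intros]: "X \<in> A \<Longrightarrow> Tm f \<Longrightarrow> D0 A (\<lambda>e. f e \<in> X)"
proof -
  assume X: "X \<in> A" and "Tm f"
  then obtain t \<sigma> where "\<And>e. f e = val (penv \<sigma> e) t" unfolding Tm_def by blast
  then show ?thesis
    unfolding D0_def using X
    by (intro bexI[of _ "t \<^bold>\<in> 0"] exI[of _ "\<lambda>_. X"] exI[of _ \<sigma>]; auto intro: Delta00.intros)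
qed

lemma D0_False: "A \<noteq> {} \<Longrightarrow> D0 A (\<lambda>e. False)"
  using D0_less[of A "\<lambda>_. 0" "\<lambda>_. 0"] Tm_const[of 0] by simp

lemma D0_not [D0_intros]: "D0 A P \<Longrightarrow> D0 A (\<lambda>e. \<not> P e)"
proof -
  assume "D0 A P"
  moreover from this have "D0 A (\<lambda>e. False)" by (intro D0_False) (auto simp: D0_def)
  ultimately show ?thesis using D0_imp[of A P "\<lambda>e. False"] by simp
qed

lemma D0_or [D0_intros]: "D0 A P \<Longrightarrow> D0 A Q \<Longrightarrow> D0 A (\<lambda>e. P e \<or> Q e)"
  using D0_imp[of A "\<lambda>e. \<not> P e" Q] D0_not[of A P] by (simp add: disj_imp)

lemma D0_and [D0_intros]: "D0 A P \<Longrightarrow> D0 A Q \<Longrightarrow> D0 A (\<lambda>e. P e \<and> Q e)"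
  using D0_not[OF D0_imp[of A P "\<lambda>e. \<not> Q e"]] D0_not[of A Q] by simp

lemma D0_le [D0_intros]: "A \<noteq> {} \<Longrightarrow> Tm f \<Longrightarrow> Tm g \<Longrightarrow> D0 A (\<lambda>e. f e \<le> g e)"
  using D0_not[OF D0_less[of A g f]] by (simp add: not_less)

lemma D0_const: "A \<noteq> {} \<Longrightarrow> D0 A (\<lambda>e. b)"
  by (cases b) (use D0_False D0_not[OF D0_False] in auto)

text \<open>In the second hypothesis \<open>e 0\<close> stands for the bound variable and the outer
  arguments are shifted by one. In this form the rule can be applied repeatedly under nested
  quantifiers.\<close>

lemma D0_all [D0_intros]:
  assumes "Tm f" and "D0 A (\<lambda>e. P (\<lambda>k. e (Suc k)) (e 0))"
  shows "D0 A (\<lambda>e. \<forall>x<f e. P e x)"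
proof -
  obtain t \<tau> where t: "\<And>e. f e = val (penv \<tau> e) t" using assms(1) unfolding Tm_def by blast
  obtain \<phi> s \<sigma> where \<phi>: "\<phi> \<in> Delta00" "range s \<subseteq> A"
    "\<And>e. P (\<lambda>k. e (Suc k)) (e 0) \<longleftrightarrow> sat {} (penv \<sigma> e) s \<phi>"
    using assms(2) unfolding D0_def by blast
  define \<sigma>' where "\<sigma>' i = (case \<sigma> i of Inl k \<Rightarrow> Inl (k - 1) | Inr a \<Rightarrow> Inr a)" for i
  \<comment> \<open>Variables that read argument 0 become the newly bound variable. The others go to
    the even positions of the joined environment, one place further because of the binder; the odd
    positions serve the bound t.\<close>
  define \<pi> where "\<pi> i = (if \<sigma> i = Inl 0 then V 0 else V (Suc (2 * i)))" for i
  define \<phi>' where "\<phi>' = sub_fm \<pi> (\<lambda>X. X) \<phi>"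
  define t' where "t' = sub_tm (\<lambda>i. V (Suc (2 * i))) t"
  have env: "(\<lambda>i. val (case_nat x (penv (join \<sigma>' \<tau>) e)) (\<pi> i)) = penv \<sigma> (case_nat x e)" for x e
    by (auto simp: fun_eq_iff \<pi>_def \<sigma>'_def penv_def One_nat_def split: sum.split nat.split)
  have t': "val (penv (join \<sigma>' \<tau>) e) t' = f e" for e
    by (simp add: t'_def val_sub_tm t)
  have "P e x \<longleftrightarrow> sat {} (case_nat x (penv (join \<sigma>' \<tau>) e)) s \<phi>'" for e x
    unfolding \<phi>'_def sat_sub_fm env using \<phi>(3)[of "case_nat x e"] by simp
  then have "(\<forall>x<f e. P e x) \<longleftrightarrow> sat {} (penv (join \<sigma>' \<tau>) e) s (AllN (V 0 \<^bold>< up 1 t' \<^bold>\<longrightarrow> \<phi>'))" for e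
    by (simp add: One_nat_def t'[unfolded One_nat_def])
  moreover have "AllN (V 0 \<^bold>< up 1 t' \<^bold>\<longrightarrow> \<phi>') \<in> Delta00"
    unfolding \<phi>'_def by (intro Delta00.intros(6) sub_fm_Delta00 \<phi>)
  ultimately show ?thesis unfolding D0_def using \<phi>(2) by blast
qed

lemma D0_ex [D0_intros]:
  assumes "Tm f" and "D0 A (\<lambda>e. P (\<lambda>k. e (Suc k)) (e 0))"
  shows "D0 A (\<lambda>e. \<exists>x<f e. P e x)"
  using D0_not[OF D0_all[OF assms(1), of A "\<lambda>e x. \<not> P e x"]] D0_not[OF assms(2)] by simp

lemma less_Suc_iff: "x < y + 1 \<longleftrightarrow> x \<le> (y :: 'a::pam)"
proof
  assume *: "x < y + 1"
  show "x \<le> y"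
  proof (rule ccontr)
    assume "\<not> x \<le> y"
    then obtain d where d: "x = y + d" "0 < d"
      by (metis add.commute le_add_diff_inverse2 less_add_same_cancel1 less_imp_le not_le)
    then have "y + 1 \<le> x" using discrete' by simp
    then show False using * by simp
  qed
qed (simp add: add.commute add_strict_increasing)

lemma D0_all_le [D0_intros]:
  assumes "Tm f" and "D0 A (\<lambda>e. P (\<lambda>k. e (Suc k)) (e 0))"
  shows "D0 A (\<lambda>e. \<forall>x\<le>f e. P e x)"
  using D0_all[OF Tm_add[OF assms(1) Tm_const[of 1]], of A P] assms(2) by (simp add: less_Suc_iff)

lemma D0_ex_le [D0_intros]:
  assumes "Tm f" and "D0 A (\<lambda>e. P (\<lambda>k. e (Suc k)) (e 0))"
  shows "D0 A (\<lambda>e. \<exists>x\<le>f e. P e x)"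
  using D0_ex[OF Tm_add[OF assms(1) Tm_const[of 1]], of A P] assms(2) by (simp add: less_Suc_iff)

text \<open>Substituting a term is simulated by a bounded quantifier, x \<le> f e with x = f e,
  which avoids substitution in formulas. With this, it suffices to define a relation on variables;
  the \<open>D0_subst\<close> lemmas below pass to terms.\<close>

lemma D0_inst:
  assumes "Tm f" and "D0 A (\<lambda>e. P (\<lambda>k. e (Suc k)) (e 0))"
  shows "D0 A (\<lambda>e. P e (f e))"
proof -
  have "A \<noteq> {}" using assms(2) by (auto simp: D0_def)
  then have "D0 A (\<lambda>e. \<exists>x\<le>f e. x = f e \<and> P e x)"
    using assms Tm_rename[OF assms(1), of Suc] by (intro D0_intros)
  then show ?thesis by simp
qed

lemma D0_subst2:
  assumes "\<And>i j. D0 A (\<lambda>e. R (e i) (e j))"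
    and "Tm f" "Tm g"
  shows "D0 A (\<lambda>e. R (f e) (g e))"
proof (rule D0_inst[OF assms(2)])
  show "D0 A (\<lambda>e. R (e 0) (g (\<lambda>k. e (Suc k))))"
  proof (rule D0_inst[OF Tm_rename[OF assms(3), of "\<lambda>k. Suc k"]])
    show "D0 A (\<lambda>e. R (e (Suc 0)) (e 0))"
      by (rule assms(1))
  qed
qed

lemma D0_subst3:
  assumes "\<And>i j k. D0 A (\<lambda>e. R (e i) (e j) (e k))"
    and "Tm f" "Tm g" "Tm h"
  shows "D0 A (\<lambda>e. R (f e) (g e) (h e))"
proof (rule D0_inst[OF assms(2)])
  show "D0 A (\<lambda>e. R (e 0) (g (\<lambda>k. e (Suc k))) (h (\<lambda>k. e (Suc k))))"
  proof (rule D0_inst[OF Tm_rename[OF assms(3), of "\<lambda>k. Suc k"]])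
    show "D0 A (\<lambda>e. R (e (Suc 0)) (e 0) (h (\<lambda>k. e (Suc (Suc k)))))"
    proof (rule D0_inst[OF Tm_rename[OF assms(4), of "\<lambda>k. Suc (Suc k)"]])
      show "D0 A (\<lambda>e. R (e (Suc (Suc 0))) (e (Suc 0)) (e 0))"
        by (rule assms(1))
    qed
  qed
qed

lemma D0_subst4:
  assumes "\<And>i j k l. D0 A (\<lambda>e. R (e i) (e j) (e k) (e l))"
    and "Tm f" "Tm g" "Tm h" "Tm u"
  shows "D0 A (\<lambda>e. R (f e) (g e) (h e) (u e))"
proof (rule D0_inst[OF assms(2)])
  show "D0 A (\<lambda>e. R (e 0) (g (\<lambda>k. e (Suc k))) (h (\<lambda>k. e (Suc k))) (u (\<lambda>k. e (Suc k))))"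
  proof (rule D0_inst[OF Tm_rename[OF assms(3), of "\<lambda>k. Suc k"]])
    show "D0 A (\<lambda>e. R (e (Suc 0)) (e 0) (h (\<lambda>k. e (Suc (Suc k)))) (u (\<lambda>k. e (Suc (Suc k)))))"
    proof (rule D0_inst[OF Tm_rename[OF assms(4), of "\<lambda>k. Suc (Suc k)"]])
      show "D0 A (\<lambda>e. R (e (Suc (Suc 0))) (e (Suc 0)) (e 0) (u (\<lambda>k. e (Suc (Suc (Suc k))))))"
      proof (rule D0_inst[OF Tm_rename[OF assms(5), of "\<lambda>k. Suc (Suc (Suc k))"]])
        show "D0 A (\<lambda>e. R (e (Suc (Suc (Suc 0)))) (e (Suc (Suc 0))) (e (Suc 0)) (e 0))"
          by (rule assms(1))
      qed
    qed
  qed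
qed

lemma D0_subst5:
  assumes "\<And>i j k l m. D0 A (\<lambda>e. R (e i) (e j) (e k) (e l) (e m))"
    and "Tm f" "Tm g" "Tm h" "Tm u" "Tm v"
  shows "D0 A (\<lambda>e. R (f e) (g e) (h e) (u e) (v e))"
proof (rule D0_inst[OF assms(2)])
  show "D0 A (\<lambda>e. R (e 0) (g (\<lambda>k. e (Suc k))) (h (\<lambda>k. e (Suc k))) (u (\<lambda>k. e (Suc k))) (v (\<lambda>k. e (Suc k))))"
  proof (rule D0_inst[OF Tm_rename[OF assms(3), of "\<lambda>k. Suc k"]])
    show "D0 A (\<lambda>e. R (e (Suc 0)) (e 0) (h (\<lambda>k. e (Suc (Suc k)))) (u (\<lambda>k. e (Suc (Suc k)))) (v (\<lambda>k. e (Suc (Suc k)))))"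
    proof (rule D0_inst[OF Tm_rename[OF assms(4), of "\<lambda>k. Suc (Suc k)"]])
      show "D0 A (\<lambda>e. R (e (Suc (Suc 0))) (e (Suc 0)) (e 0) (u (\<lambda>k. e (Suc (Suc (Suc k))))) (v (\<lambda>k. e (Suc (Suc (Suc k))))))"
      proof (rule D0_inst[OF Tm_rename[OF assms(5), of "\<lambda>k. Suc (Suc (Suc k))"]])
        show "D0 A (\<lambda>e. R (e (Suc (Suc (Suc 0)))) (e (Suc (Suc 0))) (e (Suc 0)) (e 0) (v (\<lambda>k. e (Suc (Suc (Suc (Suc k)))))))"
        proof (rule D0_inst[OF Tm_rename[OF assms(6), of "\<lambda>k. Suc (Suc (Suc (Suc k)))"]])
          show "D0 A (\<lambda>e. R (e (Suc (Suc (Suc (Suc 0))))) (e (Suc (Suc (Suc 0)))) (e (Suc (Suc 0))) (e (Suc 0)) (e 0))"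
            by (rule assms(1))
        qed
      qed
    qed
  qed
qed

lemma D0_penv: "D0 A P \<Longrightarrow> D0 A (\<lambda>e. P (penv \<tau> e))"
  unfolding D0_def
proof (elim bexE exE conjE)
  fix \<phi> s \<sigma> assume "\<phi> \<in> Delta00" "range s \<subseteq> A" "\<forall>e. P e \<longleftrightarrow> sat {} (penv \<sigma> e) s \<phi>"
  moreover have "penv (\<lambda>i. case \<sigma> i of Inl k \<Rightarrow> \<tau> k | Inr a \<Rightarrow> Inr a) e = penv \<sigma> (penv \<tau> e)" for e
    by (auto simp: penv_def fun_eq_iff split: sum.split)
  ultimately show "\<exists>\<phi>\<in>Delta00. \<exists>s \<sigma>. range s \<subseteq> A \<and>
      (\<forall>e. P (penv \<tau> e) \<longleftrightarrow> sat {} (penv \<sigma> e) s \<phi>)"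
    by (intro bexI[of _ \<phi>] exI[of _ s]
        exI[of _ "\<lambda>i. case \<sigma> i of Inl k \<Rightarrow> \<tau> k | Inr a \<Rightarrow> Inr a"]) simp_all
qed

lemma not_less_zero' [simp]: "\<not> x < (0 :: 'a::pam)"
  by (simp add: not_less)

section \<open>Sigma_1 predicates\<close>

definition S1 :: "'a::pam set set \<Rightarrow> ((nat \<Rightarrow> 'a) \<Rightarrow> bool) \<Rightarrow> bool" where
  "S1 A P \<longleftrightarrow> (\<exists>R. D0 A (\<lambda>e. R (\<lambda>k. e (Suc k)) (e 0)) \<and> (\<forall>e. P e \<longleftrightarrow> (\<exists>x. R e x)))"

lemma S1_ex_D0:
  assumes "D0 A (\<lambda>e. R (\<lambda>k. e (Suc k)) (e 0))" shows "S1 A (\<lambda>e. \<exists>x. R e x)"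
  using assms unfolding S1_def by blast

lemma S1_D0: "D0 A P \<Longrightarrow> S1 A P"
  unfolding S1_def by (intro exI[of _ "\<lambda>e x. P e"]) (simp add: D0_rename)

lemma S1E:
  assumes "S1 A P"
  obtains R where "D0 A (\<lambda>e. R (\<lambda>k. e (Suc k)) (e 0))" "P = (\<lambda>e. \<exists>x. R e x)"
proof -
  obtain R where "D0 A (\<lambda>e. R (\<lambda>k. e (Suc k)) (e 0))" "\<forall>e. P e \<longleftrightarrow> (\<exists>x. R e x)"
    using assms unfolding S1_def by blast
  then show thesis by (intro that[of R]) (simp_all add: fun_eq_iff)
qed

lemma S1_cong: "S1 A P \<Longrightarrow> (\<And>e. P e \<longleftrightarrow> Q e) \<Longrightarrow> S1 A Q"
  by (simp add: S1_def)

text \<open>Two existential quantifiers are merged by one common bound m for both witnesses, so no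
  decoding of pairs is needed.\<close>

lemma S1_ex:
  assumes "S1 A (\<lambda>e. P (\<lambda>k. e (Suc k)) (e 0))" shows "S1 A (\<lambda>e. \<exists>x. P e x)"
proof -
  obtain R where R: "D0 A (\<lambda>e. R (\<lambda>k. e (Suc k)) (e 0))"
    and P: "(\<lambda>e. P (\<lambda>k. e (Suc k)) (e 0)) = (\<lambda>e. \<exists>x. R e x)"
    using assms by (rule S1E)
  have P': "P e x \<longleftrightarrow> (\<exists>y. R (case_nat x e) y)" for e x
    using fun_cong[OF P, of "case_nat x e"] by simp
  \<comment> \<open>Inside the two bounded quantifiers, variable 0 is y, variable 1 is x, variable 2
    is the bound m, and the old environment starts at 3.\<close>
  have "D0 A (\<lambda>e. R (case_nat (e 1) (\<lambda>k. e (Suc (Suc (Suc k))))) (e 0))"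
  proof -
    have "(\<lambda>k. e (case_nat 0 (case_nat 1 (\<lambda>i. Suc (Suc (Suc i)))) (Suc k)))
        = case_nat (e 1) (\<lambda>k. e (Suc (Suc (Suc k))))" for e :: "nat \<Rightarrow> 'a"
      by (auto simp: fun_eq_iff split: nat.split)
    with D0_rename[OF R, of "case_nat 0 (case_nat 1 (\<lambda>i. Suc (Suc (Suc i))))"]
    show ?thesis by simp
  qed
  then have "D0 A (\<lambda>e. \<exists>x\<le>e 0. \<exists>y\<le>e 0. R (case_nat x (\<lambda>k. e (Suc k))) y)"
    by (intro D0_intros) (simp add: One_nat_def)
  then have *: "S1 A (\<lambda>e. \<exists>m. \<exists>x\<le>m. \<exists>y\<le>m. R (case_nat x e) y)" by (rule S1_ex_D0)
  have "(\<exists>m. \<exists>x\<le>m. \<exists>y\<le>m. R (case_nat x e) y) \<longleftrightarrow> (\<exists>x. P e x)" for e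
    unfolding P' by (meson le_cases order_refl)
  then show ?thesis using * by (rule S1_cong[rotated])
qed

lemma S1_and:
  assumes "S1 A P" "S1 A Q" shows "S1 A (\<lambda>e. P e \<and> Q e)"
proof -
  obtain R where R: "D0 A (\<lambda>e. R (\<lambda>k. e (Suc k)) (e 0))" "P = (\<lambda>e. \<exists>x. R e x)"
    using assms(1) by (rule S1E)
  obtain T where T: "D0 A (\<lambda>e. T (\<lambda>k. e (Suc k)) (e 0))" "Q = (\<lambda>e. \<exists>x. T e x)"
    using assms(2) by (rule S1E)
  have "D0 A (\<lambda>e. R (\<lambda>k. e (Suc (Suc k))) (e 1) \<and> T (\<lambda>k. e (Suc (Suc k))) (e 0))"
    using D0_rename[OF R(1), of Suc] D0_rename[OF T(1), of "case_nat 0 (\<lambda>k. Suc (Suc k))"]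
    by (intro D0_intros) (simp_all add: One_nat_def)
  then have "S1 A (\<lambda>e. \<exists>x. \<exists>y. R e x \<and> T e y)"
    by (intro S1_ex S1_ex_D0) (simp add: One_nat_def)
  then show ?thesis unfolding R(2) T(2) by simp
qed

lemma S1_or:
  assumes "S1 A P" "S1 A Q" shows "S1 A (\<lambda>e. P e \<or> Q e)"
proof -
  obtain R where R: "D0 A (\<lambda>e. R (\<lambda>k. e (Suc k)) (e 0))" "P = (\<lambda>e. \<exists>x. R e x)"
    using assms(1) by (rule S1E)
  obtain T where T: "D0 A (\<lambda>e. T (\<lambda>k. e (Suc k)) (e 0))" "Q = (\<lambda>e. \<exists>x. T e x)"
    using assms(2) by (rule S1E)
  have "S1 A (\<lambda>e. \<exists>x. R e x \<or> T e x)"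
    by (intro S1_ex_D0 D0_intros R(1) T(1))
  then show ?thesis unfolding R(2) T(2) by (simp add: ex_disj_distrib)
qed

text \<open>The axiom schemes act on the first variables and treat all others as parameters, whereas
  \<open>D0\<close> lets arguments and parameters occur in any order. This puts the n relevant
  arguments in front.\<close>

lemma D0_normal:
  assumes "D0 A P" "D0 A Q"
    and P: "\<And>e e'. (\<And>k. k < n \<Longrightarrow> e k = e' k) \<Longrightarrow> P e = P e'"
    and Q: "\<And>e e'. (\<And>k. k < n \<Longrightarrow> e k = e' k) \<Longrightarrow> Q e = Q e'"
  obtains \<phi> \<psi> s c where "\<phi> \<in> Delta00" "\<psi> \<in> Delta00" "range s \<subseteq> A"
    "\<And>e. P e \<longleftrightarrow> sat S (\<lambda>i. if i < n then e i else c (i - n)) s \<phi>"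
    "\<And>e. Q e \<longleftrightarrow> sat S (\<lambda>i. if i < n then e i else c (i - n)) s \<psi>"
proof -
  obtain \<phi> \<psi> s \<sigma> where D: "\<phi> \<in> Delta00" "\<psi> \<in> Delta00" "range s \<subseteq> A"
    "\<And>e. P e \<longleftrightarrow> sat {} (penv \<sigma> e) s \<phi>" "\<And>e. Q e \<longleftrightarrow> sat {} (penv \<sigma> e) s \<psi>"
    by (rule D0_pairE[OF assms(1,2)]) (rule that)
  \<comment> \<open>Variables reading an argument below n are renamed to that argument. All others
    move to position n + i and become parameters; those that read a later argument get the value 0,
    which P and Q cannot notice.\<close>
  define \<pi> where "\<pi> i = (case \<sigma> i of Inl k \<Rightarrow> if k < n then V k else V (n + i) | Inr a \<Rightarrow> V (n + i))" for i
  define c where "c i = penv \<sigma> (\<lambda>_. 0) i" for i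
  have env: "(\<lambda>i. val (\<lambda>i. if i < n then e i else c (i - n)) (\<pi> i)) = penv \<sigma> (\<lambda>k. if k < n then e k else 0)" for e
    by (auto simp: fun_eq_iff \<pi>_def c_def penv_def split: sum.split)
  show thesis
  proof (rule that[of "sub_fm \<pi> (\<lambda>X. X) \<phi>" "sub_fm \<pi> (\<lambda>X. X) \<psi>" s c])
    show "sub_fm \<pi> (\<lambda>X. X) \<phi> \<in> Delta00" "sub_fm \<pi> (\<lambda>X. X) \<psi> \<in> Delta00"
      by (intro sub_fm_Delta00 D)+
    show "P e \<longleftrightarrow> sat S (\<lambda>i. if i < n then e i else c (i - n)) s (sub_fm \<pi> (\<lambda>X. X) \<phi>)" for e
      unfolding sat_sub_fm env sat_Delta00[OF D(1), of S _ _ "{}"] D(4)[symmetric] by (rule P) simp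
    show "Q e \<longleftrightarrow> sat S (\<lambda>i. if i < n then e i else c (i - n)) s (sub_fm \<pi> (\<lambda>X. X) \<psi>)" for e
      unfolding sat_sub_fm env sat_Delta00[OF D(2), of S _ _ "{}"] D(5)[symmetric] by (rule Q) simp
  qed (fact D(3))
qed

lemma less_2_cases_nat: "k < (2::nat) \<longleftrightarrow> k = 0 \<or> k = 1"
  by auto

text \<open>Both formulas get the same parameters, because comprehension compares its two formulas
  in one environment.\<close>

lemma S1_normal:
  assumes "S1 A (\<lambda>e. P (e 0))" "S1 A (\<lambda>e. Q (e 0))"
  obtains \<phi> \<psi> s c where "\<phi> \<in> Delta00" "\<psi> \<in> Delta00" "range s \<subseteq> A"
    "\<And>x. P x \<longleftrightarrow> sat S (case_nat x c) s (ExN \<phi>)" "\<And>x. Q x \<longleftrightarrow> sat S (case_nat x c) s (ExN \<psi>)"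
proof -
  have 1: "\<exists>R. D0 A (\<lambda>e. R (e 1) (e 0)) \<and> (\<forall>x. P x \<longleftrightarrow> (\<exists>w. R x w))" if SP: "S1 A (\<lambda>e. P (e 0))" for P
  proof -
    obtain R where R: "D0 A (\<lambda>e. R (\<lambda>k. e (Suc k)) (e 0))"
      and P: "(\<lambda>e. P (e 0)) = (\<lambda>e. \<exists>x. R e x)"
      using SP by (rule S1E)
    have "P x \<longleftrightarrow> (\<exists>w. R (\<lambda>_. x) w)" for x
      using fun_cong[OF P, of "\<lambda>_. x"] by simp
    moreover have "D0 A (\<lambda>e. R (\<lambda>_. e 1) (e 0))"
      using D0_rename[OF R, of "case_nat 0 (\<lambda>_. 1)"] by simp
    ultimately show ?thesis by (intro exI[of _ "\<lambda>x. R (\<lambda>_. x)"]) simp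
  qed
  obtain R where R: "D0 A (\<lambda>e. R (e 1) (e 0))" "\<And>x. P x \<longleftrightarrow> (\<exists>w. R x w)" using 1[OF assms(1)] by blast
  obtain T where T: "D0 A (\<lambda>e. T (e 1) (e 0))" "\<And>x. Q x \<longleftrightarrow> (\<exists>w. T x w)" using 1[OF assms(2)] by blast
  obtain \<phi> \<psi> s c where D: "\<phi> \<in> Delta00" "\<psi> \<in> Delta00" "range s \<subseteq> A"
    "\<And>e. R (e 1) (e 0) \<longleftrightarrow> sat S (\<lambda>i. if i < 2 then e i else c (i - 2)) s \<phi>"
    "\<And>e. T (e 1) (e 0) \<longleftrightarrow> sat S (\<lambda>i. if i < 2 then e i else c (i - 2)) s \<psi>"
    by (rule D0_normal[OF R(1) T(1), of 2 S]) auto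
  have env: "(\<lambda>i. if i < 2 then case_nat w (case_nat x c) i else c (i - 2)) = case_nat w (case_nat x c)" for w x
    by (auto simp: fun_eq_iff less_2_cases_nat numeral_2_eq_2 split: nat.split)
  have "R x w \<longleftrightarrow> sat S (case_nat w (case_nat x c)) s \<phi>" "T x w \<longleftrightarrow> sat S (case_nat w (case_nat x c)) s \<psi>" for x w
    using D(4,5)[of "case_nat w (case_nat x c)"] by (simp_all add: env)
  then show thesis using D R T by (intro that[of \<phi> \<psi> s c]) simp_all
qed

section \<open>Induction, comprehension and collection in a model\<close>

locale sigma2_model =
  fixes S :: "'a::pam set set"
  assumes nonempty: "S \<noteq> {}"
    and Sigma1_induction: "\<And>\<phi> e s. \<phi> \<in> Sigma0 1 \<Longrightarrow> range s \<subseteq> S \<Longrightarrow> sat S e s (induction \<phi>)"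
    and Sigma2_induction: "\<And>\<phi> e s. \<phi> \<in> Sigma0 2 \<Longrightarrow> range s \<subseteq> S \<Longrightarrow> sat S e s (induction \<phi>)"
    and Delta1_comprehension: "\<And>\<phi> \<psi> e s. \<phi> \<in> Sigma0 1 \<Longrightarrow> \<psi> \<in> Pi0 1 \<Longrightarrow> range s \<subseteq> S
      \<Longrightarrow> sat S e s (comprehension \<phi> \<psi>)"
begin

lemma sat_induction:
  "sat S e s (induction \<phi>) \<longleftrightarrow> (sat S (case_nat 0 e) s \<phi> \<longrightarrow>
     (\<forall>x. sat S (case_nat x e) s \<phi> \<longrightarrow> sat S (case_nat (x + 1) e) s \<phi>) \<longrightarrow>
     (\<forall>x. sat S (case_nat x e) s \<phi>))"
proof -
  have "(\<lambda>i. val (case_nat x e) (case_nat (V 0 \<^bold>+ \<^bold>1) (\<lambda>i. V (Suc i)) i)) = case_nat (x + 1) e" for x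
    by (auto simp: fun_eq_iff split: nat.split)
  then show ?thesis by (simp add: induction_def sat_sub_fm imp_conjL)
qed

lemma S1_induct:
  assumes "S1 S (\<lambda>e. P (e 0))" and "P 0" and "\<And>x. P x \<Longrightarrow> P (x + 1)"
  shows "P x"
proof -
  obtain \<phi> \<psi> s c where \<phi>: "\<phi> \<in> Delta00" "\<psi> \<in> Delta00" "range s \<subseteq> S"
    "\<And>x. P x \<longleftrightarrow> sat S (case_nat x c) s (ExN \<phi>)" "\<And>x. P x \<longleftrightarrow> sat S (case_nat x c) s (ExN \<psi>)"
    by (rule S1_normal[OF assms(1,1), of S]) (rule that)
  have "ExN \<phi> \<in> Sigma0 1" using \<phi>(1) by (simp add: One_nat_def)
  from Sigma1_induction[OF this \<phi>(3), of c]
  show ?thesis using assms(2,3) unfolding sat_induction \<phi>(4)[symmetric] by blast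
qed

lemmas D0_induct = S1_induct[OF S1_D0]

text \<open>\<open>Sigma0 2\<close> offers exactly one quantifier of each kind, so a longer block
  has to be contracted into one bound before this applies.\<close>

lemma S2_induct:
  assumes R: "D0 S (\<lambda>e. R (e 2) (e 1) (e 0))"
    and "\<exists>a. \<forall>m. R 0 a m" and "\<And>x. \<exists>a. \<forall>m. R x a m \<Longrightarrow> \<exists>a. \<forall>m. R (x + 1) a m"
  shows "\<exists>a. \<forall>m. R x a m"
proof -
  obtain \<phi> \<psi> s c where \<phi>: "\<phi> \<in> Delta00" "\<psi> \<in> Delta00" "range s \<subseteq> S"
    "\<And>e. R (e 2) (e 1) (e 0) \<longleftrightarrow> sat S (\<lambda>i. if i < 3 then e i else c (i - 3)) s \<phi>"
    "\<And>e. R (e 2) (e 1) (e 0) \<longleftrightarrow> sat S (\<lambda>i. if i < 3 then e i else c (i - 3)) s \<psi>"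
    by (rule D0_normal[OF R R, of 3 S]) auto
  have env: "(\<lambda>i. if i < 3 then case_nat w (case_nat a (case_nat x c)) i else c (i - 3))
      = case_nat w (case_nat a (case_nat x c))" for w a x
    by (auto simp: fun_eq_iff numeral_3_eq_3 less_Suc_eq split: nat.split)
  have R': "R x a m \<longleftrightarrow> sat S (case_nat m (case_nat a (case_nat x c))) s \<phi>" for x a m
    using \<phi>(4)[of "case_nat m (case_nat a (case_nat x c))"] by (simp add: env)
  have *: "(\<exists>a. \<forall>m. R x a m) \<longleftrightarrow> sat S (case_nat x c) s (ExN (AllN \<phi>))" for x
    by (simp add: R')
  have "ExN (AllN \<phi>) \<in> Sigma0 2" using \<phi>(1) by (simp add: numeral_2_eq_2)
  from Sigma2_induction[OF this \<phi>(3), of c]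
  show ?thesis using assms(2,3) unfolding sat_induction *[symmetric] by blast
qed

lemma comprehension_S:
  assumes "S1 S (\<lambda>e. P (e 0))" "S1 S (\<lambda>e. \<not> P (e 0))"
  shows "{x. P x} \<in> S"
proof -
  obtain \<phi> \<psi> s c where \<phi>: "\<phi> \<in> Delta00" "\<psi> \<in> Delta00" "range s \<subseteq> S"
    "\<And>x. P x \<longleftrightarrow> sat S (case_nat x c) s (ExN \<phi>)" "\<And>x. \<not> P x \<longleftrightarrow> sat S (case_nat x c) s (ExN \<psi>)"
    by (rule S1_normal[OF assms, of S]) (rule that)
  have "ExN \<phi> \<in> Sigma0 1" "AllN (\<^bold>\<not> \<psi>) \<in> Pi0 1"
    using \<phi>(1,2) by (auto simp: One_nat_def Neg_def intro: Delta00.intros)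
  from Delta1_comprehension[OF this \<phi>(3), of c]
  have "sat S c s (AllN (ExN \<phi> \<^bold>\<longleftrightarrow> AllN (\<^bold>\<not> \<psi>))) \<longrightarrow>
      sat S c s (ExS (AllN (V 0 \<^bold>\<in> 0 \<^bold>\<longleftrightarrow> liftS (ExN \<phi>))))"
    unfolding comprehension_def by (simp only: sat.simps)
  moreover have "sat S (case_nat x c) s (ExN \<phi>) \<longleftrightarrow> sat S (case_nat x c) s (AllN (\<^bold>\<not> \<psi>))" for x
    using \<phi>(4)[of x] \<phi>(5)[of x] by auto
  ultimately have "\<exists>X\<in>S. \<forall>x. x \<in> X \<longleftrightarrow> sat S (case_nat x c) s (ExN \<phi>)"
    by (simp only: sat.simps sat_connectives sat_lift) simp
  then have "\<exists>X\<in>S. \<forall>x. x \<in> X \<longleftrightarrow> P x"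
    using \<phi>(4) by simp
  then obtain X where "X \<in> S" "\<And>x. x \<in> X \<longleftrightarrow> P x" by blast
  moreover from this have "X = {x. P x}" by blast
  ultimately show ?thesis by simp
qed

lemma D0_least:
  assumes P: "D0 S (\<lambda>e. P (e 0))" and "P x"
  shows "\<exists>m. P m \<and> (\<forall>y<m. \<not> P y)"
proof (rule ccontr)
  assume *: "\<not> ?thesis"
  have "\<forall>y<x. \<not> P y" for x
  proof (rule D0_induct[where P = "\<lambda>x. \<forall>y<x. \<not> P y"])
    show "D0 S (\<lambda>e. \<forall>y<e 0. \<not> P y)"
      by (intro D0_intros P)
    fix x assume "\<forall>y<x. \<not> P y"
    then show "\<forall>y<x + 1. \<not> P y"
      using * by (auto simp: less_Suc_iff le_less)
  qed simp
  then show False using \<open>P x\<close> less_Suc_iff by blast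
qed

text \<open>The existence of a bound for all i < l is itself Sigma_1, as its matrix is bounded, so
  Sigma_1 induction on l raises the bound step by step.\<close>

lemma collection:
  assumes R: "D0 S (\<lambda>e. R (e 1) (e 0))" and *: "\<And>i. i < n \<Longrightarrow> \<exists>x. R i x"
  shows "\<exists>c. \<forall>i<n. \<exists>x\<le>c. R i x"
proof -
  have "\<exists>c. \<forall>i<l. i < n \<longrightarrow> (\<exists>x\<le>c. R i x)" for l
  proof (rule S1_induct[where P = "\<lambda>l. \<exists>c. \<forall>i<l. i < n \<longrightarrow> (\<exists>x\<le>c. R i x)"])
    show "S1 S (\<lambda>e. \<exists>c. \<forall>i<e 0. i < n \<longrightarrow> (\<exists>x\<le>c. R i x))"
      using D0_rename[OF R, of id] nonempty
      by (intro S1_ex_D0 D0_intros) (simp_all add: One_nat_def)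
    show "\<exists>c. \<forall>i<0. i < n \<longrightarrow> (\<exists>x\<le>c. R i x)" by simp
    fix l assume "\<exists>c. \<forall>i<l. i < n \<longrightarrow> (\<exists>x\<le>c. R i x)"
    then obtain c where c: "\<And>i. i < l \<Longrightarrow> i < n \<Longrightarrow> \<exists>x\<le>c. R i x" by blast
    show "\<exists>c. \<forall>i<l + 1. i < n \<longrightarrow> (\<exists>x\<le>c. R i x)"
    proof (cases "l < n")
      case True
      then obtain x where x: "R l x" using * by blast
      have "\<exists>y\<le>max c x. R i y" if "i < l + 1" "i < n" for i
      proof (cases "i = l")
        case True
        then show ?thesis using x max.cobounded2 by blast
      next
        case False
        then have "i < l" using that by (simp add: less_Suc_iff)
        then show ?thesis using c that by (meson le_max_iff_disj)
      qed
      then show ?thesis by blast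
    next
      case False
      then show ?thesis using c by (metis less_Suc_iff not_less order_less_le_trans)
    qed
  qed
  then show ?thesis by blast
qed

text \<open>Collection supplies a common bound for the witnesses, which moves the existential
  quantifier in front of the bounded one.\<close>

lemma S1_ball:
  assumes f: "Tm f" and P: "S1 S (\<lambda>e. P (\<lambda>k. e (Suc k)) (e 0))"
  shows "S1 S (\<lambda>e. \<forall>x<f e. P e x)"
proof -
  obtain R where R: "D0 S (\<lambda>e. R (\<lambda>k. e (Suc k)) (e 0))"
    and eq: "(\<lambda>e. P (\<lambda>k. e (Suc k)) (e 0)) = (\<lambda>e. \<exists>x. R e x)"
    using P by (rule S1E)
  have P': "P e x \<longleftrightarrow> (\<exists>y. R (case_nat x e) y)" for e x
    using fun_cong[OF eq, of "case_nat x e"] by simp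
  have col: "(\<forall>x<f e. P e x) \<longleftrightarrow> (\<exists>c. \<forall>x<f e. \<exists>y\<le>c. R (case_nat x e) y)" for e
  proof
    assume *: "\<forall>x<f e. P e x"
    show "\<exists>c. \<forall>x<f e. \<exists>y\<le>c. R (case_nat x e) y"
    proof (rule collection)
      \<comment> \<open>The outer environment e is frozen into parameters, so that a binary relation
        remains for \<open>collection\<close>.\<close>
      let ?\<tau> = "case_nat (Inl 0) (case_nat (Inl 1) (\<lambda>k. Inr (e k)))"
      have "(\<lambda>k. penv ?\<tau> e' (Suc k)) = case_nat (e' 1) e" for e'
        by (auto simp: fun_eq_iff penv_def split: nat.split)
      then show "D0 S (\<lambda>e'. R (case_nat (e' 1) e) (e' 0))"
        using D0_penv[OF R, of ?\<tau>] by (simp add: penv_def)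
    qed (use * P' in blast)
  qed (use P' in blast)
  have "D0 S (\<lambda>e. R (case_nat (e 1) (\<lambda>k. e (Suc (Suc (Suc k))))) (e 0))"
  proof -
    have "(\<lambda>k. e (case_nat 0 (case_nat 1 (\<lambda>i. Suc (Suc (Suc i)))) (Suc k)))
        = case_nat (e 1) (\<lambda>k. e (Suc (Suc (Suc k))))" for e :: "nat \<Rightarrow> 'a"
      by (auto simp: fun_eq_iff split: nat.split)
    with D0_rename[OF R, of "case_nat 0 (case_nat 1 (\<lambda>i. Suc (Suc (Suc i))))"]
    show ?thesis by simp
  qed
  then have "S1 S (\<lambda>e. \<exists>c. \<forall>x<f e. \<exists>y\<le>c. R (case_nat x e) y)"
    using Tm_rename[OF f, of Suc] by (intro S1_ex_D0 D0_intros) (simp_all add: One_nat_def)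
  then show ?thesis unfolding col .
qed

end

section \<open>Pairs and finite sequences\<close>

lemma le_mult_self: "x \<le> x * (x :: 'a::pam)"
proof (cases "x = 0")
  case False
  then have "1 \<le> x" using discrete' by (metis le_less zero_le')
  then show ?thesis using mult_left_mono[of 1 x x] by simp
qed simp

lemma le_mult_pos: "0 < m \<Longrightarrow> x \<le> x * (m :: 'a::pam)"
  using mult_left_mono[of 1 m x] discrete' by auto

lemma le_add1' [simp]: "x \<le> x + (y :: 'a::pam)" and le_add2' [simp]: "x \<le> y + (x :: 'a::pam)"
  by (simp_all add: add_increasing2 add_increasing)

lemma less_imp_Suc_le: "x < y \<Longrightarrow> x + 1 \<le> (y :: 'a::pam)"
  using less_Suc_iff[of y x] by (meson not_less)

lemma le_imp_ex_add: "x \<le> y \<Longrightarrow> \<exists>d. y = x + (d :: 'a::pam)"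
  by (metis add.commute le_add_diff_inverse2)

lemma less_imp_ex_add: "x < y \<Longrightarrow> \<exists>d. y = x + d + (1 :: 'a::pam)"
  using le_imp_ex_add[OF less_imp_Suc_le] by (metis add.assoc add.commute)

lemma pos_iff: "0 < x \<longleftrightarrow> x \<noteq> (0 :: 'a::pam)"
  using zero_le'[of x] by (auto simp: le_less)

lemma less_Suc_self [simp]: "x < x + (1 :: 'a::pam)"
  by (simp add: less_Suc_iff)

definition pr :: "'a::pam \<Rightarrow> 'a \<Rightarrow> 'a"
  where "pr s t = (s + t) * (s + t) + s"

lemma le_pr1: "s \<le> pr s t" by (simp add: pr_def)

lemma le_pr2: "t \<le> pr s t"
  unfolding pr_def by (meson le_add1' le_add2' le_mult_self order_trans)

text \<open>\<open>pr s t\<close> lies between (s + t)^2 and (s + t + 1)^2, the latter excluded, so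
  the code determines the sum and then s and t.\<close>

lemma pr_less:
  fixes s t s' t' :: "'a::pam"
  assumes "s + t < s' + t'" shows "pr s t < pr s' t'"
proof -
  have "(s + t + 1) * (s + t + 1) = pr s t + (t + (s + t) + 1)"
    by (simp add: pr_def algebra_simps)
  then have "pr s t < (s + t + 1) * (s + t + 1)"
    using add_nonneg_pos[of "t + (s + t)" 1] by simp
  also have "\<dots> \<le> (s' + t') * (s' + t')"
    using less_imp_Suc_le[OF assms] by (intro mult_mono) auto
  also have "\<dots> \<le> pr s' t'" by (simp add: pr_def)
  finally show ?thesis .
qed

lemma pr_inj [simp]: "pr s t = pr s' t' \<longleftrightarrow> s = s' \<and> t = t'"
proof
  assume *: "pr s t = pr s' t'"
  then have "s + t = s' + t'" using pr_less[of s t s' t'] pr_less[of s' t' s t] by force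
  with * show "s = s' \<and> t = t'" by (simp add: pr_def)
qed simp

lemma Tm_pr [D0_intros]: "Tm f \<Longrightarrow> Tm g \<Longrightarrow> Tm (\<lambda>e. pr (f e) (g e))"
  unfolding pr_def by (intro D0_intros)

definition rm :: "'a::pam \<Rightarrow> 'a \<Rightarrow> 'a \<Rightarrow> bool"
  where "rm a m x \<longleftrightarrow> x < m \<and> (\<exists>q. a = q * m + x)"

definition len :: "'a::pam \<Rightarrow> 'a \<Rightarrow> bool"
  where "len s n \<longleftrightarrow> (\<exists>a b. s = pr n (pr a b))"

definition entry :: "'a::pam \<Rightarrow> 'a \<Rightarrow> 'a \<Rightarrow> bool"
  where "entry s i x \<longleftrightarrow> (\<exists>n a b. s = pr n (pr a b) \<and> i < n \<and> rm a (b * (i + 1) + 1) x)"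

lemma division_unique:
  fixes m :: "'a::pam"
  assumes "q * m + x = q' * m + y" "x < m" "y < m"
  shows "x = y"
proof -
  have *: False if "q * m + x = q' * m + y" "x < m" "q < q'" for q q' x y
  proof -
    have "q * m + x < q * m + m" using that(2) by simp
    also have "\<dots> \<le> q' * m"
      using mult_right_mono[OF less_imp_Suc_le[OF \<open>q < q'\<close>], of m] by (simp add: algebra_simps)
    also have "\<dots> \<le> q' * m + y" by simp
    finally show False using that by simp
  qed
  have "q = q'" using *[of q x q' y] *[of q' y q x] assms by (metis linorder_neqE)
  then show ?thesis using assms(1) by simp
qed

lemma rm_unique: "rm a m x \<Longrightarrow> rm a m y \<Longrightarrow> x = y"
  unfolding rm_def using division_unique by metis

lemma rm_le: "rm a m x \<Longrightarrow> x \<le> a"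
  by (auto simp: rm_def)

lemma entry_unique: "entry s i x \<Longrightarrow> entry s i y \<Longrightarrow> x = y"
  by (auto simp: entry_def dest: rm_unique)

lemma entry_less_len: "entry s i x \<Longrightarrow> len s n \<Longrightarrow> i < n"
  by (auto simp: entry_def len_def)

text \<open>A code bounds the indices and values of its entries. The lemmas called
  \<open>_bounded\<close> use such facts to put a bound on every quantifier of a definition, after
  which the \<open>D0\<close> rules apply to it.\<close>

lemma entry_le: assumes "entry s i x" shows "i \<le> s" "x \<le> s"
proof -
  obtain n a b where *: "s = pr n (pr a b)" "i < n" "rm a (b * (i + 1) + 1) x"
    using assms unfolding entry_def by blast
  show "i \<le> s" using * le_pr1[of n "pr a b"] by simp
  show "x \<le> s" using * rm_le le_pr1[of a b] le_pr2[of "pr a b" n] by (meson order_trans)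
qed

lemma len_le: "len s n \<Longrightarrow> n \<le> s"
  by (auto simp: len_def le_pr1)

lemma rm_bounded: "rm a m x \<longleftrightarrow> x < m \<and> (\<exists>q\<le>a. a = q * m + x)"
proof -
  have "q \<le> q * m + x" if "x < m" for q
    using le_mult_pos[of m q] that by (metis le_add1' order_trans pos_iff not_less_zero')
  then show ?thesis unfolding rm_def by blast
qed

lemma D0_rm: "A \<noteq> {} \<Longrightarrow> Tm f \<Longrightarrow> Tm g \<Longrightarrow> Tm h \<Longrightarrow> D0 A (\<lambda>e. rm (f e) (g e) (h e))"
  by (rule D0_subst3) (unfold rm_bounded, intro D0_intros)

lemma pr_bounds: "s = pr n (pr a b) \<Longrightarrow> n \<le> s \<and> a \<le> s \<and> b \<le> s"
  using le_pr1 le_pr2 order_trans by metis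

lemma entry_bounded: "entry s i x \<longleftrightarrow>
    (\<exists>n\<le>s. \<exists>a\<le>s. \<exists>b\<le>s. s = pr n (pr a b) \<and> i < n \<and> rm a (b * (i + 1) + 1) x)"
  unfolding entry_def using pr_bounds by metis

lemma len_bounded: "len s n \<longleftrightarrow> (\<exists>a\<le>s. \<exists>b\<le>s. s = pr n (pr a b))"
  unfolding len_def using pr_bounds by metis

lemma D0_entry [D0_intros]:
  "A \<noteq> {} \<Longrightarrow> Tm f \<Longrightarrow> Tm g \<Longrightarrow> Tm h \<Longrightarrow> D0 A (\<lambda>e. entry (f e) (g e) (h e))"
  by (rule D0_subst3) (unfold entry_bounded, intro D0_intros D0_rm)

lemma D0_len [D0_intros]:
  "A \<noteq> {} \<Longrightarrow> Tm f \<Longrightarrow> Tm g \<Longrightarrow> D0 A (\<lambda>e. len (f e) (g e))"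
  by (rule D0_subst2) (unfold len_bounded, intro D0_intros)

text \<open>A semiring has no negatives, hence multiples of m on both sides.\<close>

definition cng :: "'a::pam \<Rightarrow> 'a \<Rightarrow> 'a \<Rightarrow> bool"
  where "cng m a b \<longleftrightarrow> (\<exists>p q. a + p * m = b + q * m)"

lemma cng_trans: "cng m a b \<Longrightarrow> cng m b c \<Longrightarrow> cng m a c"
proof -
  assume "cng m a b" "cng m b c"
  then obtain p q p' q' where "a + p * m = b + q * m" "b + p' * m = c + q' * m"
    unfolding cng_def by blast
  then have "a + (p + p') * m = c + (q + q') * m"
    by (metis (no_types, opaque_lifting) add.assoc add.commute distrib_right)
  then show ?thesis unfolding cng_def by blast
qed

lemma cng_mult: "cng m a b \<Longrightarrow> cng m (a * c) (b * c)"
proof -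
  assume "cng m a b"
  then obtain p q where "a + p * m = b + q * m" unfolding cng_def by blast
  then have "(a + p * m) * c = (b + q * m) * c" by simp
  then have "a * c + (p * c) * m = b * c + (q * c) * m" by (simp add: algebra_simps)
  then show ?thesis unfolding cng_def by blast
qed

lemma cng_add: "cng m a b \<Longrightarrow> cng m (c + a) (c + b)"
  unfolding cng_def by (metis add.assoc)

lemma cng_unique:
  assumes "cng m (x :: 'a::pam) y" "x < m" "y < m" shows "x = y"
proof -
  obtain p q where "p * m + x = q * m + y" using assms unfolding cng_def by (metis add.commute)
  then show ?thesis using division_unique assms by blast
qed

definition unit_mod :: "'a::pam \<Rightarrow> 'a \<Rightarrow> bool"
  where "unit_mod m a \<longleftrightarrow> (\<exists>t. cng m (a * t) 1)"

lemma unit_mod_mult: "unit_mod m a \<Longrightarrow> unit_mod m b \<Longrightarrow> unit_mod m (a * b)"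
proof -
  assume "unit_mod m a" "unit_mod m b"
  then obtain t u where "cng m (a * t) 1" "cng m (b * u) 1" unfolding unit_mod_def by blast
  then have "cng m (a * t * (b * u)) 1"
    using cng_mult[of m "a * t" 1 "b * u"] cng_trans by simp
  then have "cng m (a * b * (t * u)) 1" by (simp add: ac_simps)
  then show ?thesis unfolding unit_mod_def by blast
qed

text \<open>
  The moduli of Goedel's beta function: with \<open>b = d * q\<close>, the number \<open>- (l + d + 1)\<^sup>2 * q\<close>
  is inverse to \<open>b * (l + 1) + 1\<close> modulo \<open>b * (l + d + 1) + 1\<close>.
\<close>

lemma unit_mod_beta:
  fixes l d q :: "'a::pam"
  shows "unit_mod (d * q * (l + d + 1) + 1) (d * q * (l + 1) + 1)"
proof -
  define u where "u = d * q * (l + d + 1)"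
  define m where "m = u + 1"
  define M where "M = d * q * (l + 1) + 1"
  define T where "T = (l + d + 1) * (l + d + 1) * q"
  define X where "X = M * T"
  have 1: "m = M + d * q * d" by (simp add: m_def u_def M_def algebra_simps)
  have 2: "T * (d * q * d) = u * u" by (simp add: T_def u_def ac_simps)
  have 3: "T * m = X + u * u" using 1 2 by (simp add: X_def algebra_simps)
  have 4: "(T + 1 + 1) * m = X + 1 + m * m"
  proof -
    have "(T + 1 + 1) * m = T * m + m + m" by (simp add: algebra_simps)
    also have "\<dots> = X + 1 + m * m" unfolding 3 by (simp add: m_def algebra_simps)
    finally show ?thesis .
  qed
  \<comment> \<open>X is congruent to -1 by the previous equation, so its square is congruent to 1.
    Thus \<open>T * X\<close> is an inverse of M that needs no negative number.\<close>
  have "X * X + ((T + 1 + 1) + X * m) * m = X * X + (T + 1 + 1) * m + X * m * m"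
    by (simp add: algebra_simps)
  also have "\<dots> = 1 + X * (X + 1 + m * m) + m * m" unfolding 4 by (simp add: algebra_simps)
  also have "\<dots> = 1 + (X * (T + 1 + 1) + m) * m" unfolding 4[symmetric] by (simp add: algebra_simps)
  finally have "cng m (M * (T * X)) 1" unfolding cng_def X_def by (metis mult.assoc)
  then show ?thesis unfolding unit_mod_def m_def u_def M_def by blast
qed

section \<open>Division and finite sequences in a model\<close>

context sigma2_model
begin

lemma rm_exists: assumes "0 < (m :: 'a)" shows "\<exists>x. rm a m x"
proof -
  have "\<exists>q\<le>a. \<exists>x<m. a = q * m + x" for a
  proof (rule D0_induct[where P = "\<lambda>a. \<exists>q\<le>a. \<exists>x<m. a = q * m + x"])
    show "D0 S (\<lambda>e. \<exists>q\<le>e 0. \<exists>x<m. e 0 = q * m + x)"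
      using nonempty by (intro D0_intros)
    show "\<exists>q\<le>0. \<exists>x<m. 0 = q * m + x" using assms by (intro exI[of _ 0]) simp
    fix a assume "\<exists>q\<le>a. \<exists>x<m. a = q * m + x"
    then obtain q x where q: "q \<le> a" "x < m" "a = q * m + x" by blast
    show "\<exists>q\<le>a + 1. \<exists>x<m. a + 1 = q * m + x"
    proof (cases "x + 1 < m")
      case True
      then show ?thesis using q by (intro exI[of _ q] conjI exI[of _ "x + 1"])
          (auto simp: ac_simps intro: order_trans[OF q(1)])
    next
      case False
      then have "x + 1 = m" using less_imp_Suc_le[OF q(2)] by (simp add: not_less)
      have "a + 1 = q * m + (x + 1)" using q(3) by (simp add: add.assoc)
      then have "a + 1 = (q + 1) * m + 0" using \<open>x + 1 = m\<close> by (simp add: distrib_right)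
      moreover have "q + 1 \<le> a + 1" using q by simp
      ultimately show ?thesis using assms by blast
    qed
  qed
  then show ?thesis unfolding rm_def by blast
qed

lemma entry_exists: "len (s :: 'a) n \<Longrightarrow> i < n \<Longrightarrow> \<exists>x. entry s i x"
proof -
  assume "len s n" "i < n"
  then obtain a b where "s = pr n (pr a b)" unfolding len_def by blast
  moreover have "\<exists>x. rm a (b * (i + 1) + 1) x" by (rule rm_exists) (simp add: add_nonneg_pos)
  ultimately show ?thesis using \<open>i < n\<close> unfolding entry_def by blast
qed

text \<open>The induction multiplies b by l + 1, building a factorial without having the factorial
  function.\<close>

lemma common_multiple: "\<exists>b>0. \<forall>d\<le>(l :: 'a). 0 < d \<longrightarrow> (\<exists>q. b = d * q)"
proof -
  have "\<exists>b. 0 < b \<and> (\<forall>d\<le>l. 0 < d \<longrightarrow> (\<exists>q\<le>b. b = d * q))" for l :: 'a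
  proof (rule S1_induct[where P = "\<lambda>l. \<exists>b. 0 < b \<and> (\<forall>d\<le>l. 0 < d \<longrightarrow> (\<exists>q\<le>b. b = d * q))"])
    show "S1 S (\<lambda>e. \<exists>b. 0 < b \<and> (\<forall>d\<le>e 0. 0 < d \<longrightarrow> (\<exists>q\<le>b. b = d * q)))"
      using nonempty by (intro S1_ex_D0 D0_intros)
    show "\<exists>b. 0 < b \<and> (\<forall>d\<le>(0 :: 'a). 0 < d \<longrightarrow> (\<exists>q\<le>b. b = d * q))"
      by (intro exI[of _ 1]) auto
    fix l :: 'a assume "\<exists>b. 0 < b \<and> (\<forall>d\<le>l. 0 < d \<longrightarrow> (\<exists>q\<le>b. b = d * q))"
    then obtain b where b: "0 < b" "\<And>d. d \<le> l \<Longrightarrow> 0 < d \<Longrightarrow> \<exists>q\<le>b. b = d * q" by blast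
    have "\<exists>q\<le>b * (l + 1). b * (l + 1) = d * q" if d: "d \<le> l + 1" "0 < d" for d
    proof (cases "d = l + 1")
      case True
      then show ?thesis using le_mult_pos[of d b] d by (intro exI[of _ b]) (simp add: mult.commute)
    next
      case False
      then have "d \<le> l" using d by (metis le_less less_Suc_iff)
      then obtain q where q: "q \<le> b" "b = d * q" using b(2) d(2) by blast
      have "b * (l + 1) = d * (q * (l + 1))" unfolding q(2) by (rule mult.assoc)
      moreover have "q * (l + 1) \<le> b * (l + 1)" using q(1) by (intro mult_right_mono zero_le')
      ultimately show ?thesis by blast
    qed
    moreover have "0 < b * (l + 1)" using b(1) by (simp add: add_nonneg_pos)
    ultimately show "\<exists>b. 0 < b \<and> (\<forall>d\<le>l + 1. 0 < d \<longrightarrow> (\<exists>q\<le>b. b = d * q))" by blast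
  qed
  then have "\<exists>b. 0 < b \<and> (\<forall>d\<le>l. 0 < d \<longrightarrow> (\<exists>q\<le>b. b = d * q))" .
  then obtain b where "0 < b" "\<forall>d\<le>l. 0 < d \<longrightarrow> (\<exists>q\<le>b. b = d * q)" by blast
  then show ?thesis by (intro exI[of _ b] conjI) auto
qed

lemma D0_rename2: "D0 A (\<lambda>e. R (e 1) (e 0)) \<Longrightarrow> D0 A (\<lambda>e. R (e i) (e j))"
  using D0_rename[of A "\<lambda>e. R (e 1) (e 0)" "case_nat j (\<lambda>_. i)"] by simp

text \<open>This is Goedel's beta function lemma. The difference of two indices below n divides b,
  which makes the moduli coprime, and b \<ge> n + c + 1 makes them exceed c. Sigma_1 induction on l
  then yields an a solving the first l congruences, together with a common multiple M of the first l
  moduli that is still a unit modulo the others.\<close>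

lemma sequence_exists_bounded:
  assumes R: "D0 S (\<lambda>e. R (e 1) (e 0))" and c: "\<And>i. i < n \<Longrightarrow> \<exists>x\<le>c. R i x"
  shows "\<exists>s. len s n \<and> (\<forall>i<n. \<exists>x. entry s i x \<and> R i x)"
proof -
  obtain b where b: "0 < b" "\<And>d. d \<le> n + c + 1 \<Longrightarrow> 0 < d \<Longrightarrow> \<exists>q. b = d * q"
    using common_multiple by blast
  define m where "m i = b * (i + 1) + 1" for i
  have "n + c + 1 \<le> b"
  proof -
    obtain q where q: "b = (n + c + 1) * q" using b(2)[of "n + c + 1"] by (auto simp: add_nonneg_pos)
    then have "0 < q" using b(1) by (auto simp: pos_iff)
    then show ?thesis using q le_mult_pos by blast
  qed
  moreover have "b \<le> b * (i + 1)" for i by (rule le_mult_pos) (simp add: add_nonneg_pos)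
  ultimately have less_m: "x < m i" if "x \<le> c" for x i
    using that unfolding m_def less_Suc_iff by (meson le_add1' le_add2' order_trans)
  have m_pos: "0 < m i" for i by (simp add: m_def add_nonneg_pos)
  have coprime: "unit_mod (m i) (m l)" if li: "l < i" and "i < n" for i l
  proof -
    obtain d where d: "i = l + d" "0 < d"
    proof -
      obtain d where "i = l + d + 1" using less_imp_ex_add[OF li] by blast
      then show thesis by (intro that[of "d + 1"]) (simp_all add: add.assoc add_nonneg_pos)
    qed
    have "d \<le> n + c + 1" using \<open>i < n\<close> d by (metis le_add1' le_add2' less_imp_le order_trans)
    then obtain q where "b = d * q" using b(2) d by blast
    then show ?thesis using unit_mod_beta[of d q l] d by (simp add: m_def)
  qed
  define P where "P l a M \<longleftrightarrow> (\<forall>i<l. i < n \<longrightarrow> (\<exists>x\<le>c. R i x \<and> rm a (m i) x) \<and> (\<exists>q\<le>M. M = q * m i)) \<and>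
     (\<forall>i<n. l \<le> i \<longrightarrow> unit_mod (m i) M)" for l a M
  have "\<exists>a M. P l a M" for l
  proof (rule S1_induct[where P = "\<lambda>l. \<exists>a M. P l a M"])
    have "S1 S (\<lambda>e. \<exists>t p q. e i * t + p * m (e j) = 1 + q * m (e j))" for i j
      using nonempty unfolding m_def by (intro S1_ex S1_D0 D0_intros)
    then have unit: "S1 S (\<lambda>e. unit_mod (m (e j)) (e i))" for i j
      unfolding unit_mod_def cng_def by simp
    \<comment> \<open>Being a unit is only Sigma_1, and Sigma_1 predicates are closed under
      disjunction but not under implication; the premise \<open>l \<le> i\<close> can be negated
      because it is bounded.\<close>
    have disj: "(\<not> l \<le> i \<or> U) \<longleftrightarrow> (l \<le> i \<longrightarrow> U)" for l i :: 'a and U by simp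
    have "S1 S (\<lambda>e. \<exists>a M. (\<forall>i<e 0. i < n \<longrightarrow> (\<exists>x\<le>c. R i x \<and> rm a (m i) x) \<and> (\<exists>q\<le>M. M = q * m i)) \<and>
     (\<forall>i<n. \<not> e 0 \<le> i \<or> unit_mod (m i) M))"
      using nonempty
      by (intro S1_ex S1_and S1_ball S1_or unit)
         (auto simp: m_def intro!: S1_D0 D0_intros D0_rm D0_rename2[OF R])
    then show "S1 S (\<lambda>e. \<exists>a M. P (e 0) a M)" unfolding P_def disj .
    have "unit_mod (m i) 1" for i
      unfolding unit_mod_def cng_def by (intro exI[of _ 1] exI[of _ 0]) simp
    then show "\<exists>a M. P 0 a M" unfolding P_def by auto
    fix l assume "\<exists>a M. P l a M"
    then obtain a M where P: "P l a M" by blast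
    show "\<exists>a M. P (l + 1) a M"
    proof (cases "l < n")
      case False
      then have "P (l + 1) a M" using P unfolding P_def
        by (metis less_Suc_iff less_imp_le less_le not_less order_less_le_trans)
      then show ?thesis by blast
    next
      case True
      obtain x where x: "x \<le> c" "R l x" using c True by blast
      obtain t where t: "cng (m l) (M * t) 1"
        using P True unfolding P_def unit_mod_def by blast
      \<comment> \<open>y plays the part of x - a: adding a to it gives x plus a multiple of the
        modulus. Since M * t is 1 modulo \<open>m l\<close> and 0 modulo the earlier moduli, a' has
        remainder x at l and keeps the old remainders.\<close>
      define y where "y = x + a * (b * (l + 1))"
      define a' where "a' = a + M * t * y"
      have "cng (m l) a' (a + 1 * y)"
        unfolding a'_def by (intro cng_add cng_mult t)
      moreover have "a + 1 * y = x + a * m l" by (simp add: y_def m_def algebra_simps)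
      moreover have "cng (m l) (x + a * m l) x"
        unfolding cng_def by (intro exI[of _ 0] exI[of _ a]) simp
      ultimately have "cng (m l) a' x" using cng_trans by metis
      moreover obtain r where r: "rm a' (m l) r" using rm_exists m_pos by blast
      moreover have "cng (m l) r a'"
        using r unfolding rm_def cng_def by (metis add.commute add.right_neutral mult_zero_left)
      ultimately have "r = x" using cng_unique cng_trans less_m[OF x(1)] unfolding rm_def by metis
      then have rm_l: "rm a' (m l) x" using r by simp
      have "P (l + 1) a' (M * m l)"
        unfolding P_def
      proof (intro conjI allI impI)
        fix i assume i: "i < l + 1" "i < n"
        have *: "(\<exists>x\<le>c. R i x \<and> rm a' (m i) x) \<and> (\<exists>q\<le>M * m l. M * m l = q * m i)"
        proof (cases "i = l")
          case True
          then show ?thesis using x rm_l le_mult_pos[OF m_pos] by blast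
        next
          case False
          then have "i < l" using i by (simp add: less_Suc_iff)
          then obtain z q where z: "z \<le> c" "R i z" "rm a (m i) z" "q \<le> M" "M = q * m i"
            using P i unfolding P_def by blast
          obtain p where "a = p * m i + z" "z < m i" using z unfolding rm_def by blast
          then have "a' = (p + q * t * y) * m i + z"
            unfolding a'_def using z(5) by (simp add: algebra_simps)
          then have "rm a' (m i) z" using \<open>z < m i\<close> unfolding rm_def by blast
          moreover have "M * m l = (q * m l) * m i" using z(5) by (simp add: ac_simps)
          moreover have "q * m l \<le> M * m l" using z(4) by (intro mult_right_mono) auto
          ultimately show ?thesis using z by blast
        qed
        show "\<exists>x\<le>c. R i x \<and> rm a' (m i) x" "\<exists>q\<le>M * m l. M * m l = q * m i" using * by blast+
      next
        fix i assume i: "i < n" "l + 1 \<le> i"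
        then have "l < i" using less_Suc_self order_less_le_trans by blast
        then show "unit_mod (m i) (M * m l)"
          using P i coprime unfolding P_def by (intro unit_mod_mult) auto
      qed
      then show ?thesis by blast
    qed
  qed
  then obtain a M where P: "P n a M" by blast
  have "entry (pr n (pr a b)) i x" if "i < n" "rm a (m i) x" for i x
    using that unfolding entry_def m_def by blast
  then have "\<forall>i<n. \<exists>x. entry (pr n (pr a b)) i x \<and> R i x" using P unfolding P_def by blast
  moreover have "len (pr n (pr a b)) n" by (auto simp: len_def)
  ultimately show ?thesis by blast
qed

text \<open>Finite choice: R need not be functional, and collection provides the bound on the
  entries.\<close>

lemma sequence_exists:
  assumes R: "D0 S (\<lambda>e. R (e 1) (e 0))" and ex: "\<And>i. i < n \<Longrightarrow> \<exists>x. R i x"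
  shows "\<exists>s. len s n \<and> (\<forall>i<n. \<exists>x. entry s i x \<and> R i x)"
  using sequence_exists_bounded[OF R] collection[OF R, of n] ex by blast

end

section \<open>Register machines in a model\<close>

definition upd :: "'a::pam \<Rightarrow> 'a \<Rightarrow> 'a \<Rightarrow> 'a \<Rightarrow> bool" where
  "upd r a v r' \<longleftrightarrow> (\<exists>n. len r n \<and> len r' n \<and> a < n) \<and> entry r' a v \<and>
     (\<forall>i x. i \<noteq> a \<and> entry r i x \<longrightarrow> entry r' i x)"

definition ins :: "nat \<Rightarrow> 'a::pam \<Rightarrow> 'a \<Rightarrow> 'a \<Rightarrow> 'a"
  where "ins op a b c = pr (of_nat op) (pr a (pr b c))"

definition exec :: "'a::pam set \<Rightarrow> 'a \<Rightarrow> 'a \<Rightarrow> 'a \<Rightarrow> 'a \<Rightarrow> 'a \<Rightarrow> bool" where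
  "exec F q p r p' r' \<longleftrightarrow> (\<exists>a b c u v.
     (q = ins 0 a b c \<and> upd r a b r' \<and> p' = p + 1) \<or>
     (q = ins 1 a b c \<and> entry r b u \<and> entry r c v \<and> upd r a (u + v) r' \<and> p' = p + 1) \<or>
     (q = ins 2 a b c \<and> entry r b u \<and> entry r c v \<and> upd r a (u * v) r' \<and> p' = p + 1) \<or>
     (q = ins 3 a b c \<and> entry r b u \<and> pr u v \<in> F \<and> upd r a v r' \<and> p' = p + 1) \<or>
     (q = ins 4 a b c \<and> entry r b u \<and> entry r c v \<and> r' = r \<and>
        (u < v \<and> p' = a \<or> \<not> u < v \<and> p' = p + 1)))"

definition step :: "'a::pam set \<Rightarrow> 'a \<Rightarrow> 'a \<Rightarrow> 'a \<Rightarrow> bool" where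
  "step F e s s' \<longleftrightarrow> (\<exists>p r p' r' q. s = pr p r \<and> s' = pr p' r' \<and> entry e p q \<and> exec F q p r p' r')"

definition initial :: "'a::pam \<Rightarrow> 'a \<Rightarrow> bool" where
  "initial s x \<longleftrightarrow> (\<exists>r. s = pr 0 r \<and> entry r 0 x \<and> (\<forall>i y. entry r i y \<longrightarrow> i = 0 \<or> y = 0))"

definition final :: "'a::pam \<Rightarrow> 'a \<Rightarrow> 'a \<Rightarrow> bool" where
  "final e s y \<longleftrightarrow> (\<exists>p r n. s = pr p r \<and> len e n \<and> n \<le> p \<and> entry r 0 y)"

definition computation :: "'a::pam set \<Rightarrow> 'a \<Rightarrow> 'a \<Rightarrow> 'a \<Rightarrow> bool" where
  "computation F e w t \<longleftrightarrow> len w (t + 1) \<and>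
     (\<forall>i<t. \<exists>s s'. entry w i s \<and> entry w (i + 1) s' \<and> step F e s s')"

definition phi :: "'a::pam set \<Rightarrow> 'a \<Rightarrow> 'a \<Rightarrow> 'a \<Rightarrow> bool" where
  "phi F e x y \<longleftrightarrow> (\<exists>w t. computation F e w t \<and> (\<exists>s. entry w 0 s \<and> initial s x) \<and>
     (\<exists>s. entry w t s \<and> final e s y))"

section \<open>Meaning and boundedness of the machine predicates\<close>

lemma case_nat_add [simp]:
  "case_nat x f (i + 1) = f i" "case_nat x f (i + numeral k) = f (i + pred_numeral k)"
  by (simp_all add: One_nat_def numeral_eq_Suc)

lemma val_num [simp]: "val e (num n) = of_nat n"
  by (induction n) (simp_all add: add.commute)

lemma val_pair [simp]: "val e (pair s t) = pr (val e s) (val e t)"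
  by (simp add: pair_def pr_def)

lemma sat_App [simp]: "sat S e s (App F t u) \<longleftrightarrow> pr (val e t) (val e u) \<in> s F"
  by (simp add: App_def)

lemma sat_Len [simp]: "sat S e s (Len t u) \<longleftrightarrow> len (val e t) (val e u)"
  by (simp add: Len_def len_def)

lemma sat_Rem [simp]: "sat S e s (Rem t u v) \<longleftrightarrow> rm (val e t) (val e u) (val e v)"
  by (simp add: Rem_def rm_def)

lemma sat_Entry [simp]: "sat S e s (Entry t u v) \<longleftrightarrow> entry (val e t) (val e u) (val e v)"
  by (simp add: Entry_def entry_def Let_def)

lemma sat_Upd [simp]:
  "sat S e s (Upd t u v t') \<longleftrightarrow> upd (val e t) (val e u) (val e v) (val e t')"
  by (auto simp: Upd_def upd_def Let_def)

lemma sat_Exec [simp]: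
  "sat S e s (Exec F q p r p' r') \<longleftrightarrow> exec (s F) (val e q) (val e p) (val e r) (val e p') (val e r')"
  by (simp add: Exec_def exec_def ins_def Let_def)

lemma sat_Step [simp]: "sat S e s (Step F t u v) \<longleftrightarrow> step (s F) (val e t) (val e u) (val e v)"
  by (simp add: Step_def step_def Let_def)

lemma sat_Leq [simp]: "sat S e s (t \<^bold>\<le> u) \<longleftrightarrow> val e t \<le> (val e u :: 'a::pam)"
  by (auto simp: Leq_def)

lemma sat_Initial [simp]: "sat S e s (Initial t u) \<longleftrightarrow> initial (val e t) (val e u)"
  by (simp add: Initial_def initial_def Let_def)

lemma sat_Final [simp]: "sat S e s (Final t u v) \<longleftrightarrow> final (val e t) (val e u) (val e v)"
  by (simp add: Final_def final_def Let_def)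

lemma sat_Phi [simp]:
  "sat S e s (Phi F t u v) \<longleftrightarrow> phi (s F) (val e t) (val e u) (val e v)"
  by (simp add: Phi_def phi_def computation_def Let_def conj_assoc conj_left_commute)

lemma ins_inj [simp]: "ins op a b c = ins op' a' b' c' \<longleftrightarrow> op = op' \<and> a = a' \<and> b = b' \<and> c = c'"
  by (simp add: ins_def)

lemma ins_bounds: "q = ins op a b c \<Longrightarrow> a \<le> q \<and> b \<le> q \<and> c \<le> q"
  unfolding ins_def using le_pr1 le_pr2 order_trans by metis

lemma Tm_ins [D0_intros]: "Tm f \<Longrightarrow> Tm g \<Longrightarrow> Tm h \<Longrightarrow> Tm (\<lambda>e. ins op (f e) (g e) (h e))"
  unfolding ins_def by (intro D0_intros)

lemma upd_bounded: "upd r a v r' \<longleftrightarrow> (\<exists>n\<le>r. len r n \<and> len r' n \<and> a < n) \<and> entry r' a v \<and>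
     (\<forall>i\<le>r. \<forall>x\<le>r. i \<noteq> a \<and> entry r i x \<longrightarrow> entry r' i x)"
  unfolding upd_def using entry_le len_le by metis

lemma D0_upd [D0_intros]: "A \<noteq> {} \<Longrightarrow> Tm f \<Longrightarrow> Tm g \<Longrightarrow> Tm h \<Longrightarrow> Tm u
  \<Longrightarrow> D0 A (\<lambda>e. upd (f e) (g e) (h e) (u e))"
  by (rule D0_subst4) (unfold upd_bounded, intro D0_intros)

lemma upd_le: "upd r a v r' \<Longrightarrow> v \<le> r'"
  unfolding upd_def using entry_le by blast

text \<open>The form of \<open>exec\<close> with bounded values. An oracle answer v is not bounded
  by the old registers r, but it is an entry of r'.\<close>

definition exec_case :: "'a::pam set \<Rightarrow> 'a \<Rightarrow> 'a \<Rightarrow> 'a \<Rightarrow> 'a \<Rightarrow> 'a \<Rightarrow> 'a \<Rightarrow> 'a \<Rightarrow> 'a \<Rightarrow> bool" where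
  "exec_case F q p r p' r' a b c \<longleftrightarrow>
     (q = ins 0 a b c \<and> upd r a b r' \<and> p' = p + 1) \<or>
     (\<exists>u\<le>r. \<exists>v\<le>r. q = ins 1 a b c \<and> entry r b u \<and> entry r c v \<and> upd r a (u + v) r' \<and> p' = p + 1) \<or>
     (\<exists>u\<le>r. \<exists>v\<le>r. q = ins 2 a b c \<and> entry r b u \<and> entry r c v \<and> upd r a (u * v) r' \<and> p' = p + 1) \<or>
     (\<exists>u\<le>r. \<exists>v\<le>r'. q = ins 3 a b c \<and> entry r b u \<and> pr u v \<in> F \<and> upd r a v r' \<and> p' = p + 1) \<or>
     (\<exists>u\<le>r. \<exists>v\<le>r. q = ins 4 a b c \<and> entry r b u \<and> entry r c v \<and> r' = r \<and>
        (u < v \<and> p' = a \<or> \<not> u < v \<and> p' = p + 1))"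

lemma exec_bounded:
  "exec F q p r p' r' \<longleftrightarrow> (\<exists>a\<le>q. \<exists>b\<le>q. \<exists>c\<le>q. exec_case F q p r p' r' a b c)"
proof
  assume "exec F q p r p' r'"
  then obtain a b c u v where *:
    "(q = ins 0 a b c \<and> upd r a b r' \<and> p' = p + 1) \<or>
     (q = ins 1 a b c \<and> entry r b u \<and> entry r c v \<and> upd r a (u + v) r' \<and> p' = p + 1) \<or>
     (q = ins 2 a b c \<and> entry r b u \<and> entry r c v \<and> upd r a (u * v) r' \<and> p' = p + 1) \<or>
     (q = ins 3 a b c \<and> entry r b u \<and> pr u v \<in> F \<and> upd r a v r' \<and> p' = p + 1) \<or>
     (q = ins 4 a b c \<and> entry r b u \<and> entry r c v \<and> r' = r \<and>
        (u < v \<and> p' = a \<or> \<not> u < v \<and> p' = p + 1))" (is "?P1 \<or> ?P2 \<or> ?P3 \<or> ?P4 \<or> ?P5")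
    unfolding exec_def by (elim exE)
  have "a \<le> q" "b \<le> q" "c \<le> q" using * ins_bounds[of q] by metis+
  moreover have "exec_case F q p r p' r' a b c"
    using *
  proof (elim disjE)
    show ?thesis if ?P1 unfolding exec_case_def using that by (intro disjI1)
    show ?thesis if ?P2 unfolding exec_case_def using that entry_le(2)[of r b u] entry_le(2)[of r c v]
      by blast
    show ?thesis if ?P3 unfolding exec_case_def using that entry_le(2)[of r b u] entry_le(2)[of r c v] by blast
    show ?thesis if ?P4 unfolding exec_case_def using that entry_le(2)[of r b u] upd_le[of r a v r'] by blast
    show ?thesis if ?P5 unfolding exec_case_def using that entry_le(2)[of r b u] entry_le(2)[of r c v] by blast
  qed
  ultimately show "\<exists>a\<le>q. \<exists>b\<le>q. \<exists>c\<le>q. exec_case F q p r p' r' a b c" by blast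
next
  assume "\<exists>a\<le>q. \<exists>b\<le>q. \<exists>c\<le>q. exec_case F q p r p' r' a b c"
  then obtain a b c where E: "exec_case F q p r p' r' a b c" by blast
  show "exec F q p r p' r'"
    unfolding exec_def
    by (rule exI[of _ a], rule exI[of _ b], rule exI[of _ c], insert E[unfolded exec_case_def]) blast
qed

lemma D0_exec [D0_intros]:
  assumes "F \<in> A" "Tm f" "Tm g" "Tm h" "Tm u" "Tm v"
  shows "D0 A (\<lambda>e. exec F (f e) (g e) (h e) (u e) (v e))"
proof (rule D0_subst5[OF _ assms(2-)])
  have "A \<noteq> {}" using assms(1) by blast
  then show "D0 A (\<lambda>e. exec F (e i) (e j) (e k) (e l) (e m))" for i j k l m
    unfolding exec_bounded exec_case_def by (intro D0_intros assms(1))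
qed

lemma step_bounded: "step F e s s' \<longleftrightarrow> (\<exists>p\<le>s. \<exists>r\<le>s. \<exists>p'\<le>s'. \<exists>r'\<le>s'. \<exists>q\<le>e.
    s = pr p r \<and> s' = pr p' r' \<and> entry e p q \<and> exec F q p r p' r')" (is "_ \<longleftrightarrow> ?rhs")
proof
  assume "step F e s s'"
  then obtain p r p' r' q where *: "s = pr p r" "s' = pr p' r'" "entry e p q" "exec F q p r p' r'"
    unfolding step_def by blast
  then have "p \<le> s" "r \<le> s" "p' \<le> s'" "r' \<le> s'" "q \<le> e" by (simp_all add: le_pr1 le_pr2 entry_le)
  with * show ?rhs by blast
qed (auto simp: step_def)

lemma D0_step [D0_intros]:
  assumes "F \<in> A" "Tm f" "Tm g" "Tm h"
  shows "D0 A (\<lambda>e. step F (f e) (g e) (h e))"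
proof (rule D0_subst3[OF _ assms(2-)])
  have "A \<noteq> {}" using assms(1) by blast
  then show "D0 A (\<lambda>e. step F (e i) (e j) (e k))" for i j k
    unfolding step_bounded by (intro D0_intros assms(1))
qed

lemma initial_bounded: "initial s x \<longleftrightarrow> (\<exists>r\<le>s. s = pr 0 r \<and> entry r 0 x \<and>
    (\<forall>i\<le>r. \<forall>y\<le>r. entry r i y \<longrightarrow> i = 0 \<or> y = 0))" (is "_ \<longleftrightarrow> ?rhs")
proof
  assume "initial s x"
  then obtain r where "s = pr 0 r" "entry r 0 x" "\<forall>i y. entry r i y \<longrightarrow> i = 0 \<or> y = 0"
    unfolding initial_def by blast
  moreover from this have "r \<le> s" by (simp add: le_pr2)
  ultimately show ?rhs by blast
next
  assume ?rhs
  then obtain r where r: "s = pr 0 r" "entry r 0 x"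
    "\<And>i y. i \<le> r \<Longrightarrow> y \<le> r \<Longrightarrow> entry r i y \<Longrightarrow> i = 0 \<or> y = 0" by blast
  then have "i = 0 \<or> y = 0" if "entry r i y" for i y using entry_le that by metis
  then show "initial s x" unfolding initial_def using r by blast
qed

lemma D0_initial [D0_intros]: "A \<noteq> {} \<Longrightarrow> Tm f \<Longrightarrow> Tm g \<Longrightarrow> D0 A (\<lambda>e. initial (f e) (g e))"
  by (rule D0_subst2) (unfold initial_bounded, intro D0_intros)

lemma final_bounded: "final e s y \<longleftrightarrow> (\<exists>p\<le>s. \<exists>r\<le>s. \<exists>n\<le>e. s = pr p r \<and> len e n \<and> n \<le> p \<and> entry r 0 y)"
  (is "_ \<longleftrightarrow> ?rhs")
proof
  assume "final e s y"
  then obtain p r n where "s = pr p r" "len e n" "n \<le> p" "entry r 0 y" unfolding final_def by blast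
  moreover from this have "p \<le> s" "r \<le> s" "n \<le> e" by (simp_all add: le_pr1 le_pr2 len_le)
  ultimately show ?rhs by blast
qed (auto simp: final_def)

lemma D0_final [D0_intros]: "A \<noteq> {} \<Longrightarrow> Tm f \<Longrightarrow> Tm g \<Longrightarrow> Tm h \<Longrightarrow> D0 A (\<lambda>e. final (f e) (g e) (h e))"
  by (rule D0_subst3) (unfold final_bounded, intro D0_intros)

lemma computation_bounded: "computation F e w t \<longleftrightarrow> len w (t + 1) \<and>
     (\<forall>i<t. \<exists>s\<le>w. \<exists>s'\<le>w. entry w i s \<and> entry w (i + 1) s' \<and> step F e s s')"
proof -
  have "(\<exists>s s'. entry w i s \<and> entry w (i + 1) s' \<and> step F e s s') \<longleftrightarrow>
      (\<exists>s\<le>w. \<exists>s'\<le>w. entry w i s \<and> entry w (i + 1) s' \<and> step F e s s')" for i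
    using entry_le(2)[of w i] entry_le(2)[of w "i + 1"] by blast
  then show ?thesis unfolding computation_def by (simp only:)
qed

lemma D0_computation [D0_intros]:
  assumes "F \<in> A" "Tm f" "Tm g" "Tm h"
  shows "D0 A (\<lambda>e. computation F (f e) (g e) (h e))"
proof (rule D0_subst3[OF _ assms(2-)])
  have "A \<noteq> {}" using assms(1) by blast
  then show "D0 A (\<lambda>e. computation F (e i) (e j) (e k))" for i j k
    unfolding computation_bounded by (intro D0_intros assms(1))
qed

text \<open>c is a stage that bounds the code of the computation. The predicate is thereby bounded
  and monotone in c, so that many convergent computations can share one stage.\<close>

definition phi_below :: "'a::pam set \<Rightarrow> 'a \<Rightarrow> 'a \<Rightarrow> 'a \<Rightarrow> 'a \<Rightarrow> bool" where
  "phi_below F c e x y \<longleftrightarrow> (\<exists>w<c. \<exists>t\<le>w. computation F e w t \<and>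
     (\<exists>s\<le>w. entry w 0 s \<and> initial s x) \<and> (\<exists>s\<le>w. entry w t s \<and> final e s y))"

lemma D0_phi_below [D0_intros]:
  assumes "F \<in> A" "Tm f" "Tm g" "Tm h" "Tm u"
  shows "D0 A (\<lambda>e. phi_below F (f e) (g e) (h e) (u e))"
proof (rule D0_subst4[OF _ assms(2-)])
  have "A \<noteq> {}" using assms(1) by blast
  then show "D0 A (\<lambda>e. phi_below F (e i) (e j) (e k) (e l))" for i j k l
    unfolding phi_below_def by (intro D0_intros assms(1))
qed

lemma phi_below_mono: "phi_below F c e x y \<Longrightarrow> c \<le> d \<Longrightarrow> phi_below F d e x y"
  unfolding phi_below_def using order_less_le_trans by blast

lemma phi_iff_below: "phi F e x y \<longleftrightarrow> (\<exists>c. phi_below F c e x y)"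
proof
  assume "phi F e x y"
  then obtain w t s s' where *: "computation F e w t" "entry w 0 s" "initial s x" "entry w t s'" "final e s' y"
    unfolding phi_def by blast
  moreover have "t \<le> w" "s \<le> w" "s' \<le> w" using * entry_le by blast+
  ultimately have "phi_below F (w + 1) e x y" unfolding phi_below_def using less_Suc_self by blast
  then show "\<exists>c. phi_below F c e x y" ..
qed (auto simp: phi_def phi_below_def)

section \<open>Determinism of the machine\<close>

lemma le_zero_iff' [simp]: "x \<le> 0 \<longleftrightarrow> x = (0 :: 'a::pam)"
  by (simp add: order.eq_iff)

text \<open>Two computations on the same input may use different codes and different numbers of
  registers, so only registers present in both can be compared.\<close>

definition same_regs :: "'a::pam \<Rightarrow> 'a \<Rightarrow> bool"
  where "same_regs r r' \<longleftrightarrow> (\<forall>i\<le>r. \<forall>x\<le>r. \<forall>y\<le>r'. entry r i x \<and> entry r' i y \<longrightarrow> x = y)"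

lemma same_regsD: "same_regs r r' \<Longrightarrow> entry r i x \<Longrightarrow> entry r' i y \<Longrightarrow> x = y"
  unfolding same_regs_def using entry_le by metis

lemma D0_same_regs [D0_intros]:
  "A \<noteq> {} \<Longrightarrow> Tm f \<Longrightarrow> Tm g \<Longrightarrow> D0 A (\<lambda>e. same_regs (f e) (g e))"
  by (rule D0_subst2) (unfold same_regs_def, intro D0_intros)

definition same_conf :: "'a::pam \<Rightarrow> 'a \<Rightarrow> bool"
  where "same_conf s s' \<longleftrightarrow> (\<exists>p\<le>s. \<exists>r\<le>s. \<exists>r'\<le>s'. s = pr p r \<and> s' = pr p r' \<and> same_regs r r')"

lemma same_confI: "same_regs r r' \<Longrightarrow> same_conf (pr p r) (pr p r')"
  unfolding same_conf_def using le_pr1 le_pr2 by blast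

lemma D0_same_conf [D0_intros]:
  "A \<noteq> {} \<Longrightarrow> Tm f \<Longrightarrow> Tm g \<Longrightarrow> D0 A (\<lambda>e. same_conf (f e) (g e))"
  by (rule D0_subst2) (unfold same_conf_def, intro D0_intros)

lemma same_conf_initial: "initial s x \<Longrightarrow> initial s' x \<Longrightarrow> same_conf s s'"
proof -
  assume "initial s x" "initial s' x"
  then obtain r r' where r: "s = pr 0 r" "entry r 0 x" "\<forall>i y. entry r i y \<longrightarrow> i = 0 \<or> y = 0"
    "s' = pr 0 r'" "entry r' 0 x" "\<forall>i y. entry r' i y \<longrightarrow> i = 0 \<or> y = 0"
    unfolding initial_def by blast
  then have "same_regs r r'" unfolding same_regs_def using entry_unique by metis
  then show ?thesis using r same_confI by blast
qed

lemma same_conf_final: "same_conf s s' \<Longrightarrow> final e s y \<Longrightarrow> final e s' y' \<Longrightarrow> y = y'"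
  unfolding same_conf_def final_def using same_regsD pr_inj by metis

lemma final_not_step: "same_conf s s' \<Longrightarrow> final e s y \<Longrightarrow> \<not> step F e s' s''"
  unfolding same_conf_def final_def step_def using entry_less_len pr_inj not_less by metis

lemma step_not_final: "same_conf s s' \<Longrightarrow> final e s' y \<Longrightarrow> \<not> step F e s s''"
  unfolding same_conf_def final_def step_def using entry_less_len pr_inj not_less by metis

context sigma2_model
begin

lemma same_regs_upd:
  assumes same: "same_regs (r :: 'a) r'" and "upd r a v r1" "upd r' a v r1'"
  shows "same_regs r1 r1'"
proof -
  \<comment> \<open>\<open>upd\<close> says only that the old entries survive. That the result has
    no other entries away from a follows from the equal lengths and the uniqueness of
    entries.\<close>
  have old: "entry r i x" if "upd r a v r1" "entry r1 i x" "i \<noteq> a" for r r1 i x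
  proof -
    obtain n where n: "len r n" "len r1 n" using \<open>upd r a v r1\<close> unfolding upd_def by blast
    then have "i < n" using entry_less_len that(2) by blast
    then obtain z where "entry r i z" using entry_exists n by blast
    moreover have "entry r1 i z" using \<open>upd r a v r1\<close> \<open>i \<noteq> a\<close> calculation unfolding upd_def by blast
    ultimately show ?thesis using entry_unique that(2) by metis
  qed
  have "x = y" if x: "entry r1 i x" and y: "entry r1' i y" for i x y
  proof (cases "i = a")
    case True
    then have "x = v" "y = v" using assms x y unfolding upd_def by (metis entry_unique)+
    then show ?thesis by simp
  next
    case False
    then show ?thesis using old[OF assms(2) x] old[OF assms(3) y] same_regsD[OF same] by blast
  qed
  then show ?thesis unfolding same_regs_def by blast
qed

lemma same_conf_exec:
  assumes F: "\<And>u v v'. pr u v \<in> F \<Longrightarrow> pr u v' \<in> F \<Longrightarrow> v = v'" and same: "same_regs (r :: 'a) r'"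
    and 1: "exec F q p r p1 r1" and 2: "exec F q p r' p1' r1'"
  shows "p1 = p1' \<and> same_regs r1 r1'"
proof -
  have u: "u = u'" if "entry r i u" "entry r' i u'" for i u u' using same_regsD[OF same] that by blast
  have up: "same_regs r1 r1'" if "upd r a v r1" "upd r' a v r1'" for a v
    using same_regs_upd[OF same that] .
  from 1 show ?thesis unfolding exec_def
  proof (elim exE disjE conjE)
    fix a b c u v assume q: "q = ins 0 a b c" and "upd r a b r1" "p1 = p + 1"
    moreover have "upd r' a b r1'" "p1' = p + 1" using 2 unfolding exec_def q by auto
    ultimately show ?thesis using up by blast
  next
    fix a b c u v assume q: "q = ins 1 a b c" and *: "entry r b u" "entry r c v" "upd r a (u + v) r1" "p1 = p + 1"
    obtain u' v' where "entry r' b u'" "entry r' c v'" "upd r' a (u' + v') r1'" "p1' = p + 1"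
      using 2 unfolding exec_def q by auto
    then show ?thesis using up * u by metis
  next
    fix a b c u v assume q: "q = ins 2 a b c" and *: "entry r b u" "entry r c v" "upd r a (u * v) r1" "p1 = p + 1"
    obtain u' v' where "entry r' b u'" "entry r' c v'" "upd r' a (u' * v') r1'" "p1' = p + 1"
      using 2 unfolding exec_def q by auto
    then show ?thesis using up * u by metis
  next
    fix a b c u v assume q: "q = ins 3 a b c" and *: "entry r b u" "pr u v \<in> F" "upd r a v r1" "p1 = p + 1"
    obtain u' v' where "entry r' b u'" "pr u' v' \<in> F" "upd r' a v' r1'" "p1' = p + 1"
      using 2 unfolding exec_def q by auto
    then show ?thesis using up * u F by metis
  next
    fix a b c u v assume q: "q = ins 4 a b c" and *: "entry r b u" "entry r c v" "r1 = r" "u < v" "p1 = a"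
    obtain u' v' where "entry r' b u'" "entry r' c v'" "r1' = r'" "u' < v' \<and> p1' = a \<or> \<not> u' < v'"
      using 2 unfolding exec_def q by auto
    then show ?thesis using * u same by metis
  next
    fix a b c u v assume q: "q = ins 4 a b c" and *: "entry r b u" "entry r c v" "r1 = r" "\<not> u < v" "p1 = p + 1"
    obtain u' v' where "entry r' b u'" "entry r' c v'" "r1' = r'" "\<not> u' < v' \<and> p1' = p + 1 \<or> u' < v'"
      using 2 unfolding exec_def q by auto
    then show ?thesis using * u same by metis
  qed
qed

lemma same_conf_step:
  assumes F: "\<And>u v v'. pr u v \<in> F \<Longrightarrow> pr u v' \<in> F \<Longrightarrow> v = v'" and same: "same_conf (s :: 'a) s'"
    and 1: "step F e s s1" and 2: "step F e s' s1'"
  shows "same_conf s1 s1'"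
proof -
  obtain p r r' where s: "s = pr p r" "s' = pr p r'" "same_regs r r'"
    using same unfolding same_conf_def by blast
  obtain p1 r1 q where 3: "s1 = pr p1 r1" "entry e p q" "exec F q p r p1 r1"
    using 1 unfolding step_def s by auto
  obtain p1' r1' where 4: "s1' = pr p1' r1'" "exec F q p r' p1' r1'"
    using 2 entry_unique[OF 3(2)] unfolding step_def s by auto
  have "p1 = p1' \<and> same_regs r1 r1'"
    by (rule same_conf_exec[OF _ s(3) 3(3) 4(2)]) (rule F)
  then show ?thesis using 3(1) 4(1) same_confI by blast
qed

text \<open>Bounded induction on the step number keeps the two computations in the same
  configuration as long as both last. A final configuration has no successor, so they have equal
  length and equal output.\<close>

lemma phi_unique:
  assumes FS: "F \<in> S" and F: "\<And>u v v'. pr u v \<in> F \<Longrightarrow> pr u v' \<in> F \<Longrightarrow> v = v'"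
    and "phi F e x y" "phi F e x y'"
  shows "y = y'"
proof -
  obtain w t s0 s1 where 1: "computation F e w t" "entry w 0 s0" "initial s0 x" "entry w t s1" "final e s1 y"
    using assms(3) unfolding phi_def by blast
  obtain w' t' s0' s1' where 2: "computation F e w' t'" "entry w' 0 s0'" "initial s0' x" "entry w' t' s1'" "final e s1' y'"
    using assms(4) unfolding phi_def by blast
  have st: "\<exists>u u'. entry w i u \<and> entry w (i + 1) u' \<and> step F e u u'" if "computation F e w t" "i < t" for w t i
    using that unfolding computation_def by blast
  have inv: "i \<le> t \<and> i \<le> t' \<longrightarrow> (\<exists>u\<le>w. \<exists>u'\<le>w'. entry w i u \<and> entry w' i u' \<and> same_conf u u')" for i
  proof (rule D0_induct[where P = "\<lambda>i. i \<le> t \<and> i \<le> t' \<longrightarrow>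
      (\<exists>u\<le>w. \<exists>u'\<le>w'. entry w i u \<and> entry w' i u' \<and> same_conf u u')"])
    show "D0 S (\<lambda>e. e 0 \<le> t \<and> e 0 \<le> t' \<longrightarrow>
      (\<exists>u\<le>w. \<exists>u'\<le>w'. entry w (e 0) u \<and> entry w' (e 0) u' \<and> same_conf u u'))"
      using nonempty by (intro D0_intros)
    show "0 \<le> t \<and> 0 \<le> t' \<longrightarrow> (\<exists>u\<le>w. \<exists>u'\<le>w'. entry w 0 u \<and> entry w' 0 u' \<and> same_conf u u')"
      using 1(2,3) 2(2,3) same_conf_initial entry_le(2) by blast
    fix i
    assume IH: "i \<le> t \<and> i \<le> t' \<longrightarrow> (\<exists>u\<le>w. \<exists>u'\<le>w'. entry w i u \<and> entry w' i u' \<and> same_conf u u')"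
    show "i + 1 \<le> t \<and> i + 1 \<le> t' \<longrightarrow>
      (\<exists>u\<le>w. \<exists>u'\<le>w'. entry w (i + 1) u \<and> entry w' (i + 1) u' \<and> same_conf u u')"
    proof
      assume "i + 1 \<le> t \<and> i + 1 \<le> t'"
      then have i: "i < t" "i < t'" using less_Suc_self order_less_le_trans by blast+
      then obtain u u' where u: "entry w i u" "entry w' i u'" "same_conf u u'"
        using IH by (meson less_imp_le)
      obtain u1 where u1: "entry w (i + 1) u1" "step F e u u1"
        using st[OF 1(1) i(1)] entry_unique u(1) by metis
      obtain u1' where u1': "entry w' (i + 1) u1'" "step F e u' u1'"
        using st[OF 2(1) i(2)] entry_unique u(2) by metis
      have "same_conf u1 u1'" by (rule same_conf_step[OF _ u(3) u1(2) u1'(2)]) (rule F)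
      then show "\<exists>u\<le>w. \<exists>u'\<le>w'. entry w (i + 1) u \<and> entry w' (i + 1) u' \<and> same_conf u u'"
        using u1(1) u1'(1) entry_le(2) by blast
    qed
  qed
  have "\<not> t < t'"
  proof
    assume "t < t'"
    then obtain u u' where u: "entry w t u" "entry w' t u'" "same_conf u u'"
      using inv[of t] by (meson less_imp_le order_refl)
    moreover obtain u1' where "step F e u' u1'" using st[OF 2(1) \<open>t < t'\<close>] entry_unique u(2) by metis
    ultimately show False using final_not_step 1(4,5) entry_unique by metis
  qed
  moreover have "\<not> t' < t"
  proof
    assume "t' < t"
    then obtain u u' where u: "entry w t' u" "entry w' t' u'" "same_conf u u'"
      using inv[of t'] by (meson less_imp_le order_refl)
    moreover obtain u1 where "step F e u u1" using st[OF 1(1) \<open>t' < t\<close>] entry_unique u(1) by metis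
    ultimately show False using step_not_final 2(4,5) entry_unique by metis
  qed
  ultimately have "t = t'" by simp
  then obtain u u' where "entry w t u" "entry w' t u'" "same_conf u u'" using inv[of t] by auto
  then have "same_conf s1 s1'" using 1(4) 2(4) \<open>t = t'\<close> entry_unique by metis
  then show ?thesis using same_conf_final 1(5) 2(5) by blast
qed

end

section \<open>Reachability of configurations\<close>

definition reach :: "'a::pam set \<Rightarrow> 'a \<Rightarrow> 'a \<Rightarrow> 'a \<Rightarrow> bool" where
  "reach F e s s' \<longleftrightarrow> (\<exists>w t. computation F e w t \<and> entry w 0 s \<and> entry w t s')"

lemma phi_reach: "initial s x \<Longrightarrow> reach F e s s' \<Longrightarrow> final e s' y \<Longrightarrow> phi F e x y"
  unfolding reach_def phi_def by blast

context sigma2_model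
begin

lemma reach_refl: "reach F e (s :: 'a) s"
proof -
  have "D0 S (\<lambda>e. e 0 = s)" using nonempty by (intro D0_intros)
  from sequence_exists[of "\<lambda>_ x. x = s", OF this, of 1]
  obtain w where "len w 1" "entry w 0 s" by auto
  then show ?thesis unfolding reach_def computation_def by (intro exI[of _ w] exI[of _ 0]) auto
qed

text \<open>Splicing two coded computations requires a new code, which the existence of finite
  sequences provides.\<close>

lemma reach_trans:
  assumes "reach F e (s :: 'a) s'" "reach F e s' s''" shows "reach F e s s''"
proof -
  obtain w t where 1: "computation F e w t" "entry w 0 s" "entry w t s'" using assms unfolding reach_def by blast
  obtain w' t' where 2: "computation F e w' t'" "entry w' 0 s'" "entry w' t' s''" using assms unfolding reach_def by blast
  \<comment> \<open>Both clauses apply at i = t, where they agree on s'. The bound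
    \<open>j \<le> i\<close> keeps R bounded.\<close>
  define R where "R i x \<longleftrightarrow> (i \<le> t \<and> entry w i x) \<or> (\<exists>j\<le>i. i = t + j \<and> entry w' j x)" for i x
  have lens: "len w (t + 1)" "len w' (t' + 1)" using 1(1) 2(1) unfolding computation_def by blast+
  have R: "D0 S (\<lambda>e. R (e 1) (e 0))"
    using nonempty unfolding R_def by (intro D0_intros)
  have R_left: "R i x \<longleftrightarrow> entry w i x" if "i \<le> t" for i x
  proof -
    have "j = 0" if "i = t + j" for j using \<open>i \<le> t\<close> that by simp
    then have "entry w i x" if "i = t + j" "entry w' j x" for j
      using that 1(3) entry_unique[OF 2(2)] by (metis add.right_neutral)
    then show ?thesis unfolding R_def using that by blast
  qed
  have R_right: "R (t + j) x \<longleftrightarrow> entry w' j x" for j x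
  proof (cases "j = 0")
    case True
    then show ?thesis using R_left[of t x] 1(3) 2(2) entry_unique by auto
  next
    case False
    then have "\<not> t + j \<le> t" using pos_iff[of j] by (simp add: not_le)
    then show ?thesis unfolding R_def by auto
  qed
  have "\<exists>x. R i x" if "i < t + t' + 1" for i
  proof (cases "i \<le> t")
    case True
    then show ?thesis using R_left entry_exists[OF lens(1), of i] by (simp add: less_Suc_iff)
  next
    case False
    then obtain j where j: "i = t + j" using le_imp_ex_add by (meson less_imp_le not_le)
    then have "j < t' + 1" using that by (simp add: add.assoc)
    then show ?thesis using R_right entry_exists[OF lens(2)] j by blast
  qed
  then obtain v where v: "len v (t + t' + 1)" "\<And>i. i < t + t' + 1 \<Longrightarrow> \<exists>x. entry v i x \<and> R i x"
    using sequence_exists[OF R, of "t + t' + 1"] by blast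
  have left: "entry v i x" if "entry w i x" for i x
  proof -
    have "i \<le> t" using entry_less_len[OF that lens(1)] by (simp add: less_Suc_iff)
    moreover have "i < t + t' + 1" using calculation by (simp add: less_Suc_iff add_increasing2)
    ultimately show ?thesis using v(2) R_left that entry_unique by metis
  qed
  have right: "entry v (t + j) x" if "entry w' j x" for j x
  proof -
    have "t + j < t + t' + 1" using entry_less_len[OF that lens(2)] by (simp add: less_Suc_iff)
    then show ?thesis using v(2) R_right that entry_unique by metis
  qed
  have "\<exists>u u'. entry v i u \<and> entry v (i + 1) u' \<and> step F e u u'" if "i < t + t'" for i
  proof (cases "i < t")
    case True
    then show ?thesis using 1(1) left unfolding computation_def by blast
  next
    case False
    then obtain j where j: "i = t + j" using le_imp_ex_add by (meson not_less)
    then have "j < t'" using that by simp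
    then obtain u u' where "entry w' j u" "entry w' (j + 1) u'" "step F e u u'"
      using 2(1) unfolding computation_def by blast
    then show ?thesis using right[of j u] right[of "j + 1" u'] j by (auto simp: add.assoc)
  qed
  then have "computation F e v (t + t')" unfolding computation_def using v(1) by blast
  moreover have "entry v 0 s" "entry v (t + t') s''" using left 1(2) right 2(3) by auto
  ultimately show ?thesis unfolding reach_def by blast
qed

lemma reach_step: assumes "step F e (s :: 'a) s'" shows "reach F e s s'"
proof -
  have "D0 S (\<lambda>e. (e 1 = 0 \<and> e 0 = s) \<or> (e 1 = 1 \<and> e 0 = s'))" using nonempty by (intro D0_intros)
  then have "\<exists>w. len w (1 + 1) \<and> (\<forall>i<1 + 1. \<exists>x. entry w i x \<and> ((i = 0 \<and> x = s) \<or> (i = 1 \<and> x = s')))"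
  proof (rule sequence_exists)
    fix i :: 'a assume "i < 1 + 1"
    then have "i = 0 \<or> i = 1" using less_Suc_iff[of i 1] less_Suc_iff[of i 0] by (auto simp: le_less)
    then show "\<exists>x. i = 0 \<and> x = s \<or> i = 1 \<and> x = s'" by auto
  qed
  then obtain w where w: "len w (1 + 1)" "\<forall>i<1 + 1. \<exists>x. entry w i x \<and> ((i = 0 \<and> x = s) \<or> (i = 1 \<and> x = s'))" by blast
  have "(0 :: 'a) < 1 + 1" "(1 :: 'a) < 1 + 1" by (simp_all add: less_Suc_iff)
  then have e: "entry w 0 s" "entry w 1 s'" using w(2) by (metis zero_neq_one)+
  have "computation F e w 1"
    unfolding computation_def
  proof (intro conjI allI impI)
    fix i :: 'a assume "i < 1"
    then have "i = 0" using less_Suc_iff[of i 0] by auto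
    then show "\<exists>s s'. entry w i s \<and> entry w (i + 1) s' \<and> step F e s s'" using e assms by auto
  qed (use w in simp)
  then show ?thesis unfolding reach_def using e by blast
qed

end

section \<open>Compiling bounded formulas into programs\<close>

text \<open>Discreteness leaves no room for nonstandard elements below a standard one. Hence the
  contents of a standard number of registers are completely described by a function on
  \<open>nat\<close>.\<close>

lemma less_of_natD: "x < of_nat n \<Longrightarrow> \<exists>j<n. x = (of_nat j :: 'a::pam)"
proof (induction n)
  case (Suc n)
  then have "x \<le> of_nat n" by (simp add: less_Suc_iff[symmetric] add.commute)
  then consider "x = of_nat n" | "x < of_nat n" by (auto simp: le_less)
  then show ?case by cases (use Suc.IH less_Suc_eq in auto)
qed simp

lemma of_nat_less_of_nat [simp]: "of_nat i < (of_nat j :: 'a::pam) \<longleftrightarrow> i < j"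
  by (rule of_nat_less_iff)

lemma D0_finite_all: "A \<noteq> {} \<Longrightarrow> (\<And>j. j < (n :: nat) \<Longrightarrow> D0 A (\<lambda>e. P j e)) \<Longrightarrow> D0 A (\<lambda>e. \<forall>j<n. P j e)"
proof (induction n)
  case 0
  then show ?case by (simp add: D0_const)
next
  case (Suc n)
  then have "D0 A (\<lambda>e. (\<forall>j<n. P j e) \<and> P n e)" by (intro D0_and) auto
  then show ?case by (simp add: All_less_Suc conj_commute)
qed

lemma D0_finite_ex: "A \<noteq> {} \<Longrightarrow> (\<And>j. j < (n :: nat) \<Longrightarrow> D0 A (\<lambda>e. P j e)) \<Longrightarrow> D0 A (\<lambda>e. \<exists>j<n. P j e)"
proof -
  assume "A \<noteq> {}" "\<And>j. j < n \<Longrightarrow> D0 A (\<lambda>e. P j e)"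
  then have "D0 A (\<lambda>e. \<not> (\<forall>j<n. \<not> P j e))" by (intro D0_not D0_finite_all)
  then show ?thesis by simp
qed

definition regs :: "nat \<Rightarrow> 'a::pam \<Rightarrow> (nat \<Rightarrow> 'a) \<Rightarrow> bool"
  where "regs n r \<rho> \<longleftrightarrow> len r (of_nat n) \<and> (\<forall>j<n. entry r (of_nat j) (\<rho> j))"

type_synonym 'a instr = "nat \<times> 'a \<times> 'a \<times> 'a"

primrec enc :: "'a::pam instr \<Rightarrow> 'a"
  where "enc (op, abc) = ins op (fst abc) (fst (snd abc)) (snd (snd abc))"

definition prog_at :: "'a::pam \<Rightarrow> nat \<Rightarrow> 'a instr list \<Rightarrow> bool"
  where "prog_at e p C \<longleftrightarrow> (\<forall>i<length C. entry e (of_nat (p + i)) (enc (C ! i)))"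

lemma prog_at_Nil [simp]: "prog_at e p []"
  by (simp add: prog_at_def)

lemma prog_at_Cons [simp]: "prog_at e p (c # C) \<longleftrightarrow> entry e (of_nat p) (enc c) \<and> prog_at e (Suc p) C"
  unfolding prog_at_def
proof (intro iffI conjI allI impI)
  assume *: "\<forall>i<length (c # C). entry e (of_nat (p + i)) (enc ((c # C) ! i))"
  from *[rule_format, of 0] show "entry e (of_nat p) (enc c)" by simp
  fix i assume "i < length C"
  then show "entry e (of_nat (Suc p + i)) (enc (C ! i))" using *[rule_format, of "Suc i"] by simp
next
  fix i
  assume "entry e (of_nat p) (enc c) \<and> (\<forall>i<length C. entry e (of_nat (Suc p + i)) (enc (C ! i)))"
    and "i < length (c # C)"
  then show "entry e (of_nat (p + i)) (enc ((c # C) ! i))" by (cases i) auto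
qed

lemma prog_at_append [simp]: "prog_at e p (C @ D) \<longleftrightarrow> prog_at e p C \<and> prog_at e (p + length C) D"
  by (induction C arbitrary: p) auto

definition conf :: "nat \<Rightarrow> 'a::pam \<Rightarrow> 'a" where "conf p r = pr (of_nat p) r"

text \<open>From any code of the registers \<open>\<rho>\<close>: codes of sequences are not unique.\<close>

definition runs :: "'a::pam set \<Rightarrow> 'a \<Rightarrow> nat \<Rightarrow> nat \<Rightarrow> (nat \<Rightarrow> 'a) \<Rightarrow> nat \<Rightarrow> (nat \<Rightarrow> 'a) \<Rightarrow> bool" where
  "runs F e n p \<rho> p' \<rho>' \<longleftrightarrow> (\<forall>r. regs n r \<rho> \<longrightarrow> (\<exists>r'. regs n r' \<rho>' \<and> reach F e (conf p r) (conf p' r')))"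

text \<open>Registers from D on are scratch space, so a function must not look at them if its value
  is to survive the computation of another one.\<close>

definition depends_below :: "nat \<Rightarrow> ((nat \<Rightarrow> 'a) \<Rightarrow> 'b) \<Rightarrow> bool"
  where "depends_below D g \<longleftrightarrow> (\<forall>\<rho> \<rho>'. (\<forall>j<D. \<rho> j = \<rho>' j) \<longrightarrow> g \<rho> = g \<rho>')"

lemma depends_belowD: "depends_below D g \<Longrightarrow> (\<And>j. j < D \<Longrightarrow> \<rho> j = \<rho>' j) \<Longrightarrow> g \<rho> = g \<rho>'"
  by (auto simp: depends_below_def)

lemma depends_below_mono: "depends_below D g \<Longrightarrow> D \<le> D' \<Longrightarrow> depends_below D' g"
  by (auto simp: depends_below_def)

text \<open>
  Some program fragment puts \<open>g \<rho>\<close> into register \<open>D\<close>, preserves the registers below \<open>D\<close> and uses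
  those above as scratch space, provided that the registers satisfy \<open>A\<close>.
\<close>

definition computes :: "'a::pam set \<Rightarrow> nat \<Rightarrow> ((nat \<Rightarrow> 'a) \<Rightarrow> bool) \<Rightarrow> ((nat \<Rightarrow> 'a) \<Rightarrow> 'a) \<Rightarrow> bool" where
  "computes F D A g \<longleftrightarrow> depends_below D g \<and> (\<forall>p. \<exists>C N. \<forall>e n \<rho>. prog_at e p C \<longrightarrow> N \<le> n \<longrightarrow> A \<rho> \<longrightarrow>
     (\<exists>\<rho>'. runs F e n p \<rho> (p + length C) \<rho>' \<and> (\<forall>j<D. \<rho>' j = \<rho> j) \<and> \<rho>' D = g \<rho>))"

lemma computesE:
  assumes "computes F D A g"
  obtains C N where "\<And>e n \<rho>. prog_at e p C \<Longrightarrow> N \<le> n \<Longrightarrow> A \<rho> \<Longrightarrow>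
     \<exists>\<rho>'. runs F e n p \<rho> (p + length C) \<rho>' \<and> (\<forall>j<D. \<rho>' j = \<rho> j) \<and> \<rho>' D = g \<rho>"
proof -
  obtain C N where "\<forall>e n \<rho>. prog_at e p C \<longrightarrow> N \<le> n \<longrightarrow> A \<rho> \<longrightarrow>
     (\<exists>\<rho>'. runs F e n p \<rho> (p + length C) \<rho>' \<and> (\<forall>j<D. \<rho>' j = \<rho> j) \<and> \<rho>' D = g \<rho>)"
    using assms unfolding computes_def by blast
  then show thesis by (intro that[of C N]) simp
qed

section \<open>Program fragments and their composition\<close>

locale machine_model = sigma2_model S for S :: "'a::pam set set" +
  fixes F :: "'a set" and f :: "'a \<Rightarrow> 'a"
  assumes F_in: "F \<in> S" and F_graph: "F = {pr x (f x) | x. True}"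
begin

lemma pr_in_F [simp]: "pr u v \<in> F \<longleftrightarrow> v = f u"
  unfolding F_graph by auto

lemma regs_exists: "\<exists>r. regs n r (\<rho> :: nat \<Rightarrow> 'a)"
proof -
  define R where "R i x \<longleftrightarrow> (\<exists>j<n. i = of_nat j \<and> x = \<rho> j)" for i x :: 'a
  have "D0 S (\<lambda>e. R (e 1) (e 0))"
    unfolding R_def using nonempty by (intro D0_finite_ex D0_intros)
  moreover have "\<exists>x. R i x" if "i < of_nat n" for i
    using less_of_natD[OF that] unfolding R_def by blast
  ultimately obtain r where r: "len r (of_nat n)" "\<And>i. i < of_nat n \<Longrightarrow> \<exists>x. entry r i x \<and> R i x"
    using sequence_exists[of R "of_nat n"] by blast
  have "entry r (of_nat j) (\<rho> j)" if "j < n" for j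
    using r(2)[of "of_nat j"] that unfolding R_def by auto
  then show ?thesis using r(1) unfolding regs_def by blast
qed

lemma upd_regs:
  assumes r: "regs n r (\<rho> :: nat \<Rightarrow> 'a)" and "a < n" and r': "regs n r' (\<rho>(a := v))"
  shows "upd r (of_nat a) v r'"
proof -
  have "entry r' i x" if "i \<noteq> of_nat a" "entry r i x" for i x
  proof -
    have "i < of_nat n" using that r entry_less_len unfolding regs_def by blast
    then obtain j where j: "j < n" "i = of_nat j" using less_of_natD by blast
    then have "x = \<rho> j" using that(2) r entry_unique unfolding regs_def by blast
    then show ?thesis using r' j that(1) unfolding regs_def by (metis fun_upd_apply)
  qed
  moreover have "entry r' (of_nat a) v" using r' \<open>a < n\<close> unfolding regs_def by (metis fun_upd_apply)
  ultimately show ?thesis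
    unfolding upd_def using r r' \<open>a < n\<close> unfolding regs_def by (metis of_nat_less_of_nat)
qed

lemma regs_upd:
  assumes "regs n r (\<rho> :: nat \<Rightarrow> 'a)" and "a < n"
  obtains r' where "upd r (of_nat a) v r'" "regs n r' (\<rho>(a := v))"
  using upd_regs[OF assms] regs_exists by metis

lemma runs_refl: "runs F e n p \<rho> p \<rho>"
  unfolding runs_def using reach_refl by blast

lemma runs_trans: "runs F e n p \<rho> p' \<rho>' \<Longrightarrow> runs F e n p' \<rho>' p'' \<rho>'' \<Longrightarrow> runs F e n p \<rho> p'' \<rho>''"
  unfolding runs_def using reach_trans by meson

lemma runs_write:
  assumes "entry e (of_nat p) q" "a < n"
    and "\<And>r r'. regs n r \<rho> \<Longrightarrow> upd r (of_nat a) v r' \<Longrightarrow> exec F q (of_nat p) r (of_nat p + 1) r'"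
  shows "runs F e n p \<rho> (Suc p) (\<rho>(a := v :: 'a))"
  unfolding runs_def
proof (intro allI impI)
  fix r assume r: "regs n r \<rho>"
  obtain r' where r': "upd r (of_nat a) v r'" "regs n r' (\<rho>(a := v))" using regs_upd[OF r assms(2)] .
  have "step F e (conf p r) (conf (Suc p) r')"
    unfolding step_def conf_def using assms(1) assms(3)[OF r r'(1)] by (auto simp: add.commute)
  then show "\<exists>r'. regs n r' (\<rho>(a := v)) \<and> reach F e (conf p r) (conf (Suc p) r')"
    using r'(2) reach_step by blast
qed

lemma regs_entry: "regs n r \<rho> \<Longrightarrow> j < n \<Longrightarrow> entry r (of_nat j) (\<rho> j)"
  by (simp add: regs_def)

lemma exec_const: "upd r a b r' \<Longrightarrow> exec F (ins 0 a b c) p r (p + 1) r'"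
  unfolding exec_def by (rule exI[of _ a], rule exI[of _ b], rule exI[of _ c]) simp

lemma exec_arith:
  assumes "entry r b u" "entry r c v"
  shows "upd r a (u + v) r' \<Longrightarrow> exec F (ins 1 a b c) p r (p + 1) r'"
    "upd r a (u * v) r' \<Longrightarrow> exec F (ins 2 a b c) p r (p + 1) r'"
  unfolding exec_def
  by (rule exI[of _ a], rule exI[of _ b], rule exI[of _ c], rule exI[of _ u], rule exI[of _ v],
      simp add: assms)+

lemma exec_oracle: "entry r b u \<Longrightarrow> upd r a (f u) r' \<Longrightarrow> exec F (ins 3 a b c) p r (p + 1) r'"
  unfolding exec_def
  by (rule exI[of _ a], rule exI[of _ b], rule exI[of _ c], rule exI[of _ u], rule exI[of _ "f u"]) simp

lemma runs_const:
  "entry e (of_nat p) (ins 0 (of_nat a) v c) \<Longrightarrow> a < n \<Longrightarrow> runs F e n p \<rho> (Suc p) (\<rho>(a := v :: 'a))"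
  by (erule runs_write, assumption) (rule exec_const)

lemma runs_add:
  "entry e (of_nat p) (ins 1 (of_nat a) (of_nat b) (of_nat c)) \<Longrightarrow> a < n \<Longrightarrow> b < n \<Longrightarrow> c < n \<Longrightarrow>
    runs F e n p \<rho> (Suc p) (\<rho>(a := \<rho> b + \<rho> c :: 'a))"
  by (erule runs_write, assumption) (rule exec_arith(1)[OF regs_entry regs_entry])

lemma runs_mul:
  "entry e (of_nat p) (ins 2 (of_nat a) (of_nat b) (of_nat c)) \<Longrightarrow> a < n \<Longrightarrow> b < n \<Longrightarrow> c < n \<Longrightarrow>
    runs F e n p \<rho> (Suc p) (\<rho>(a := \<rho> b * \<rho> c :: 'a))"
  by (erule runs_write, assumption) (rule exec_arith(2)[OF regs_entry regs_entry])

lemma runs_oracle: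
  "entry e (of_nat p) (ins 3 (of_nat a) (of_nat b) c) \<Longrightarrow> a < n \<Longrightarrow> b < n \<Longrightarrow>
    runs F e n p \<rho> (Suc p) (\<rho>(a := f (\<rho> b)))"
  by (erule runs_write, assumption) (rule exec_oracle[OF regs_entry])

lemma runs_jump:
  assumes "entry e (of_nat p) (ins 4 (of_nat a) (of_nat b) (of_nat c))" "b < n" "c < n"
  shows "runs F e n p \<rho> (if \<rho> b < (\<rho> c :: 'a) then a else Suc p) \<rho>"
  unfolding runs_def
proof (intro allI impI)
  fix r assume r: "regs n r \<rho>"
  let ?p' = "if \<rho> b < \<rho> c then a else Suc p"
  have "exec F (ins 4 (of_nat a) (of_nat b) (of_nat c)) (of_nat p) r (of_nat ?p') r"
    unfolding exec_def
    by (rule exI[of _ "of_nat a"], rule exI[of _ "of_nat b"], rule exI[of _ "of_nat c"],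
        rule exI[of _ "\<rho> b"], rule exI[of _ "\<rho> c"])
       (simp add: regs_entry[OF r assms(2)] regs_entry[OF r assms(3)] add.commute)
  then have "step F e (conf p r) (conf ?p' r)"
    unfolding step_def conf_def using assms(1) by blast
  then show "\<exists>r'. regs n r' \<rho> \<and> reach F e (conf p r) (conf ?p' r')"
    using r reach_step by blast
qed

lemma computesI:
  assumes "depends_below D g"
    and "\<And>p. \<exists>C N. \<forall>e n \<rho>. prog_at e p C \<longrightarrow> N \<le> n \<longrightarrow> A \<rho> \<longrightarrow>
     (\<exists>\<rho>'. runs F e n p \<rho> (p + length C) \<rho>' \<and> (\<forall>j<D. \<rho>' j = \<rho> j) \<and> \<rho>' D = g \<rho>)"
  shows "computes F D A g"
  using assms unfolding computes_def by blast

text \<open>v is any element of the model, possibly nonstandard. This is how number parameters enter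
  a program.\<close>

lemma computes_const: "computes F D A (\<lambda>_. v :: 'a)"
proof (rule computesI)
  fix p
  show "\<exists>C N. \<forall>e n \<rho>. prog_at e p C \<longrightarrow> N \<le> n \<longrightarrow> A \<rho> \<longrightarrow>
     (\<exists>\<rho>'. runs F e n p \<rho> (p + length C) \<rho>' \<and> (\<forall>j<D. \<rho>' j = \<rho> j) \<and> \<rho>' D = v)"
  proof (intro exI[of _ "[(0, of_nat D, v, 0)]"] exI[of _ "Suc D"] allI impI)
    fix e n \<rho> assume "prog_at e p [(0, of_nat D, v, 0)]" "Suc D \<le> n"
    then have "runs F e n p \<rho> (Suc p) (\<rho>(D := v))" by (intro runs_const) auto
    then show "\<exists>\<rho>'. runs F e n p \<rho> (p + length [(0, of_nat D, v, 0 :: 'a)]) \<rho>' \<and> (\<forall>j<D. \<rho>' j = \<rho> j) \<and> \<rho>' D = v"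
      by (intro exI[of _ "\<rho>(D := v)"]) simp
  qed
qed (simp add: depends_below_def)

text \<open>Jump targets are absolute, so the second fragment is requested for the address at which
  the first one ends. It may assume that register D already holds the result of the first.\<close>

lemma computes_append:
  assumes g: "computes F D A g" and "depends_below D h"
    and "\<And>p. \<exists>C N. \<forall>e n \<rho>. prog_at e p C \<longrightarrow> N \<le> n \<longrightarrow> \<rho> D = g \<rho> \<longrightarrow>
     (\<exists>\<rho>'. runs F e n p \<rho> (p + length C) \<rho>' \<and> (\<forall>j<D. \<rho>' j = \<rho> j) \<and> \<rho>' D = (h \<rho> :: 'a))"
  shows "computes F D A h"
proof (rule computesI)
  fix p
  obtain C N where C: "\<And>e n \<rho>. prog_at e p C \<Longrightarrow> N \<le> n \<Longrightarrow> A \<rho> \<Longrightarrow>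
     \<exists>\<rho>'. runs F e n p \<rho> (p + length C) \<rho>' \<and> (\<forall>j<D. \<rho>' j = \<rho> j) \<and> \<rho>' D = g \<rho>"
    using computesE[OF g] by metis
  obtain C' N' where C': "\<And>e n \<rho>. prog_at e (p + length C) C' \<Longrightarrow> N' \<le> n \<Longrightarrow> \<rho> D = g \<rho> \<Longrightarrow>
     \<exists>\<rho>'. runs F e n (p + length C) \<rho> (p + length C + length C') \<rho>' \<and> (\<forall>j<D. \<rho>' j = \<rho> j) \<and> \<rho>' D = h \<rho>"
    using assms(3)[of "p + length C"] by blast
  show "\<exists>C N. \<forall>e n \<rho>. prog_at e p C \<longrightarrow> N \<le> n \<longrightarrow> A \<rho> \<longrightarrow>
     (\<exists>\<rho>'. runs F e n p \<rho> (p + length C) \<rho>' \<and> (\<forall>j<D. \<rho>' j = \<rho> j) \<and> \<rho>' D = h \<rho>)"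
  proof (intro exI[of _ "C @ C'"] exI[of _ "max N N'"] allI impI)
    fix e n \<rho> assume *: "prog_at e p (C @ C')" "max N N' \<le> n" "A \<rho>"
    then obtain \<rho>1 where 1: "runs F e n p \<rho> (p + length C) \<rho>1" "\<forall>j<D. \<rho>1 j = \<rho> j" "\<rho>1 D = g \<rho>"
      using C[of e n \<rho>] by auto
    have "g \<rho>1 = g \<rho>" "h \<rho>1 = h \<rho>"
      using 1(2) g assms(2) unfolding computes_def by (auto intro: depends_belowD)
    then obtain \<rho>2 where "runs F e n (p + length C) \<rho>1 (p + length C + length C') \<rho>2" "\<forall>j<D. \<rho>2 j = \<rho>1 j" "\<rho>2 D = h \<rho>"
      using C'[of e n \<rho>1] * 1(3) by auto
    then show "\<exists>\<rho>'. runs F e n p \<rho> (p + length (C @ C')) \<rho>' \<and> (\<forall>j<D. \<rho>' j = \<rho> j) \<and> \<rho>' D = h \<rho>"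
      using 1 runs_trans by (intro exI[of _ \<rho>2]) (auto simp: add.assoc)
  qed
qed fact

lemma computes_dep: "computes F D A g \<Longrightarrow> depends_below D g"
  by (simp add: computes_def)

text \<open>The first result stays in D, where g2 may read it, while the second is put into
  \<open>Suc D\<close>; hence g2 is evaluated at \<open>\<rho>(D := g1 \<rho>)\<close>.\<close>

lemma computes_append2:
  assumes g1: "computes F D A g1" and g2: "computes F (Suc D) (\<lambda>_. True) g2" and h: "depends_below D h"
    and tail: "\<And>p. \<exists>C N. \<forall>e n \<rho>. prog_at e p C \<longrightarrow> N \<le> n \<longrightarrow> \<rho> (Suc D) = g2 (\<rho>(D := g1 \<rho>)) \<longrightarrow> \<rho> D = g1 \<rho> \<longrightarrow>
     (\<exists>\<rho>'. runs F e n p \<rho> (p + length C) \<rho>' \<and> (\<forall>j<D. \<rho>' j = \<rho> j) \<and> \<rho>' D = (h \<rho> :: 'a))"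
  shows "computes F D A h"
proof (rule computes_append[OF g1 h])
  fix p
  obtain C N where C: "\<And>e n \<rho>. prog_at e p C \<Longrightarrow> N \<le> n \<Longrightarrow>
     \<exists>\<rho>'. runs F e n p \<rho> (p + length C) \<rho>' \<and> (\<forall>j<Suc D. \<rho>' j = \<rho> j) \<and> \<rho>' (Suc D) = g2 \<rho>"
    using computesE[OF g2] by metis
  obtain C' N' where C': "\<And>e n \<rho>. prog_at e (p + length C) C' \<Longrightarrow> N' \<le> n \<Longrightarrow>
     \<rho> (Suc D) = g2 (\<rho>(D := g1 \<rho>)) \<Longrightarrow> \<rho> D = g1 \<rho> \<Longrightarrow>
     \<exists>\<rho>'. runs F e n (p + length C) \<rho> (p + length C + length C') \<rho>' \<and> (\<forall>j<D. \<rho>' j = \<rho> j) \<and> \<rho>' D = h \<rho>"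
    using tail[of "p + length C"] by blast
  show "\<exists>C N. \<forall>e n \<rho>. prog_at e p C \<longrightarrow> N \<le> n \<longrightarrow> \<rho> D = g1 \<rho> \<longrightarrow>
     (\<exists>\<rho>'. runs F e n p \<rho> (p + length C) \<rho>' \<and> (\<forall>j<D. \<rho>' j = \<rho> j) \<and> \<rho>' D = h \<rho>)"
  proof (intro exI[of _ "C @ C'"] exI[of _ "max N N'"] allI impI)
    fix e n \<rho> assume *: "prog_at e p (C @ C')" "max N N' \<le> n" "\<rho> D = g1 \<rho>"
    then obtain \<rho>1 where 1: "runs F e n p \<rho> (p + length C) \<rho>1" "\<forall>j<Suc D. \<rho>1 j = \<rho> j" "\<rho>1 (Suc D) = g2 \<rho>"
      using C[of e n \<rho>] by auto
    have eq: "g1 \<rho>1 = g1 \<rho>" "h \<rho>1 = h \<rho>"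
      using 1(2) depends_belowD[OF computes_dep[OF g1], of \<rho>1 \<rho>] depends_belowD[OF h, of \<rho>1 \<rho>]
      by auto
    have eq2: "g2 (\<rho>1(D := g1 \<rho>1)) = g2 \<rho>"
      using 1(2) *(3) eq(1) by (intro depends_belowD[OF computes_dep[OF g2]]) (auto simp: less_Suc_eq)
    have "prog_at e (p + length C) C'" "N' \<le> n" "\<rho>1 (Suc D) = g2 (\<rho>1(D := g1 \<rho>1))" "\<rho>1 D = g1 \<rho>1"
      using * 1 eq eq2 by simp_all
    from C'[OF this] obtain \<rho>2 where "runs F e n (p + length C) \<rho>1 (p + length C + length C') \<rho>2" "\<forall>j<D. \<rho>2 j = \<rho>1 j" "\<rho>2 D = h \<rho>"
      unfolding eq by blast
    then show "\<exists>\<rho>'. runs F e n p \<rho> (p + length (C @ C')) \<rho>' \<and> (\<forall>j<D. \<rho>' j = \<rho> j) \<and> \<rho>' D = h \<rho>"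
      using 1 runs_trans by (intro exI[of _ \<rho>2]) (auto simp: add.assoc)
  qed
qed

lemma computes_let:
  assumes g1: "computes F D A g1" and g2: "computes F (Suc D) (\<lambda>_. True) g2"
  shows "computes F D A (\<lambda>\<rho>. g2 (\<rho>(D := g1 \<rho>)))"
proof (rule computes_append2[OF g1 g2])
  show "depends_below D (\<lambda>\<rho>. g2 (\<rho>(D := g1 \<rho>)))"
    unfolding depends_below_def
  proof (intro allI impI)
    fix \<rho> \<rho>' :: "nat \<Rightarrow> 'a" assume *: "\<forall>j<D. \<rho> j = \<rho>' j"
    then have "g1 \<rho> = g1 \<rho>'" by (intro depends_belowD[OF computes_dep[OF g1]]) simp
    then show "g2 (\<rho>(D := g1 \<rho>)) = g2 (\<rho>'(D := g1 \<rho>'))"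
      using * by (intro depends_belowD[OF computes_dep[OF g2]]) (auto simp: less_Suc_eq)
  qed
  fix p
  \<comment> \<open>There is no copy instruction: \<open>Suc D\<close> is copied to D by adding a
    scratch register that holds 0.\<close>
  let ?C = "[(0, of_nat (Suc (Suc D)), 0, 0), (1, of_nat D, of_nat (Suc D), of_nat (Suc (Suc D)))] :: 'a instr list"
  show "\<exists>C N. \<forall>e n \<rho>. prog_at e p C \<longrightarrow> N \<le> n \<longrightarrow> \<rho> (Suc D) = g2 (\<rho>(D := g1 \<rho>)) \<longrightarrow> \<rho> D = g1 \<rho> \<longrightarrow>
     (\<exists>\<rho>'. runs F e n p \<rho> (p + length C) \<rho>' \<and> (\<forall>j<D. \<rho>' j = \<rho> j) \<and> \<rho>' D = g2 (\<rho>(D := g1 \<rho>)))"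
  proof (intro exI[of _ ?C] exI[of _ "Suc (Suc (Suc D))"] allI impI)
    fix e :: 'a and n and \<rho> :: "nat \<Rightarrow> 'a"
    assume *: "prog_at e p ?C" "Suc (Suc (Suc D)) \<le> n" "\<rho> (Suc D) = g2 (\<rho>(D := g1 \<rho>))"
    define \<rho>1 where "\<rho>1 = \<rho>(Suc (Suc D) := 0)"
    have "runs F e n p \<rho> (Suc p) \<rho>1"
      unfolding \<rho>1_def by (rule runs_const) (use * in auto)
    moreover have "runs F e n (Suc p) \<rho>1 (Suc (Suc p)) (\<rho>1(D := \<rho>1 (Suc D) + \<rho>1 (Suc (Suc D))))"
      by (rule runs_add) (use * in auto)
    ultimately show "\<exists>\<rho>'. runs F e n p \<rho> (p + length ?C) \<rho>' \<and> (\<forall>j<D. \<rho>' j = \<rho> j) \<and> \<rho>' D = g2 (\<rho>(D := g1 \<rho>))"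
      using runs_trans *(3) by (intro exI[of _ "\<rho>1(D := \<rho>1 (Suc D) + \<rho>1 (Suc (Suc D)))"]) (auto simp: \<rho>1_def)
  qed
qed

lemma computes_two:
  assumes g1: "computes F D A g1" and g2: "computes F (Suc D) (\<lambda>_. True) g2" "depends_below D g2"
    and dh: "depends_below D (\<lambda>\<rho>. h (g1 \<rho>) (g2 \<rho>))"
    and tail: "\<And>p. \<exists>C N. \<forall>e n \<rho>. prog_at e p C \<longrightarrow> N \<le> n \<longrightarrow>
     (\<exists>\<rho>'. runs F e n p \<rho> (p + length C) \<rho>' \<and> (\<forall>j<D. \<rho>' j = \<rho> j) \<and> \<rho>' D = (h (\<rho> D) (\<rho> (Suc D)) :: 'a))"
  shows "computes F D A (\<lambda>\<rho>. h (g1 \<rho>) (g2 \<rho>))"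
proof (rule computes_append2[OF g1 g2(1) dh])
  fix p
  have eq: "g2 (\<rho>(D := g1 \<rho>)) = g2 \<rho>" for \<rho> by (rule depends_belowD[OF g2(2)]) simp
  show "\<exists>C N. \<forall>e n \<rho>. prog_at e p C \<longrightarrow> N \<le> n \<longrightarrow> \<rho> (Suc D) = g2 (\<rho>(D := g1 \<rho>)) \<longrightarrow> \<rho> D = g1 \<rho> \<longrightarrow>
     (\<exists>\<rho>'. runs F e n p \<rho> (p + length C) \<rho>' \<and> (\<forall>j<D. \<rho>' j = \<rho> j) \<and> \<rho>' D = h (g1 \<rho>) (g2 \<rho>))"
    unfolding eq using tail[of p] by metis
qed

text \<open>m bounds the registers that are read, D is where the result goes. Allowing every D \<ge>
  m lets the function be computed while intermediate results occupy registers from m on.\<close>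

definition Cm :: "nat \<Rightarrow> ((nat \<Rightarrow> 'a) \<Rightarrow> 'a) \<Rightarrow> bool"
  where "Cm m g \<longleftrightarrow> depends_below m g \<and> (\<forall>D\<ge>m. computes F D (\<lambda>_. True) g)"

lemma Cm_mono: "Cm m g \<Longrightarrow> m \<le> m' \<Longrightarrow> Cm m' g"
  unfolding Cm_def by (meson depends_below_mono order_trans)

lemma Cm_const: "Cm m (\<lambda>_. v)"
  unfolding Cm_def by (simp add: computes_const depends_below_def)

lemma Cm_two:
  assumes "Cm m g1" "Cm m g2"
    and "\<And>D p. \<exists>C N. \<forall>e n \<rho>. prog_at e p C \<longrightarrow> N \<le> n \<longrightarrow>
     (\<exists>\<rho>'. runs F e n p \<rho> (p + length C) \<rho>' \<and> (\<forall>j<D. \<rho>' j = \<rho> j) \<and> \<rho>' D = h (\<rho> D) (\<rho> (Suc D)))"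
  shows "Cm m (\<lambda>\<rho>. h (g1 \<rho>) (g2 \<rho>))"
proof -
  have dep: "depends_below m (\<lambda>\<rho>. h (g1 \<rho>) (g2 \<rho>))"
    using assms(1,2) unfolding Cm_def depends_below_def by metis
  have "computes F D (\<lambda>_. True) (\<lambda>\<rho>. h (g1 \<rho>) (g2 \<rho>))" if "m \<le> D" for D
  proof (rule computes_two[where h = h])
    show "computes F D (\<lambda>_. True) g1" "computes F (Suc D) (\<lambda>_. True) g2" "depends_below D g2"
      using assms(1,2) that unfolding Cm_def by (auto intro: depends_below_mono)
    show "depends_below D (\<lambda>\<rho>. h (g1 \<rho>) (g2 \<rho>))" using dep that by (rule depends_below_mono)
  qed (rule assms(3))
  then show ?thesis using dep unfolding Cm_def by blast
qed

lemma Cm_add: assumes "Cm m g1" "Cm m g2" shows "Cm m (\<lambda>\<rho>. g1 \<rho> + g2 \<rho>)"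
proof (rule Cm_two[OF assms])
  fix D p
  let ?C = "[(1, of_nat D, of_nat D, of_nat (Suc D))] :: 'a instr list"
  show "\<exists>C N. \<forall>e n \<rho>. prog_at e p C \<longrightarrow> N \<le> n \<longrightarrow>
     (\<exists>\<rho>'. runs F e n p \<rho> (p + length C) \<rho>' \<and> (\<forall>j<D. \<rho>' j = \<rho> j) \<and> \<rho>' D = \<rho> D + \<rho> (Suc D))"
  proof (intro exI[of _ ?C] exI[of _ "Suc (Suc D)"] allI impI)
    fix e :: 'a and n and \<rho> :: "nat \<Rightarrow> 'a" assume *: "prog_at e p ?C" "Suc (Suc D) \<le> n"
    have "runs F e n p \<rho> (Suc p) (\<rho>(D := \<rho> D + \<rho> (Suc D)))"
      by (rule runs_add) (use * in auto)
    then show "\<exists>\<rho>'. runs F e n p \<rho> (p + length ?C) \<rho>' \<and> (\<forall>j<D. \<rho>' j = \<rho> j) \<and> \<rho>' D = \<rho> D + \<rho> (Suc D)"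
      by (intro exI[of _ "\<rho>(D := \<rho> D + \<rho> (Suc D))"]) auto
  qed
qed

lemma Cm_mul: assumes "Cm m g1" "Cm m g2" shows "Cm m (\<lambda>\<rho>. g1 \<rho> * g2 \<rho>)"
proof (rule Cm_two[OF assms])
  fix D p
  let ?C = "[(2, of_nat D, of_nat D, of_nat (Suc D))] :: 'a instr list"
  show "\<exists>C N. \<forall>e n \<rho>. prog_at e p C \<longrightarrow> N \<le> n \<longrightarrow>
     (\<exists>\<rho>'. runs F e n p \<rho> (p + length C) \<rho>' \<and> (\<forall>j<D. \<rho>' j = \<rho> j) \<and> \<rho>' D = \<rho> D * \<rho> (Suc D))"
  proof (intro exI[of _ ?C] exI[of _ "Suc (Suc D)"] allI impI)
    fix e :: 'a and n and \<rho> :: "nat \<Rightarrow> 'a" assume *: "prog_at e p ?C" "Suc (Suc D) \<le> n"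
    have "runs F e n p \<rho> (Suc p) (\<rho>(D := \<rho> D * \<rho> (Suc D)))"
      by (rule runs_mul) (use * in auto)
    then show "\<exists>\<rho>'. runs F e n p \<rho> (p + length ?C) \<rho>' \<and> (\<forall>j<D. \<rho>' j = \<rho> j) \<and> \<rho>' D = \<rho> D * \<rho> (Suc D)"
      by (intro exI[of _ "\<rho>(D := \<rho> D * \<rho> (Suc D))"]) auto
  qed
qed

lemma Cm_less: assumes "Cm m g1" "Cm m g2" shows "Cm m (\<lambda>\<rho>. of_bool (g1 \<rho> < g2 \<rho>))"
proof (rule Cm_two[OF assms])
  fix D p
  \<comment> \<open>Register \<open>Suc (Suc D)\<close> is set to 1, and the jump skips the
    instruction that would reset it to 0. The last two instructions copy it into D.\<close>
  let ?C = "[(0, of_nat (Suc (Suc D)), 1, 0), (4, of_nat (Suc (Suc (Suc p))), of_nat D, of_nat (Suc D)),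
     (0, of_nat (Suc (Suc D)), 0, 0), (0, of_nat (Suc D), 0, 0), (1, of_nat D, of_nat (Suc (Suc D)), of_nat (Suc D))] :: 'a instr list"
  show "\<exists>C N. \<forall>e n \<rho>. prog_at e p C \<longrightarrow> N \<le> n \<longrightarrow>
     (\<exists>\<rho>'. runs F e n p \<rho> (p + length C) \<rho>' \<and> (\<forall>j<D. \<rho>' j = \<rho> j) \<and> \<rho>' D = of_bool (\<rho> D < \<rho> (Suc D)))"
  proof (intro exI[of _ ?C] exI[of _ "Suc (Suc (Suc D))"] allI impI)
    fix e :: 'a and n and \<rho> :: "nat \<Rightarrow> 'a" assume *: "prog_at e p ?C" "Suc (Suc (Suc D)) \<le> n"
    define \<rho>1 where "\<rho>1 = \<rho>(Suc (Suc D) := 1)"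
    define b where "b \<longleftrightarrow> \<rho> D < \<rho> (Suc D)"
    define \<rho>2 where "\<rho>2 = \<rho>(Suc (Suc D) := of_bool b)"
    have 1: "runs F e n p \<rho> (Suc p) \<rho>1"
      unfolding \<rho>1_def by (rule runs_const) (use * in auto)
    have 2: "runs F e n (Suc p) \<rho>1 (if b then Suc (Suc (Suc p)) else Suc (Suc p)) \<rho>1"
      using runs_jump[of e "Suc p" "Suc (Suc (Suc p))" D "Suc D" n \<rho>1] * by (auto simp: \<rho>1_def b_def)
    have 3: "runs F e n (if b then Suc (Suc (Suc p)) else Suc (Suc p)) \<rho>1 (Suc (Suc (Suc p))) \<rho>2"
    proof (cases b)
      case True
      then show ?thesis using runs_refl by (simp add: \<rho>1_def \<rho>2_def)
    next
      case False
      have "runs F e n (Suc (Suc p)) \<rho>1 (Suc (Suc (Suc p))) (\<rho>1(Suc (Suc D) := 0))"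
        by (rule runs_const) (use * in auto)
      then show ?thesis using False by (simp add: \<rho>1_def \<rho>2_def)
    qed
    have 4: "runs F e n (Suc (Suc (Suc p))) \<rho>2 (Suc (Suc (Suc (Suc p)))) (\<rho>2(Suc D := 0))"
      by (rule runs_const) (use * in auto)
    have 5: "runs F e n (Suc (Suc (Suc (Suc p)))) (\<rho>2(Suc D := 0)) (Suc (Suc (Suc (Suc (Suc p))))) (\<rho>2(Suc D := 0, D := of_bool b))"
    proof -
      have "runs F e n (Suc (Suc (Suc (Suc p)))) (\<rho>2(Suc D := 0)) (Suc (Suc (Suc (Suc (Suc p)))))
          (\<rho>2(Suc D := 0, D := (\<rho>2(Suc D := 0)) (Suc (Suc D)) + (\<rho>2(Suc D := 0)) (Suc D)))"
        by (rule runs_add) (use * in auto)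
      then show ?thesis by (simp add: \<rho>2_def)
    qed
    have "runs F e n p \<rho> (Suc (Suc (Suc (Suc (Suc p))))) (\<rho>2(Suc D := 0, D := of_bool b))"
      using runs_trans[OF 1 runs_trans[OF 2 runs_trans[OF 3 runs_trans[OF 4 5]]]] .
    then show "\<exists>\<rho>'. runs F e n p \<rho> (p + length ?C) \<rho>' \<and> (\<forall>j<D. \<rho>' j = \<rho> j) \<and> \<rho>' D = of_bool (\<rho> D < \<rho> (Suc D))"
      by (intro exI[of _ "\<rho>2(Suc D := 0, D := of_bool b)"]) (auto simp: \<rho>2_def b_def)
  qed
qed

lemma Cm_reg: assumes "i < m" shows "Cm m (\<lambda>\<rho>. \<rho> i)"
proof -
  have "computes F D (\<lambda>_. True) (\<lambda>\<rho>. \<rho> i)" if "m \<le> D" for D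
  proof (rule computes_append[OF computes_const[of D "\<lambda>_. True" 0]])
    show "depends_below D (\<lambda>\<rho>. \<rho> i)" using assms that by (simp add: depends_below_def)
    fix p
    let ?C = "[(1, of_nat D, of_nat i, of_nat D)] :: 'a instr list"
    show "\<exists>C N. \<forall>e n \<rho>. prog_at e p C \<longrightarrow> N \<le> n \<longrightarrow> \<rho> D = 0 \<longrightarrow>
     (\<exists>\<rho>'. runs F e n p \<rho> (p + length C) \<rho>' \<and> (\<forall>j<D. \<rho>' j = \<rho> j) \<and> \<rho>' D = \<rho> i)"
    proof (intro exI[of _ ?C] exI[of _ "Suc D"] allI impI)
      fix e :: 'a and n and \<rho> :: "nat \<Rightarrow> 'a" assume *: "prog_at e p ?C" "Suc D \<le> n" "\<rho> D = 0"
      have "runs F e n p \<rho> (Suc p) (\<rho>(D := \<rho> i + \<rho> D))"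
        by (rule runs_add) (use * assms that in auto)
      then show "\<exists>\<rho>'. runs F e n p \<rho> (p + length ?C) \<rho>' \<and> (\<forall>j<D. \<rho>' j = \<rho> j) \<and> \<rho>' D = \<rho> i"
        using * by (intro exI[of _ "\<rho>(D := \<rho> i + \<rho> D)"]) auto
    qed
  qed
  then show ?thesis using assms unfolding Cm_def by (simp add: depends_below_def)
qed

lemma Cm_oracle: assumes "Cm m g" shows "Cm m (\<lambda>\<rho>. f (g \<rho>))"
proof -
  have dep: "depends_below m (\<lambda>\<rho>. f (g \<rho>))"
    using assms unfolding Cm_def depends_below_def by metis
  have "computes F D (\<lambda>_. True) (\<lambda>\<rho>. f (g \<rho>))" if "m \<le> D" for D
  proof (rule computes_append)
    show "computes F D (\<lambda>_. True) g" using assms that unfolding Cm_def by blast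
    show "depends_below D (\<lambda>\<rho>. f (g \<rho>))" using dep that by (rule depends_below_mono)
    fix p
    let ?C = "[(3, of_nat D, of_nat D, 0)] :: 'a instr list"
    show "\<exists>C N. \<forall>e n \<rho>. prog_at e p C \<longrightarrow> N \<le> n \<longrightarrow> \<rho> D = g \<rho> \<longrightarrow>
     (\<exists>\<rho>'. runs F e n p \<rho> (p + length C) \<rho>' \<and> (\<forall>j<D. \<rho>' j = \<rho> j) \<and> \<rho>' D = f (g \<rho>))"
    proof (intro exI[of _ ?C] exI[of _ "Suc D"] allI impI)
      fix e :: 'a and n and \<rho> :: "nat \<Rightarrow> 'a" assume *: "prog_at e p ?C" "Suc D \<le> n" "\<rho> D = g \<rho>"
      have "runs F e n p \<rho> (Suc p) (\<rho>(D := f (\<rho> D)))"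
        by (rule runs_oracle) (use * in auto)
      then show "\<exists>\<rho>'. runs F e n p \<rho> (p + length ?C) \<rho>' \<and> (\<forall>j<D. \<rho>' j = \<rho> j) \<and> \<rho>' D = f (g \<rho>)"
        using * by (intro exI[of _ "\<rho>(D := f (\<rho> D))"]) auto
    qed
  qed
  then show ?thesis using dep unfolding Cm_def by blast
qed

section \<open>Unbounded search\<close>

lemma regs_of_len: "len r (of_nat n) \<Longrightarrow> \<exists>\<rho> :: nat \<Rightarrow> 'a. regs n r \<rho>"
proof -
  assume r: "len r (of_nat n)"
  then have "\<forall>j. \<exists>x. j < n \<longrightarrow> entry r (of_nat j) x" using entry_exists of_nat_less_of_nat by blast
  then obtain \<rho> where "\<forall>j. j < n \<longrightarrow> entry r (of_nat j) (\<rho> j)" by metis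
  then show ?thesis using r unfolding regs_def by blast
qed

text \<open>The values 1 and 0 drive the search loop: the test value is added to the counter, and
  the loop continues while it is positive.\<close>

definition is_mu :: "('a \<Rightarrow> 'a) \<Rightarrow> 'a \<Rightarrow> bool"
  where "is_mu h m \<longleftrightarrow> h m = 0 \<and> (\<forall>x<m. h x = 1)"

lemma is_mu_unique: "is_mu h m \<Longrightarrow> is_mu h m' \<Longrightarrow> m = m'"
  unfolding is_mu_def by (metis linorder_neqE zero_neq_one)

lemma the_is_mu: "is_mu h m \<Longrightarrow> (THE m. is_mu h m) = m"
  using is_mu_unique by blast

text \<open>The number m of rounds may be nonstandard, so \<open>runs_trans\<close> cannot simply be
  iterated. Instead, Sigma_1 induction in the model shows that every counter value up to m is
  reached.\<close>

lemma runs_loop: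
  assumes body: "\<And>\<rho>1. (\<And>j. j < D \<Longrightarrow> \<rho>1 j = \<rho> j) \<Longrightarrow>
      \<exists>\<rho>2. runs F e n L \<rho>1 (if 0 < h (\<rho>1 D) then L else q) \<rho>2 \<and> (\<forall>j<D. \<rho>2 j = \<rho> j) \<and> \<rho>2 D = \<rho>1 D + h (\<rho>1 D)"
    and m: "is_mu h m" and n: "D < n" and r: "regs n r \<rho>" "\<rho> D = 0"
  shows "\<exists>r' \<rho>'. regs n r' \<rho>' \<and> reach F e (conf L r) (conf q r') \<and> (\<forall>j<D. \<rho>' j = \<rho> j) \<and> \<rho>' D = m"
proof -
  \<comment> \<open>Stated with codes and standardly many entries instead of a function for the
    current registers, the invariant is Sigma_1. Scratch registers are left unspecified.\<close>
  define I where "I x \<longleftrightarrow> (\<exists>r'. (len r' (of_nat n) \<and> (\<forall>j<D. entry r' (of_nat j) (\<rho> j)) \<and> entry r' (of_nat D) x) \<and>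
    reach F e (conf L r) (conf L r'))" for x
  have next_regs: "\<exists>r2 \<rho>2. regs n r2 \<rho>2 \<and> reach F e (conf L r) (conf (if 0 < h x then L else q) r2) \<and>
      (\<forall>j<D. \<rho>2 j = \<rho> j) \<and> \<rho>2 D = x + h x" if Ix: "I x" for x
  proof -
    obtain r1 where r1: "len r1 (of_nat n)" "\<forall>j<D. entry r1 (of_nat j) (\<rho> j)" "entry r1 (of_nat D) x"
      "reach F e (conf L r) (conf L r1)" using Ix unfolding I_def by blast
    obtain \<rho>1 where \<rho>1: "regs n r1 \<rho>1" using regs_of_len r1(1) by blast
    have "\<rho>1 j = \<rho> j" if "j < D" for j
      using \<rho>1 r1(2) that n entry_unique unfolding regs_def by (meson order_less_trans)
    moreover have "\<rho>1 D = x" using \<rho>1 r1(3) n entry_unique unfolding regs_def by blast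
    ultimately obtain \<rho>2 where \<rho>2: "runs F e n L \<rho>1 (if 0 < h x then L else q) \<rho>2"
      "\<forall>j<D. \<rho>2 j = \<rho> j" "\<rho>2 D = x + h x" using body[of \<rho>1] by metis
    obtain r2 where "regs n r2 \<rho>2" "reach F e (conf L r1) (conf (if 0 < h x then L else q) r2)"
      using \<rho>2(1) \<rho>1 unfolding runs_def by blast
    then show ?thesis using \<rho>2 reach_trans r1(4) by blast
  qed
  have "\<not> x \<le> m \<or> I x" for x
  proof (rule S1_induct[where P = "\<lambda>x. \<not> x \<le> m \<or> I x"])
    show "S1 S (\<lambda>e. \<not> e 0 \<le> m \<or> I (e 0))"
      unfolding I_def reach_def conf_def using nonempty F_in
      by (intro S1_or S1_ex S1_and S1_D0 D0_intros D0_finite_all)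
    have "I 0" unfolding I_def using r n reach_refl unfolding regs_def
      by (metis order_less_trans)
    then show "\<not> 0 \<le> m \<or> I 0" by blast
    fix x assume IH: "\<not> x \<le> m \<or> I x"
    show "\<not> x + 1 \<le> m \<or> I (x + 1)"
    proof (cases "x < m")
      case True
      then have h: "h x = 1" using m unfolding is_mu_def by blast
      have "I x" using IH True by auto
      from next_regs[OF this, unfolded h]
      obtain r2 \<rho>2 where r2: "regs n r2 \<rho>2" "reach F e (conf L r) (conf L r2)" "\<forall>j<D. \<rho>2 j = \<rho> j" "\<rho>2 D = x + 1"
        by auto
      have "len r2 (of_nat n)" "entry r2 (of_nat D) (x + 1)" "\<forall>j<D. entry r2 (of_nat j) (\<rho> j)"
        using r2 n unfolding regs_def by (metis, metis, metis order_less_trans)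
      then show ?thesis unfolding I_def using r2(2) by blast
    next
      case False
      then show ?thesis using less_Suc_self order_less_le_trans by blast
    qed
  qed
  then have "I m" by blast
  moreover have "h m = 0" using m unfolding is_mu_def by blast
  ultimately show ?thesis using next_regs[of m] by (auto; blast)
qed

lemma computes_mu:
  assumes H: "computes F (Suc D) (\<lambda>_. True) (\<lambda>\<rho>. h \<rho> (\<rho> D))" and dep: "depends_below D h"
  shows "computes F D (\<lambda>\<rho>. \<exists>m. is_mu (h \<rho>) m) (\<lambda>\<rho>. THE m. is_mu (h \<rho>) m)"
proof (rule computesI)
  show "depends_below D (\<lambda>\<rho>. THE m. is_mu (h \<rho>) m)"
    using dep unfolding depends_below_def by metis
  fix p
  obtain C N where C: "\<And>e n \<rho>. prog_at e (Suc p) C \<Longrightarrow> N \<le> n \<Longrightarrow>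
     \<exists>\<rho>'. runs F e n (Suc p) \<rho> (Suc p + length C) \<rho>' \<and> (\<forall>j<Suc D. \<rho>' j = \<rho> j) \<and> \<rho>' (Suc D) = h \<rho> (\<rho> D)"
    using computesE[OF H] by metis
  define l where "l = Suc p + length C"
  \<comment> \<open>The test value in \<open>Suc D\<close> is added to the counter, and a comparison
    with a fresh 0 jumps back to the test if that value is positive.\<close>
  let ?T = "[(1, of_nat D, of_nat D, of_nat (Suc D)), (0, of_nat (Suc (Suc D)), 0, 0),
     (4, of_nat (Suc p), of_nat (Suc (Suc D)), of_nat (Suc D))] :: 'a instr list"
  let ?P = "(0, of_nat D, 0, 0) # C @ ?T"
  show "\<exists>C N. \<forall>e n \<rho>. prog_at e p C \<longrightarrow> N \<le> n \<longrightarrow> (\<exists>m. is_mu (h \<rho>) m) \<longrightarrow>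
     (\<exists>\<rho>'. runs F e n p \<rho> (p + length C) \<rho>' \<and> (\<forall>j<D. \<rho>' j = \<rho> j) \<and> \<rho>' D = (THE m. is_mu (h \<rho>) m))"
  proof (intro exI[of _ ?P] exI[of _ "max N (Suc (Suc (Suc D)))"] allI impI)
    fix e :: 'a and n and \<rho> :: "nat \<Rightarrow> 'a"
    assume P: "prog_at e p ?P" and n: "max N (Suc (Suc (Suc D))) \<le> n" and "\<exists>m. is_mu (h \<rho>) m"
    then obtain m where m: "is_mu (h \<rho>) m" by blast
    have T: "prog_at e l ?T" "prog_at e (Suc p) C" using P by (simp_all add: l_def)
    have "\<exists>\<rho>2. runs F e n (Suc p) \<rho>1 (if 0 < h \<rho> (\<rho>1 D) then Suc p else Suc (Suc (Suc l))) \<rho>2 \<and>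
       (\<forall>j<D. \<rho>2 j = (\<rho>(D := 0)) j) \<and> \<rho>2 D = \<rho>1 D + h \<rho> (\<rho>1 D)"
      if *: "\<And>j. j < D \<Longrightarrow> \<rho>1 j = (\<rho>(D := 0)) j" for \<rho>1
    proof -
      have h: "h \<rho>1 = h \<rho>" by (rule depends_belowD[OF dep]) (use * in simp)
      obtain \<rho>2 where \<rho>2: "runs F e n (Suc p) \<rho>1 l \<rho>2" "\<forall>j<Suc D. \<rho>2 j = \<rho>1 j" "\<rho>2 (Suc D) = h \<rho> (\<rho>1 D)"
        using C[OF T(2), of n \<rho>1] n unfolding h l_def by auto
      define \<rho>3 where "\<rho>3 = \<rho>2(D := \<rho>2 D + \<rho>2 (Suc D))"
      define \<rho>4 where "\<rho>4 = \<rho>3(Suc (Suc D) := 0)"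
      have "runs F e n l \<rho>2 (Suc l) \<rho>3"
        unfolding \<rho>3_def by (rule runs_add) (use T(1) n in auto)
      moreover have "runs F e n (Suc l) \<rho>3 (Suc (Suc l)) \<rho>4"
        unfolding \<rho>4_def by (rule runs_const) (use T(1) n in auto)
      moreover have "runs F e n (Suc (Suc l)) \<rho>4 (if \<rho>4 (Suc (Suc D)) < \<rho>4 (Suc D) then Suc p else Suc (Suc (Suc l))) \<rho>4"
        by (rule runs_jump) (use T(1) n in auto)
      moreover have "\<rho>4 (Suc (Suc D)) = 0" "\<rho>4 (Suc D) = h \<rho> (\<rho>1 D)" "\<rho>4 D = \<rho>1 D + h \<rho> (\<rho>1 D)"
        using \<rho>2 by (simp_all add: \<rho>3_def \<rho>4_def)
      moreover have "\<forall>j<D. \<rho>4 j = (\<rho>(D := 0)) j" using \<rho>2(2) * by (simp add: \<rho>3_def \<rho>4_def)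
      ultimately show ?thesis using runs_trans[OF \<rho>2(1)] runs_trans by metis
    qed
    note loop = runs_loop[where h = "h \<rho>" and L = "Suc p" and q = "Suc (Suc (Suc l))", OF this m]
    \<comment> \<open>\<open>runs\<close> needs one \<rho>' for all codes r of \<rho>, but the
      outcome of the loop may depend on the code at which it starts. The instruction that clears
      register D can lead from every r to the same code r0.\<close>
    obtain r0 where r0: "regs n r0 (\<rho>(D := 0))" using regs_exists by blast
    have "\<exists>r' \<rho>'. regs n r' \<rho>' \<and> reach F e (conf (Suc p) r0) (conf (Suc (Suc (Suc l))) r') \<and>
        (\<forall>j<D. \<rho>' j = (\<rho>(D := 0)) j) \<and> \<rho>' D = m"
      by (rule loop[OF _ _ r0]) (use n in auto)
    then obtain r' \<rho>' where r': "regs n r' \<rho>'" "reach F e (conf (Suc p) r0) (conf (Suc (Suc (Suc l))) r')"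
      "\<forall>j<D. \<rho>' j = \<rho> j" "\<rho>' D = m" by auto
    have "runs F e n p \<rho> (Suc (Suc (Suc l))) \<rho>'"
      unfolding runs_def
    proof (intro allI impI)
      fix r assume r: "regs n r \<rho>"
      have "exec F (ins 0 (of_nat D) 0 0) (of_nat p) r (of_nat p + 1) r0"
        by (rule exec_const, rule upd_regs[OF r _ r0]) (use n in auto)
      then have "step F e (conf p r) (conf (Suc p) r0)"
        unfolding step_def conf_def using P by (auto simp: add.commute)
      then show "\<exists>r'. regs n r' \<rho>' \<and> reach F e (conf p r) (conf (Suc (Suc (Suc l))) r')"
        using reach_step reach_trans r'(1,2) by blast
    qed
    moreover have "p + length ?P = Suc (Suc (Suc l))" by (simp add: l_def)
    ultimately show "\<exists>\<rho>'. runs F e n p \<rho> (p + length ?P) \<rho>' \<and> (\<forall>j<D. \<rho>' j = \<rho> j) \<and> \<rho>' D = (THE m. is_mu (h \<rho>) m)"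
      using r'(3,4) the_is_mu[OF m] by metis
  qed
qed

section \<open>Deciding bounded formulas by programs\<close>

lemma Cm_not: "Cm m (\<lambda>\<rho>. of_bool (P \<rho>)) \<Longrightarrow> Cm m (\<lambda>\<rho>. of_bool (\<not> P \<rho>))"
proof -
  assume "Cm m (\<lambda>\<rho>. of_bool (P \<rho>))"
  then have "Cm m (\<lambda>\<rho>. of_bool (of_bool (P \<rho>) < (1 :: 'a)))" by (intro Cm_less Cm_const)
  moreover have "(of_bool (P \<rho>) < (1 :: 'a)) = (\<not> P \<rho>)" for \<rho> by simp
  ultimately show ?thesis by simp
qed

lemma Cm_and:
  "Cm m (\<lambda>\<rho>. of_bool (P \<rho>)) \<Longrightarrow> Cm m (\<lambda>\<rho>. of_bool (Q \<rho>)) \<Longrightarrow> Cm m (\<lambda>\<rho>. of_bool (P \<rho> \<and> Q \<rho>))"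
  using Cm_mul[of m "\<lambda>\<rho>. of_bool (P \<rho>)" "\<lambda>\<rho>. of_bool (Q \<rho>)"] by (simp add: of_bool_conj)

lemma Cm_eq: assumes "Cm m g1" "Cm m g2" shows "Cm m (\<lambda>\<rho>. of_bool (g1 \<rho> = g2 \<rho>))"
proof -
  have "Cm m (\<lambda>\<rho>. of_bool (\<not> g1 \<rho> < g2 \<rho> \<and> \<not> g2 \<rho> < g1 \<rho>))"
    by (intro Cm_and Cm_not Cm_less assms)
  moreover have "(\<not> g1 \<rho> < g2 \<rho> \<and> \<not> g2 \<rho> < g1 \<rho>) = (g1 \<rho> = g2 \<rho>)" for \<rho> by auto
  ultimately show ?thesis by simp
qed

text \<open>The search stops at the first x that satisfies P or has reached the bound, hence always.
  A witness exists exactly if it stops strictly below the bound.\<close>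

lemma Cm_bex:
  assumes b: "Cm m b" and P: "\<And>D. m \<le> D \<Longrightarrow> Cm (Suc D) (\<lambda>\<rho>. of_bool (P \<rho> (\<rho> D)))"
    and dep: "depends_below m P" and D0: "\<And>\<rho>. D0 S (\<lambda>e. P \<rho> (e 0))"
  shows "Cm m (\<lambda>\<rho>. of_bool (\<exists>x<b \<rho>. P \<rho> x))"
proof -
  define h where "h \<rho> x = (of_bool (\<not> P \<rho> x \<and> x < b \<rho>) :: 'a)" for \<rho> x
  have dep_h: "depends_below m h"
    using dep b unfolding h_def Cm_def depends_below_def by metis
  have mu: "\<exists>k. is_mu (h \<rho>) k" for \<rho>
  proof -
    have "D0 S (\<lambda>e. \<not> (\<not> P \<rho> (e 0) \<and> e 0 < b \<rho>))" using nonempty by (intro D0_intros D0)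
    from D0_least[of "\<lambda>x. \<not> (\<not> P \<rho> x \<and> x < b \<rho>)" "b \<rho>", OF this]
    obtain k where "\<not> (\<not> P \<rho> k \<and> k < b \<rho>)" "\<forall>y<k. \<not> P \<rho> y \<and> y < b \<rho>" by auto
    then have "is_mu (h \<rho>) k" unfolding is_mu_def h_def by simp
    then show ?thesis ..
  qed
  have "Cm m (\<lambda>\<rho>. THE k. is_mu (h \<rho>) k)"
    unfolding Cm_def
  proof (intro conjI allI impI)
    show "depends_below m (\<lambda>\<rho>. THE k. is_mu (h \<rho>) k)"
      using dep_h unfolding depends_below_def by metis
    fix D assume D: "m \<le> D"
    have "Cm (Suc D) (\<lambda>\<rho>. h \<rho> (\<rho> D))"
      unfolding h_def using D by (intro Cm_and Cm_not Cm_less P Cm_reg Cm_mono[OF b]) auto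
    then have "computes F (Suc D) (\<lambda>_. True) (\<lambda>\<rho>. h \<rho> (\<rho> D))" unfolding Cm_def by blast
    from computes_mu[OF this depends_below_mono[OF dep_h D]]
    show "computes F D (\<lambda>_. True) (\<lambda>\<rho>. THE k. is_mu (h \<rho>) k)"
      using mu by simp
  qed
  from Cm_less[OF this b]
  have "Cm m (\<lambda>\<rho>. of_bool ((THE k. is_mu (h \<rho>) k) < b \<rho>))" .
  moreover have "((THE k. is_mu (h \<rho>) k) < b \<rho>) \<longleftrightarrow> (\<exists>x<b \<rho>. P \<rho> x)" for \<rho>
  proof -
    obtain k where k: "is_mu (h \<rho>) k" using mu by blast
    then have 1: "\<not> (\<not> P \<rho> k \<and> k < b \<rho>)" and 2: "\<And>y. y < k \<Longrightarrow> \<not> P \<rho> y"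
      unfolding is_mu_def h_def by auto
    have "k < b \<rho> \<longleftrightarrow> (\<exists>x<b \<rho>. P \<rho> x)"
      using 1 2 by (meson not_less order_le_less_trans)
    then show ?thesis unfolding the_is_mu[OF k] .
  qed
  ultimately show ?thesis by simp
qed

lemma Cm_val: "(\<And>i. Cm m (l i)) \<Longrightarrow> Cm m (\<lambda>\<rho>. val (\<lambda>i. l i \<rho>) t)"
  by (induction t) (simp_all add: Cm_const Cm_add Cm_mul)

lemma D0_sat: "\<phi> \<in> Delta00 \<Longrightarrow> D0 S (\<lambda>e. sat {} (case_nat (e 0) c) (\<lambda>_. F) \<phi>)"
proof -
  assume "\<phi> \<in> Delta00"
  moreover have "penv (case_nat (Inl 0) (\<lambda>i. Inr (c i))) e = case_nat (e 0) c" for e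
    by (auto simp: fun_eq_iff penv_def split: nat.split)
  ultimately show ?thesis unfolding D0_def using F_in
    by (intro bexI[of _ \<phi>] exI[of _ "\<lambda>_. F"] exI[of _ "case_nat (Inl 0) (\<lambda>i. Inr (c i))"]) auto
qed

lemma Cm_bex_sat:
  assumes \<phi>: "\<phi> \<in> Delta00"
    and IH: "\<And>m l. (\<And>i. Cm m (l i)) \<Longrightarrow> Cm m (\<lambda>\<rho>. of_bool (sat {} (\<lambda>i. l i \<rho>) (\<lambda>_. F) \<phi>))"
    and l: "\<And>i. Cm m (l i)"
  shows "Cm m (\<lambda>\<rho>. of_bool (\<exists>x<val (\<lambda>i. l i \<rho>) t. sat {} (case_nat x (\<lambda>i. l i \<rho>)) (\<lambda>_. F) \<phi>))"
proof (rule Cm_bex[OF Cm_val[OF l]])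
  fix D assume D: "m \<le> D"
  have "Cm (Suc D) (\<lambda>\<rho>. of_bool (sat {} (\<lambda>i. case_nat (\<lambda>\<rho>. \<rho> D) l i \<rho>) (\<lambda>_. F) \<phi>))"
    using D by (intro IH) (auto intro: Cm_reg Cm_mono[OF l] split: nat.split)
  moreover have "(\<lambda>i. case_nat (\<lambda>\<rho>. \<rho> D) l i \<rho>) = case_nat (\<rho> D) (\<lambda>i. l i \<rho>)" for \<rho>
    by (auto simp: fun_eq_iff split: nat.split)
  ultimately show "Cm (Suc D) (\<lambda>\<rho>. of_bool (sat {} (case_nat (\<rho> D) (\<lambda>i. l i \<rho>)) (\<lambda>_. F) \<phi>))" by simp
next
  show "depends_below m (\<lambda>\<rho> x. sat {} (case_nat x (\<lambda>i. l i \<rho>)) (\<lambda>_. F) \<phi>)"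
    unfolding depends_below_def
  proof (intro allI impI)
    fix \<rho> \<rho>' :: "nat \<Rightarrow> 'a" assume "\<forall>j<m. \<rho> j = \<rho>' j"
    then have "l i \<rho> = l i \<rho>'" for i using l[of i] unfolding Cm_def depends_below_def by blast
    then show "(\<lambda>x. sat {} (case_nat x (\<lambda>i. l i \<rho>)) (\<lambda>_. F) \<phi>) = (\<lambda>x. sat {} (case_nat x (\<lambda>i. l i \<rho>')) (\<lambda>_. F) \<phi>)"
      by simp
  qed
qed (rule D0_sat[OF \<phi>])

text \<open>\<open>l i\<close> supplies the value of variable i from the registers; under a
  quantifier the search register is put in front. The recursion is on formulas of the metatheory, so
  the program has standard length.\<close>

lemma Cm_sat: "\<phi> \<in> Delta00 \<Longrightarrow> (\<And>i. Cm m (l i)) \<Longrightarrow> Cm m (\<lambda>\<rho>. of_bool (sat {} (\<lambda>i. l i \<rho>) (\<lambda>_. F) \<phi>))"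
proof (induction arbitrary: m l rule: Delta00.induct)
  case (1 s t)
  then show ?case by (simp add: Cm_eq Cm_val)
next
  case (2 s t)
  then show ?case by (simp add: Cm_less Cm_val)
next
  case (3 t X)
  let ?t = "\<lambda>\<rho>. val (\<lambda>i. l i \<rho>) t"
  have t: "Cm m ?t" using 3 by (rule Cm_val)
  \<comment> \<open>The oracle returns values of f and does not decide its graph. Membership of a
    code is decided by searching for its first component, which is at most the code.\<close>
  have "Cm m (\<lambda>\<rho>. of_bool (\<exists>x<?t \<rho> + 1. ?t \<rho> = (x + f x) * (x + f x) + x))"
  proof (rule Cm_bex)
    show "Cm m (\<lambda>\<rho>. ?t \<rho> + 1)" by (intro Cm_add t Cm_const)
    show "Cm (Suc D) (\<lambda>\<rho>. of_bool (?t \<rho> = (\<rho> D + f (\<rho> D)) * (\<rho> D + f (\<rho> D)) + \<rho> D))" if "m \<le> D" for D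
      using that by (intro Cm_eq Cm_add Cm_mul Cm_oracle Cm_reg Cm_mono[OF t]) auto
    show "depends_below m (\<lambda>\<rho> x. ?t \<rho> = (x + f x) * (x + f x) + x)"
      unfolding depends_below_def
    proof (intro allI impI)
      fix \<rho> \<rho>' :: "nat \<Rightarrow> 'a" assume "\<forall>j<m. \<rho> j = \<rho>' j"
      then have "?t \<rho> = ?t \<rho>'" using t unfolding Cm_def depends_below_def by blast
      then show "(\<lambda>x. ?t \<rho> = (x + f x) * (x + f x) + x) = (\<lambda>x. ?t \<rho>' = (x + f x) * (x + f x) + x)"
        by simp
    qed
    fix \<rho>
    have "(?t \<rho> = (x + f x) * (x + f x) + x) \<longleftrightarrow> (\<exists>y\<le>?t \<rho>. ?t \<rho> = pr x y \<and> ?t \<rho> \<in> F)" for x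
      using le_pr2[of "f x" x] unfolding pr_def[symmetric] by auto
    moreover have "D0 S (\<lambda>e. \<exists>y\<le>?t \<rho>. ?t \<rho> = pr (e 0) y \<and> ?t \<rho> \<in> F)"
      using nonempty F_in by (intro D0_intros)
    ultimately show "D0 S (\<lambda>e. ?t \<rho> = (e 0 + f (e 0)) * (e 0 + f (e 0)) + e 0)" by simp
  qed
  moreover have "(\<exists>x<u + 1. u = (x + f x) * (x + f x) + x) \<longleftrightarrow> u \<in> F" for u
    unfolding F_graph less_Suc_iff pr_def[symmetric] using le_pr1 by blast
  ultimately show ?case by simp
next
  case 4
  then show ?case using Cm_const[of m 0] by simp
next
  case (5 \<phi> \<psi>)
  have "Cm m (\<lambda>\<rho>. of_bool (\<not> (sat {} (\<lambda>i. l i \<rho>) (\<lambda>_. F) \<phi> \<and> \<not> sat {} (\<lambda>i. l i \<rho>) (\<lambda>_. F) \<psi>)))"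
    by (intro Cm_not Cm_and 5)
  then show ?case by simp
next
  case (6 \<phi> t)
  have "Cm m (\<lambda>\<rho>. of_bool (sat {} (\<lambda>i. l i \<rho>) (\<lambda>_. F) (\<^bold>\<not> \<phi>)))" if "\<And>i. Cm m (l i)" for m l
    using Cm_not[OF 6(2)[OF that]] by simp
  from Cm_not[OF Cm_bex_sat[OF _ this 6(3), where t = t]] 6(1)
  show ?case by (simp add: Neg_def Delta00.intros One_nat_def)
next
  case (7 \<phi> t)
  from Cm_bex_sat[OF 7(1,2,3), where t = t] show ?case by (simp add: One_nat_def)
qed

text \<open>Number parameters become constants of the program; the only admissible set parameter is
  the graph of the oracle.\<close>

lemma Cm_D0:
  assumes "D0 {F} P" and l: "\<And>k. Cm m (l k)"
  shows "Cm m (\<lambda>\<rho>. of_bool (P (\<lambda>k. l k \<rho>)))"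
proof -
  obtain \<phi> s \<sigma> where \<phi>: "\<phi> \<in> Delta00" "range s \<subseteq> {F}" "\<And>e. P e \<longleftrightarrow> sat {} (penv \<sigma> e) s \<phi>"
    using assms(1) unfolding D0_def by blast
  have s: "s = (\<lambda>_. F)" using \<phi>(2) by (auto simp: fun_eq_iff)
  define l' where "l' i = (case \<sigma> i of Inl k \<Rightarrow> l k | Inr a \<Rightarrow> (\<lambda>_. a))" for i
  have "Cm m (l' i)" for i by (auto simp: l'_def l Cm_const split: sum.split)
  then have "Cm m (\<lambda>\<rho>. of_bool (sat {} (\<lambda>i. l' i \<rho>) (\<lambda>_. F) \<phi>))" by (rule Cm_sat[OF \<phi>(1)])
  moreover have "(\<lambda>i. l' i \<rho>) = penv \<sigma> (\<lambda>k. l k \<rho>)" for \<rho>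
    by (auto simp: fun_eq_iff l'_def penv_def split: sum.split)
  ultimately show ?thesis using \<phi>(3) unfolding s by simp
qed

end

lemma D0_rename3: "D0 A (\<lambda>e. R (e 2) (e 1) (e 0)) \<Longrightarrow> D0 A (\<lambda>e. R (e i) (e j) (e k))"
  using D0_rename[of A "\<lambda>e. R (e 2) (e 1) (e 0)" "case_nat k (case_nat j (\<lambda>_. i))"]
  by (simp add: numeral_2_eq_2)

section \<open>Uniformization of Sigma_1 relations\<close>

context sigma2_model
begin

text \<open>h z is the first component of the least code of a pair (b, w) with T z b w. As h is
  total, its graph and the complement are both Sigma_1, and Delta_1 comprehension applies.\<close>

lemma uniformization:
  assumes T: "D0 S (\<lambda>e. T (e 2) (e 1) (e 0))" and total: "\<And>z. \<exists>b w. T z b w"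
  shows "\<exists>h. {pr z (h z) | z. True} \<in> S \<and> (\<forall>z. \<exists>w. T z (h z) w)"
proof -
  define Q where "Q z q \<longleftrightarrow> (\<exists>b\<le>q. \<exists>w\<le>q. q = pr b w \<and> T z b w)" for z q
  define L where "L z q \<longleftrightarrow> Q z q \<and> (\<forall>q'<q. \<not> Q z q')" for z q
  have Q_D0: "D0 S (\<lambda>e. Q (e i) (e j))" for i j
    unfolding Q_def using nonempty by (intro D0_intros D0_rename3[OF T])
  have L_D0: "D0 S (\<lambda>e. L (e i) (e j))" for i j
    unfolding L_def by (intro D0_intros Q_D0)
  have ex_L: "\<exists>q. L z q" for z
  proof -
    obtain b w where "T z b w" using total by blast
    then have "Q z (pr b w)" unfolding Q_def using le_pr1 le_pr2 by blast
    moreover have "D0 S (\<lambda>e. Q z (e 0))" using D0_subst2[where R = Q, OF Q_D0, of "\<lambda>_. z" "\<lambda>e. e 0"] by (simp add: Tm_const Tm_var)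
    ultimately show ?thesis using D0_least[of "Q z"] unfolding L_def by blast
  qed
  have L_unique: "q = q'" if "L z q" "L z q'" for z q q'
    using that unfolding L_def by (metis linorder_neqE)
  have L_pr: "\<exists>b w. q = pr b w \<and> T z b w" if "L z q" for z q
    using that unfolding L_def Q_def by blast
  have "\<forall>z. \<exists>b. \<exists>q w. L z q \<and> q = pr b w" using ex_L L_pr by metis
  then obtain h where h: "\<And>z. \<exists>q w. L z q \<and> q = pr (h z) w" by metis
  have h_iff: "(\<exists>q w. L z q \<and> q = pr b w) \<longleftrightarrow> b = h z" for z b
    using h[of z] L_unique pr_inj by metis
  have "S1 S (\<lambda>e. \<exists>z b. e 0 = pr z b \<and> (\<exists>q w. L z q \<and> q = pr b w))"
    using nonempty by (intro S1_ex S1_and S1_D0 D0_intros L_D0)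
  \<comment> \<open>The complement of the graph: no code of a pair at all, or a pair whose second
    component differs from the value c selected for z.\<close>
  moreover have "S1 S (\<lambda>e. (\<forall>z\<le>e 0. \<forall>b\<le>e 0. e 0 \<noteq> pr z b) \<or>
      (\<exists>z b c. (e 0 = pr z b \<and> b \<noteq> c) \<and> (\<exists>q w. L z q \<and> q = pr c w)))"
    using nonempty by (intro S1_or S1_ex S1_and S1_D0 D0_intros L_D0)
  moreover have "((\<forall>z\<le>p. \<forall>b\<le>p. p \<noteq> pr z b) \<or> (\<exists>z b c. (p = pr z b \<and> b \<noteq> c) \<and> (\<exists>q w. L z q \<and> q = pr c w)))
      \<longleftrightarrow> \<not> (\<exists>z b. p = pr z b \<and> (\<exists>q w. L z q \<and> q = pr b w))" for p
  proof (cases "\<exists>z b. p = pr z b")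
    case True
    then obtain z b where p: "p = pr z b" by blast
    then have "\<not> (\<forall>z\<le>p. \<forall>b\<le>p. p \<noteq> pr z b)" using le_pr1 le_pr2 by blast
    then show ?thesis unfolding p h_iff pr_inj by blast
  next
    case False
    then show ?thesis by blast
  qed
  ultimately have "{p. \<exists>z b. p = pr z b \<and> (\<exists>q w. L z q \<and> q = pr b w)} \<in> S"
    by (intro comprehension_S) simp_all
  then have "{pr z (h z) | z. True} \<in> S" unfolding h_iff by simp
  moreover have "\<exists>w. T z (h z) w" for z
    using h[of z] L_pr pr_inj by metis
  ultimately show ?thesis by blast
qed

end

section \<open>Search and the s-m-n argument\<close>

context machine_model
begin

lemma computes_weaken:
  assumes "computes F D A g" "\<And>\<rho>. B \<rho> \<Longrightarrow> A \<rho>"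
  shows "computes F D B g"
proof (rule computesI)
  show "depends_below D g" using assms(1) by (rule computes_dep)
  fix p
  obtain C N where C: "\<And>e n \<rho>. prog_at e p C \<Longrightarrow> N \<le> n \<Longrightarrow> A \<rho> \<Longrightarrow>
     \<exists>\<rho>'. runs F e n p \<rho> (p + length C) \<rho>' \<and> (\<forall>j<D. \<rho>' j = \<rho> j) \<and> \<rho>' D = g \<rho>"
    using computesE[OF assms(1)] by metis
  show "\<exists>C N. \<forall>e n \<rho>. prog_at e p C \<longrightarrow> N \<le> n \<longrightarrow> B \<rho> \<longrightarrow>
     (\<exists>\<rho>'. runs F e n p \<rho> (p + length C) \<rho>' \<and> (\<forall>j<D. \<rho>' j = \<rho> j) \<and> \<rho>' D = g \<rho>)"
    by (intro exI[of _ C] exI[of _ N] allI impI C assms(2))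
qed

lemma computes_total_mu:
  assumes "Cm (Suc D) (\<lambda>\<rho>. of_bool (P \<rho> (\<rho> D)))" "depends_below D P"
  shows "computes F D (\<lambda>\<rho>. \<exists>m. P \<rho> m \<and> (\<forall>x<m. \<not> P \<rho> x)) (\<lambda>\<rho>. THE m. P \<rho> m \<and> (\<forall>x<m. \<not> P \<rho> x))"
proof -
  have "is_mu (\<lambda>x. of_bool (\<not> P \<rho> x)) m \<longleftrightarrow> P \<rho> m \<and> (\<forall>x<m. \<not> P \<rho> x)" for \<rho> m
    by (simp add: is_mu_def)
  moreover have "computes F (Suc D) (\<lambda>_. True) (\<lambda>\<rho>. of_bool (\<not> P \<rho> (\<rho> D)))"
    using Cm_not[OF assms(1)] unfolding Cm_def by blast
  moreover have "depends_below D (\<lambda>\<rho> x. of_bool (\<not> P \<rho> x) :: 'a)"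
    using assms(2) unfolding depends_below_def by metis
  ultimately show ?thesis using computes_mu[of D "\<lambda>\<rho> x. of_bool (\<not> P \<rho> x)"] by simp
qed

lemma the_least: "P (m :: 'a) \<Longrightarrow> \<forall>x<m. \<not> P x \<Longrightarrow> (THE m. P m \<and> (\<forall>x<m. \<not> P x)) = m"
  by (rule the_equality) (auto intro: linorder_neqE)

text \<open>
  First search for a bound \<open>z\<close> on a solution \<open>u, w\<close>, then for the least \<open>u\<close> below it: the register
  \<open>1\<close> holds the parameter \<open>v\<close>.
\<close>

lemma computes_search:
  assumes \<theta>: "D0 {F} (\<lambda>e. \<theta> (e 2) (e 1) (e 0))"
  shows "\<exists>g. computes F 2 (\<lambda>\<rho>. \<exists>u w. \<theta> (\<rho> 1) u w) g \<and>
    (\<forall>\<rho>. (\<exists>u w. \<theta> (\<rho> 1) u w) \<longrightarrow> (\<exists>w. \<theta> (\<rho> 1) (g \<rho>) w))"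
proof -
  define Q where "Q v z \<longleftrightarrow> (\<exists>u\<le>z. \<exists>w\<le>z. \<theta> v u w)" for v z
  \<comment> \<open>The second disjunct makes this search end even if z bounds no solution. That
    matters because \<open>computes_let\<close> requires its second function to be computed
    unconditionally.\<close>
  define T where "T v z u \<longleftrightarrow> (\<exists>w\<le>z. \<theta> v u w) \<or> \<not> u \<le> z" for v z u
  define q where "q \<rho> = (THE m. Q (\<rho> 1) m \<and> (\<forall>x<m. \<not> Q (\<rho> 1) x))" for \<rho> :: "nat \<Rightarrow> 'a"
  define t where "t \<rho> = (THE m. T (\<rho> 1) (\<rho> 2) m \<and> (\<forall>x<m. \<not> T (\<rho> 1) (\<rho> 2) x))" for \<rho> :: "nat \<Rightarrow> 'a"
  have Q_D0: "D0 {F} (\<lambda>e. Q (e i) (e j))" for i j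
    unfolding Q_def by (intro D0_intros D0_rename3[OF \<theta>])
  have T_D0: "D0 {F} (\<lambda>e. T (e i) (e j) (e k))" for i j k
    unfolding T_def by (intro D0_intros D0_rename3[OF \<theta>]) simp
  have sub: "{F} \<subseteq> S" using F_in by simp
  have Q_least: "\<exists>m. Q v m \<and> (\<forall>x<m. \<not> Q v x)" if "\<theta> v u w" for v u w
  proof -
    have "Q v (max u w)" using that unfolding Q_def by (metis max.cobounded1 max.cobounded2)
    moreover have "D0 S (\<lambda>e. Q v (e 0))"
      using D0_subst2[where R = Q, OF D0_mono[OF Q_D0 sub], of "\<lambda>_. v" "\<lambda>e. e 0"] by (simp add: Tm_const Tm_var)
    ultimately show ?thesis using D0_least[of "Q v"] by blast
  qed
  have T_least: "\<exists>m. T v z m \<and> (\<forall>x<m. \<not> T v z x)" for v z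
  proof -
    have "T v z (z + 1)" unfolding T_def by (simp add: not_le)
    moreover have "D0 S (\<lambda>e. T v z (e 0))"
      using D0_subst3[where R = T, OF D0_mono[OF T_D0 sub], of "\<lambda>_. v" "\<lambda>_. z" "\<lambda>e. e 0"] by (simp add: Tm_const Tm_var)
    ultimately show ?thesis using D0_least[of "T v z"] by blast
  qed
  have "Cm 3 (\<lambda>\<rho>. of_bool (Q (\<rho> 1) (\<rho> 2)))"
  proof -
    have "Cm 3 (case_nat (\<lambda>\<rho>. \<rho> 1) (\<lambda>_ \<rho>. \<rho> 2) k)" for k
      by (cases k) (auto intro: Cm_reg)
    from Cm_D0[where l = "case_nat (\<lambda>\<rho>. \<rho> 1) (\<lambda>_ \<rho>. \<rho> 2)", OF Q_D0[of 0 1] this] show ?thesis by simp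
  qed
  then have 1: "computes F 2 (\<lambda>\<rho>. \<exists>m. Q (\<rho> 1) m \<and> (\<forall>x<m. \<not> Q (\<rho> 1) x)) q"
    unfolding q_def by (intro computes_total_mu) (auto simp: depends_below_def numeral_2_eq_2 numeral_3_eq_3 One_nat_def)
  have "Cm 4 (\<lambda>\<rho>. of_bool (T (\<rho> 1) (\<rho> 2) (\<rho> 3)))"
  proof -
    have "Cm 4 (case_nat (\<lambda>\<rho>. \<rho> 1) (case_nat (\<lambda>\<rho>. \<rho> 2) (\<lambda>_ \<rho>. \<rho> 3)) k)" for k
      by (auto intro: Cm_reg split: nat.split)
    from Cm_D0[where l = "case_nat (\<lambda>\<rho>. \<rho> 1) (case_nat (\<lambda>\<rho>. \<rho> 2) (\<lambda>_ \<rho>. \<rho> 3))",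
        OF T_D0[of 0 1 2] this]
    show ?thesis by simp
  qed
  then have "computes F 3 (\<lambda>\<rho>. \<exists>m. T (\<rho> 1) (\<rho> 2) m \<and> (\<forall>x<m. \<not> T (\<rho> 1) (\<rho> 2) x)) t"
    unfolding t_def by (intro computes_total_mu) (auto simp: depends_below_def eval_nat_numeral One_nat_def)
  moreover have "(\<lambda>\<rho> :: nat \<Rightarrow> 'a. \<exists>m. T (\<rho> 1) (\<rho> 2) m \<and> (\<forall>x<m. \<not> T (\<rho> 1) (\<rho> 2) x)) = (\<lambda>_. True)"
    using T_least by (intro ext) simp
  ultimately have 2: "computes F (Suc 2) (\<lambda>_. True) t" by simp
  have "computes F 2 (\<lambda>\<rho>. \<exists>u w. \<theta> (\<rho> 1) u w) (\<lambda>\<rho>. t (\<rho>(2 := q \<rho>)))"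
    by (rule computes_weaken[OF computes_let[OF 1 2]]) (use Q_least in blast)
  moreover have "\<exists>w. \<theta> (\<rho> 1) (t (\<rho>(2 := q \<rho>))) w" if uw: "\<theta> (\<rho> 1) u w" for \<rho> u w
  proof -
    obtain z where z: "Q (\<rho> 1) z" "\<forall>x<z. \<not> Q (\<rho> 1) x" using Q_least[OF uw] by blast
    have qz: "q \<rho> = z" unfolding q_def using z by (rule the_least)
    obtain y where y: "T (\<rho> 1) z y" "\<forall>x<y. \<not> T (\<rho> 1) z x" using T_least by blast
    have "t (\<rho>(2 := z)) = y"
      unfolding t_def using the_least[of "T (\<rho> 1) z", OF y] by simp
    moreover have "y \<le> z"
    proof (rule ccontr)
      assume "\<not> y \<le> z"
      obtain u where "u \<le> z" "T (\<rho> 1) z u" using z(1) unfolding Q_def T_def by blast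
      then show False using y(2) \<open>\<not> y \<le> z\<close> by (meson le_less_trans not_le)
    qed
    ultimately show ?thesis using y(1) qz unfolding T_def by auto
  qed
  ultimately show ?thesis by blast
qed

text \<open>\<open>Pg e v\<close> says that e codes a fixed list of instructions preceded by one
  that loads v into register 1; it is a relation because sequences have many codes. The program
  outputs some solution for v, which need not be the given u.\<close>

lemma smn:
  assumes \<theta>: "D0 {F} (\<lambda>e. \<theta> (e 2) (e 1) (e 0))"
  obtains Pg where "D0 S (\<lambda>e. Pg (e 1) (e 0))" "\<And>v. \<exists>e. Pg e v"
    "\<And>e v u w x. Pg e v \<Longrightarrow> \<theta> v u w \<Longrightarrow> \<exists>u w. \<theta> v u w \<and> phi F e x u"
proof -
  obtain g where g: "computes F 2 (\<lambda>\<rho>. \<exists>u w. \<theta> (\<rho> 1) u w) g"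
    "\<And>\<rho> u w. \<theta> (\<rho> 1) u w \<Longrightarrow> \<exists>w. \<theta> (\<rho> 1) (g \<rho>) w"
    using computes_search[OF \<theta>] by blast
  obtain C N where C: "\<And>e n \<rho>. prog_at e (Suc 0) C \<Longrightarrow> N \<le> n \<Longrightarrow> \<exists>u w. \<theta> (\<rho> 1) u w \<Longrightarrow>
     \<exists>\<rho>'. runs F e n (Suc 0) \<rho> (Suc 0 + length C) \<rho>' \<and> (\<forall>j<2. \<rho>' j = \<rho> j) \<and> \<rho>' 2 = g \<rho>"
    using computesE[OF g(1)] by metis
  \<comment> \<open>The result is in register 2; adding the 0 in register 3 moves it to the output
    register 0.\<close>
  define E where "E = C @ [(0, of_nat 3, 0, 0), (1, of_nat 0, of_nat 2, of_nat 3)]"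
  define l where "l = Suc (length E)"
  define Pg where "Pg e v \<longleftrightarrow> len e (of_nat l) \<and> prog_at e 0 ((0, of_nat 1, v, 0) # E)" for e v
  show thesis
  proof (rule that[of Pg])
    show "D0 S (\<lambda>e. Pg (e 1) (e 0))"
      unfolding Pg_def prog_at_Cons unfolding prog_at_def enc.simps fst_conv snd_conv using nonempty
      by (intro D0_intros D0_finite_all)
  next
    fix v
    obtain e where e: "regs l e (\<lambda>i. enc (((0, of_nat 1, v, 0) # E) ! i))" using regs_exists by blast
    then have "Pg e v" unfolding Pg_def regs_def prog_at_def l_def by simp
    then show "\<exists>e. Pg e v" ..
  next
    fix e v u w x
    assume Pg: "Pg e v" and uw: "\<theta> v u w"
    define n where "n = max N 4"
    have P: "entry e (of_nat 0) (ins 0 (of_nat 1) v 0)" "prog_at e (Suc 0) C"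
      "entry e (of_nat (Suc 0 + length C)) (ins 0 (of_nat 3) 0 0)"
      "entry e (of_nat (Suc (Suc 0 + length C))) (ins 1 (of_nat 0) (of_nat 2) (of_nat 3))"
      using Pg unfolding Pg_def E_def by simp_all
    have "phi F e x (g ((\<lambda>_. 0)(0 := x, 1 := v)))"
    proof -
      define \<rho>0 where "\<rho>0 = (\<lambda>_ :: nat. 0 :: 'a)(0 := x)"
      define \<rho>1 where "\<rho>1 = \<rho>0(1 := v)"
      obtain r0 where r0: "regs n r0 \<rho>0" using regs_exists by blast
      have n: "0 < n" "1 < n" "2 < n" "3 < n" "N \<le> n" by (auto simp: n_def)
      have run1: "runs F e n 0 \<rho>0 (Suc 0) \<rho>1"
        unfolding \<rho>1_def by (rule runs_const[where c = 0]) (use P n in auto)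
      have "\<exists>u w. \<theta> (\<rho>1 1) u w" using uw by (auto simp: \<rho>1_def)
      from C[where \<rho> = \<rho>1, OF P(2) n(5) this] obtain \<rho>2 where \<rho>2: "runs F e n (Suc 0) \<rho>1 (Suc 0 + length C) \<rho>2" "\<rho>2 2 = g \<rho>1"
        by blast
      have run3: "runs F e n (Suc 0 + length C) \<rho>2 (Suc (Suc 0 + length C)) (\<rho>2(3 := 0))"
        by (rule runs_const[OF P(3) n(4)])
      have run4: "runs F e n (Suc (Suc 0 + length C)) (\<rho>2(3 := 0)) (Suc (Suc (Suc 0 + length C)))
          (\<rho>2(3 := 0, 0 := (\<rho>2(3 := 0)) 2 + (\<rho>2(3 := 0)) 3))"
        by (rule runs_add[OF P(4) n(1,3,4)])
      have "runs F e n 0 \<rho>0 l (\<rho>2(3 := 0, 0 := g \<rho>1))"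
        using runs_trans[OF run1 runs_trans[OF \<rho>2(1) runs_trans[OF run3 run4]]] \<rho>2(2)
        by (simp add: l_def E_def)
      then obtain r1 where r1: "regs n r1 (\<rho>2(3 := 0, 0 := g \<rho>1))" "reach F e (conf 0 r0) (conf l r1)"
        using r0 unfolding runs_def by blast
      have "initial (conf 0 r0) x"
        unfolding initial_def conf_def
      proof (intro exI[of _ r0] conjI allI impI)
        show "entry r0 0 x" using regs_entry[OF r0 n(1)] by (simp add: \<rho>0_def)
        fix i y assume iy: "entry r0 i y"
        then have "i < of_nat n" using r0 entry_less_len unfolding regs_def by blast
        then obtain j where j: "j < n" "i = of_nat j" using less_of_natD by blast
        then have "y = \<rho>0 j" using iy regs_entry[OF r0] entry_unique by blast
        then show "i = 0 \<or> y = 0" using j by (auto simp: \<rho>0_def)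
      qed simp
      moreover have "final e (conf l r1) (g \<rho>1)"
        unfolding final_def conf_def using regs_entry[OF r1(1) n(1)] Pg unfolding Pg_def by fastforce
      ultimately show ?thesis using phi_reach r1(2) unfolding \<rho>1_def \<rho>0_def by blast
    qed
    moreover have "\<exists>w. \<theta> v (g ((\<lambda>_. 0)(0 := x, 1 := v))) w"
      using g(2)[of "(\<lambda>_. 0)(0 := x, 1 := v)"] uw by auto
    ultimately show "\<exists>u w. \<theta> v u w \<and> phi F e x u" by blast
  qed
qed

end

section \<open>From bounded to two-valued functions\<close>

lemma le_sum4:
  fixes s e u c :: "'a::pam"
  shows "s \<le> s + e + u + c" "e \<le> s + e + u + c" "u \<le> s + e + u + c" "c \<le> s + e + u + c"
proof -
  have 1: "s + e + u + c = e + (s + u + c)" by (simp add: ac_simps)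
  show "e \<le> s + e + u + c" unfolding 1 by simp
  have 2: "s + e + u + c = u + (s + e + c)" by (simp add: ac_simps)
  show "u \<le> s + e + u + c" unfolding 2 by simp
  show "s \<le> s + e + u + c" by (simp add: add.assoc)
  show "c \<le> s + e + u + c" by simp
qed

context machine_model
begin

lemma two_valued_DNR:
  assumes G: "{pr x (g x) | x. True} \<in> S" (is "?G \<in> S") and bound: "\<And>x. g x < k"
    and dnr: "\<And>x. \<not> phi F x x (g x)"
  shows "\<exists>h. {pr x (h x) | x. True} \<in> S \<and> (\<forall>x. h x < 2) \<and> (\<forall>x. \<not> phi F x x (h x))"
proof -
  have G_iff: "pr x y \<in> ?G \<longleftrightarrow> y = g x" for x y by auto
  \<comment> \<open>By stage c, the program at place i of s has output component i of the vector for
    u.\<close>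
  define hit where "hit s u c i \<longleftrightarrow> (\<exists>x\<le>s. entry s i x \<and>
      (i = u \<and> phi_below F c x x 1 \<or> i \<noteq> u \<and> phi_below F c x x 0))" for s u c i
  have hit_D0: "D0 A (\<lambda>e. hit (e i) (e j) (e l) (e m))" if "F \<in> A" for A i j l m
    unfolding hit_def using that by (intro D0_intros) auto
  have hit_phi: "\<exists>x. entry s i x \<and> phi F x x (of_bool (i = u))" if "hit s u c i" for s u c i
    using that unfolding hit_def by (cases "i = u") (auto simp: phi_iff_below)
  have hit_mono: "hit s u d i" if "hit s u c i" "c \<le> d" for s u c d i
    using that(1) phi_below_mono[OF _ that(2)] unfolding hit_def by meson
  define \<theta> where "\<theta> s u c \<longleftrightarrow> u < k \<and> (\<forall>i<k. hit s u c i)" for s u c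
  have \<theta>_unique: "u = u'" if "\<theta> s u c" "\<theta> s u' c'" for s u c u' c'
  \<comment> \<open>At place u the program from s would have output 1 on account of u and 0 on
    account of u'.\<close>
  proof (rule ccontr)
    assume "u \<noteq> u'"
    have u: "u < k" "hit s u c u" "hit s u' c' u" using that unfolding \<theta>_def by auto
    obtain x where x: "entry s u x" "phi F x x 1" using hit_phi[OF u(2)] by auto
    obtain y where y: "entry s u y" "phi F y y 0" using hit_phi[OF u(3)] \<open>u \<noteq> u'\<close> by auto
    have "x = y" using x y entry_unique by blast
    have "(1 :: 'a) = 0"
      by (rule phi_unique[OF F_in _ x(2)]) (use y(2) \<open>x = y\<close> in simp_all)
    then show False by simp
  qed
  have \<theta>_D0: "D0 {F} (\<lambda>e. \<theta> (e 2) (e 1) (e 0))"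
    unfolding \<theta>_def by (intro D0_intros hit_D0) auto
  obtain Pg where Pg: "D0 S (\<lambda>e. Pg (e 1) (e 0))" "\<And>v. \<exists>e. Pg e v"
    "\<And>e v u w x. Pg e v \<Longrightarrow> \<theta> v u w \<Longrightarrow> \<exists>u w. \<theta> v u w \<and> phi F e x u"
    by (rule smn[OF \<theta>_D0]) (rule that)
  define agree where "agree j a s \<longleftrightarrow> (\<forall>i<j. \<exists>x\<le>a. entry a i x \<and> entry s i x)" for j a s :: 'a
  \<comment> \<open>u is g(e), named through its graph so that the predicate stays bounded. The
    stage c is common to all places from j on.\<close>
  define tail where "tail j s e u c \<longleftrightarrow> len s k \<and> Pg e s \<and> pr e u \<in> ?G \<and> (\<forall>i<k. j \<le> i \<longrightarrow> hit s u c i)" for j s e u c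
  have agree_D0: "D0 S (\<lambda>e. agree (e i) (e j) (e l))" for i j l
    unfolding agree_def using nonempty by (intro D0_intros)
  have tail_D0: "D0 S (\<lambda>e. tail (e i) (e j) (e l) (e m) (e n))" for i j l m n
    unfolding tail_def using nonempty F_in G by (intro D0_intros D0_rename2[OF Pg(1)] hit_D0)
  \<comment> \<open>The single bound m replaces a block of four quantifiers. The conjunct
    \<open>j \<le> k\<close> makes R fail at k + 1, so induction over all j suffices to find the
    place where it breaks down.\<close>
  define R where "R j a m \<longleftrightarrow> len a k \<and> j \<le> k \<and>
      \<not> (\<exists>s\<le>m. \<exists>e\<le>m. \<exists>u\<le>m. \<exists>c\<le>m. agree j a s \<and> tail j s e u c)" for j a m
  have R_iff: "(\<forall>m. R j a m) \<longleftrightarrow> len a k \<and> j \<le> k \<and> \<not> (\<exists>s e u c. agree j a s \<and> tail j s e u c)" for j a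
  proof -
    have "R j a (s + e + u + c) \<Longrightarrow> \<not> (agree j a s \<and> tail j s e u c)" for s e u c
    proof -
      have "s \<le> s + e + u + c" "e \<le> s + e + u + c" "u \<le> s + e + u + c" "c \<le> s + e + u + c"
        by (rule le_sum4)+
      then show "R j a (s + e + u + c) \<Longrightarrow> \<not> (agree j a s \<and> tail j s e u c)" unfolding R_def by blast
    qed
    moreover have "R j a 0 \<Longrightarrow> len a k \<and> j \<le> k" by (simp add: R_def)
    moreover have "R j a m" if "len a k" "j \<le> k" "\<not> (\<exists>s e u c. agree j a s \<and> tail j s e u c)" for m
      using that unfolding R_def by blast
    ultimately show ?thesis by blast
  qed
  have "\<exists>j. (\<exists>a. \<forall>m. R j a m) \<and> \<not> (\<exists>a. \<forall>m. R (j + 1) a m)"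
  proof (rule ccontr)
    assume *: "\<not> ?thesis"
    have "\<exists>a. \<forall>m. R j a m" for j
    proof (rule S2_induct[where R = R])
      show "D0 S (\<lambda>e. R (e 2) (e 1) (e 0))"
        unfolding R_def using nonempty by (intro D0_intros agree_D0 tail_D0)
      show "\<exists>a. \<forall>m. R 0 a m"
      proof -
        obtain a where a: "len a k" unfolding len_def by blast
        have False if "tail 0 s e u c" for s e u c
        proof -
          \<comment> \<open>Hits at all places make g(e) a solution for s, and by uniqueness it is
            the one that program e outputs on its own code. This contradicts the choice of
            g.\<close>
          have "\<theta> s u c" "Pg e s" "u = g e"
            using that bound unfolding tail_def \<theta>_def G_iff by auto
          then show False using Pg(3) \<theta>_unique dnr by metis
        qed
        then show ?thesis unfolding R_iff using a by (metis zero_le')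
      qed
    qed (use * in blast)
    then obtain a where "\<forall>m. R (k + 1) a m" by blast
    then have "k + 1 \<le> k" unfolding R_iff by blast
    then show False using less_Suc_self[of k] by simp
  qed
  then obtain j a where a: "\<forall>m. R j a m" and next_j: "\<not> (\<exists>a. \<forall>m. R (j + 1) a m)" by blast
  have len_a: "len a k" and no_tail: "\<And>s e u c. agree j a s \<Longrightarrow> \<not> tail j s e u c"
    using a unfolding R_iff by blast+
  \<comment> \<open>At j = k no place is left to be hit, so a itself, any program for it and stage 0
    already contradict \<open>no_tail\<close>.\<close>
  have "j < k"
  proof (rule ccontr)
    assume "\<not> j < k"
    then have "k \<le> j" by simp
    moreover have "j \<le> k" using a unfolding R_iff by blast
    ultimately have "j = k" by simp
    obtain e where "Pg e a" using Pg(2) by blast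
    then have "tail j a e (g e) 0" unfolding tail_def \<open>j = k\<close> using len_a by auto
    moreover have "agree j a a"
      unfolding agree_def \<open>j = k\<close> using entry_exists[OF len_a] entry_le(2) by blast
    ultimately show False using no_tail by blast
  qed
  \<comment> \<open>w bounds the search for s, e, u and c, which leaves one witness besides the
    value b, as \<open>uniformization\<close> expects.\<close>
  define T where "T z b w \<longleftrightarrow> (\<exists>s\<le>w. \<exists>e\<le>w. \<exists>u\<le>w. \<exists>c\<le>w. agree j a s \<and> entry s j z \<and> tail (j + 1) s e u c \<and>
      (j = u \<and> b = 1 \<or> j \<noteq> u \<and> b = 0))" for z b w :: 'a
  have "D0 S (\<lambda>e. T (e 2) (e 1) (e 0))"
    unfolding T_def using nonempty
    by (intro D0_intros D0_subst3[where R = agree, OF agree_D0] D0_subst5[where R = tail, OF tail_D0])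
  moreover have "\<exists>b w. T z b w" for z
  proof -
    \<comment> \<open>The entries of a with place j overwritten by z. As R fails at j + 1 for every
      sequence of length k, it fails for this one.\<close>
    define Q where "Q i x \<longleftrightarrow> i = j \<and> x = z \<or> i \<noteq> j \<and> entry a i x" for i x :: 'a
    have "D0 S (\<lambda>e. Q (e 1) (e 0))" unfolding Q_def using nonempty by (intro D0_intros)
    moreover have "\<exists>x. Q i x" if "i < k" for i
      using entry_exists[OF len_a that] unfolding Q_def by blast
    ultimately obtain a' where a': "len a' k" "\<And>i. i < k \<Longrightarrow> \<exists>x. entry a' i x \<and> Q i x"
      using sequence_exists[of Q k] by blast
    have "j + 1 \<le> k" using \<open>j < k\<close> by (rule less_imp_Suc_le)
    then obtain s e u c where s: "agree (j + 1) a' s" "tail (j + 1) s e u c"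
      using next_j a'(1) unfolding R_iff by blast
    have "entry s j z"
      using s(1) a'(2)[OF \<open>j < k\<close>] less_Suc_self[of j] entry_unique unfolding agree_def Q_def by metis
    moreover have "agree j a s"
      unfolding agree_def
    proof (intro allI impI)
      fix i assume "i < j"
      then have "i < j + 1" "i < k" "i \<noteq> j" using \<open>j < k\<close> less_Suc_self by (auto intro: order.strict_trans)
      then obtain x where "entry a i x" "entry s i x"
        using s(1) a'(2)[of i] entry_unique unfolding agree_def Q_def by metis
      then show "\<exists>x\<le>a. entry a i x \<and> entry s i x" using entry_le(2) by blast
    qed
    moreover have "s \<le> s + e + u + c" "e \<le> s + e + u + c" "u \<le> s + e + u + c" "c \<le> s + e + u + c"
      by (rule le_sum4)+
    moreover have "j = u \<and> of_bool (j = u) = (1 :: 'a) \<or> j \<noteq> u \<and> of_bool (j = u) = (0 :: 'a)" by simp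
    ultimately have "T z (of_bool (j = u)) (s + e + u + c)"
      unfolding T_def using s(2) by blast
    then show ?thesis by blast
  qed
  ultimately obtain h where h: "{pr z (h z) | z. True} \<in> S" "\<And>z. \<exists>w. T z (h z) w"
    using uniformization by blast
  have "h z < 2" for z
    using h(2)[of z] unfolding T_def by auto
  moreover have "\<not> phi F z z (h z)" for z
  proof
    assume "phi F z z (h z)"
    then obtain d where d: "phi_below F d z z (h z)" unfolding phi_iff_below by blast
    obtain s e u c where s: "agree j a s" "entry s j z" "tail (j + 1) s e u c" "j = u \<and> h z = 1 \<or> j \<noteq> u \<and> h z = 0"
      using h(2)[of z] unfolding T_def by blast
    \<comment> \<open>If z did output h z on input z, place j would be hit too. Raising the stage to
      \<open>max c d\<close> covers this computation and the old ones, which contradicts the choice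
      of a.\<close>
    have "hit s u (max c d) i" if "i < k" "j \<le> i" for i
    proof (cases "i = j")
      case True
      have "phi_below F (max c d) z z (h z)" using d by (rule phi_below_mono) simp
      then show ?thesis using s(2,4) entry_le(2) True unfolding hit_def by metis
    next
      case False
      then have "j + 1 \<le> i" using that by (intro less_imp_Suc_le) simp
      then have "hit s u c i" using s(3) that unfolding tail_def by blast
      then show ?thesis by (rule hit_mono) simp
    qed
    then have "tail j s e u (max c d)" using s(3) unfolding tail_def by blast
    then show False using no_tail s(1) by blast
  qed
  ultimately show ?thesis using h(1) by blast
qed

end

section \<open>Meaning of the theory and of the goal in a model\<close>

lemma sat_IsFun: "sat S e s (IsFun X) \<longleftrightarrow> (\<exists>f. s X = {pr x (f x) | x. True})"
proof -
  have *: "sat S e s (IsFun X) \<longleftrightarrow> (\<forall>p. p \<in> s X \<longrightarrow> (\<exists>x y. p = pr x y)) \<and> (\<forall>x. \<exists>y. pr x y \<in> s X) \<and>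
      (\<forall>x y z. pr x y \<in> s X \<and> pr x z \<in> s X \<longrightarrow> y = z)"
    by (simp add: IsFun_def One_nat_def numeral_2_eq_2)
  show ?thesis
  proof
    assume "sat S e s (IsFun X)"
    then obtain f where f: "\<And>x. pr x (f x) \<in> s X" and u: "\<And>x y z. pr x y \<in> s X \<Longrightarrow> pr x z \<in> s X \<Longrightarrow> y = z"
      and p: "\<And>p. p \<in> s X \<Longrightarrow> \<exists>x y. p = pr x y" unfolding * by metis
    have "s X = {pr x (f x) | x. True}" using f u p by blast
    then show "\<exists>f. s X = {pr x (f x) | x. True}" by blast
  qed (auto simp: *)
qed

lemma sat_DNR:
  "sat S e s (DNR t X) \<longleftrightarrow> (\<exists>g. {pr x (g x) | x. True} \<in> S \<and> (\<forall>x. g x < val e t) \<and>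
     (\<forall>x. \<not> phi (s X) x x (g x)))"
proof -
  have "sat S e s (DNR t X) \<longleftrightarrow> (\<exists>Y\<in>S. (\<exists>g. Y = {pr x (g x) | x. True}) \<and>
      (\<forall>x y. pr x y \<in> Y \<longrightarrow> y < val e t) \<and> (\<forall>x y. pr x y \<in> Y \<longrightarrow> \<not> phi (s X) x x y))"
    by (simp add: DNR_def sat_IsFun Bounded_def DiagNonRec_def One_nat_def)
  also have "\<dots> \<longleftrightarrow> (\<exists>g. {pr x (g x) | x. True} \<in> S \<and> (\<forall>x. g x < val e t) \<and> (\<forall>x. \<not> phi (s X) x x (g x)))"
    (is "?L \<longleftrightarrow> ?R")
  proof
    assume ?R
    then obtain g where "{pr x (g x) | x. True} \<in> S" "\<And>x. g x < val e t" "\<And>x. \<not> phi (s X) x x (g x)" by blast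
    then show ?L by (intro bexI[of _ "{pr x (g x) | x. True}"]) auto
  qed auto
  finally show ?thesis .
qed

lemma sigma2_model_theory:
  fixes s :: "nat \<Rightarrow> 'a::pam set"
  assumes s: "range s \<subseteq> S" and T: "\<forall>\<phi>\<in>theory_2p7. sat S e s \<phi>"
  shows "sigma2_model S"
proof
  show "S \<noteq> {}" using s by blast
  have "\<forall>\<phi>\<in>I_Sigma0 1. sat S e s \<phi>" "\<forall>\<phi>\<in>I_Sigma0 2. sat S e s \<phi>" "\<forall>\<phi>\<in>Delta01_CA. sat S e s \<phi>"
    using T unfolding theory_2p7_def RCA0_def by blast+
  note 1 = this[unfolded I_Sigma0_def Delta01_CA_def sat_universal_closures[OF s]]
  fix \<phi> \<psi> e and s :: "nat \<Rightarrow> 'a set" assume "range s \<subseteq> S"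
  note range_s = this
  show "sat S e s (induction \<phi>)" if "\<phi> \<in> Sigma0 1"
    by (rule 1(1)[rule_format, OF imageI[OF that] range_s])
  show "sat S e s (induction \<phi>)" if "\<phi> \<in> Sigma0 2"
    by (rule 1(2)[rule_format, OF imageI[OF that] range_s])
  show "sat S e s (comprehension \<phi> \<psi>)" if "\<phi> \<in> Sigma0 1" "\<psi> \<in> Pi0 1"
  proof -
    have "comprehension \<phi> \<psi> \<in> {comprehension \<phi> \<psi> | \<phi> \<psi>. \<phi> \<in> Sigma0 1 \<and> \<psi> \<in> Pi0 1}"
      using that by blast
    then show ?thesis by (rule 1(3)[rule_format, OF _ range_s])
  qed
qed

lemma goal_2p7_true:
  fixes s :: "nat \<Rightarrow> 'a::pam set"
  assumes s: "range s \<subseteq> S" and T: "\<forall>\<phi>\<in>theory_2p7. sat S e s \<phi>"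
  shows "sat S e s goal_2p7"
proof -
  interpret sigma2_model S using s T by (rule sigma2_model_theory)
  have "sat S e s (AllFun (ExN (DNR (V 0) 0)))" using T by (simp add: theory_2p7_def)
  then have bounded: "\<exists>k g. {pr x (g x) | x. True} \<in> S \<and> (\<forall>x. g x < k) \<and> (\<forall>x. \<not> phi F x x (g x))"
    if "F \<in> S" "F = {pr x (f x) | x. True}" for F f
    using that by (auto simp: AllFun_def sat_IsFun sat_DNR)
  have "\<exists>g. {pr x (g x) | x. True} \<in> S \<and> (\<forall>x. g x < 2) \<and> (\<forall>x. \<not> phi F x x (g x))"
    if F: "F \<in> S" "F = {pr x (f x) | x. True}" for F f
  proof -
    interpret machine_model S F f using F by unfold_locales
    obtain k g where "{pr x (g x) | x. True} \<in> S" "\<And>x. g x < k" "\<And>x. \<not> phi F x x (g x)"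
      using bounded[OF F] by blast
    then show ?thesis by (rule two_valued_DNR)
  qed
  then show ?thesis unfolding goal_2p7_def
    by (auto simp: AllFun_def sat_IsFun sat_DNR)
qed

theorem theorem2p7:
  shows "RCA0 \<union> I_Sigma0 2 \<union> {AllFun (ExN (DNR (V 0) 0))} \<turnstile> AllFun (DNR (num 2) 0)"
  using provable_if_true_in_trm[OF goal_2p7_true] unfolding theory_2p7_def goal_2p7_def .

end
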